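(* Let $G$ be a group with a finite symmetric generating set $S$, and let $|S|=2k$. Let $g$ be obtained by random walk on $G$ (with respect to $S$) of length $n$ ($n$ even), conditioned to lie in $[G,G]$. Then for any $\epsilon>0$ there are constants $C_1>1$, $C_2>0$ so that with probability $1-O\left(C_1^{-n^{C_2}}\right)$ there is an inequality $$\mathrm{scl}(g)\le \frac{(k-1)\log(2k-1)+\epsilon}{6k}\cdot\frac{n}{\log n}.$$
   Context: Random walk of length $n$ with respect to $S$ means $g=s_1s_2\cdots s_n$ with the $s_i$ independent and uniformly distributed on $S$. The probability is the conditional probability given $g\in[G,G]$. For $g\in[G,G]$, the commutator length $\mathrm{cl}(g)$ is the least number of commutators in $G$ whose product is $g$, and the stable commutator length is $\mathrm{scl}(g)=\lim_{m\to\infty}\mathrm{cl}(g^m)/m$. The $O(\cdot)$ is as $n\to\infty$ through even integers. *)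

theory Defs
  imports "HOL-Probability.Probability" "HOL-Algebra.Generated_Groups" "HOL-Library.Landau_Symbols"
begin

definition list_prod :: "('a, 'b) monoid_scheme \<Rightarrow> 'a list \<Rightarrow> 'a" where
  "list_prod G xs = foldr (mult G) xs \<one>\<^bsub>G\<^esub>"

definition symmetric_generating_set :: "('a, 'b) monoid_scheme \<Rightarrow> 'a set \<Rightarrow> bool" where
  "symmetric_generating_set G S \<longleftrightarrow>
     S \<subseteq> carrier G \<and> (\<forall>s\<in>S. inv\<^bsub>G\<^esub> s \<in> S) \<and> generate G S = carrier G"

text \<open>The law of the endpoint of the walk; meaningful for finite nonempty \<open>S\<close>.\<close>

definition random_walk :: "('a, 'b) monoid_scheme \<Rightarrow> 'a set \<Rightarrow> nat \<Rightarrow> 'a pmf" where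
  "random_walk G S n = map_pmf (list_prod G) (replicate_pmf n (pmf_of_set S))"

abbreviation commutator_subgroup :: "('a, 'b) monoid_scheme \<Rightarrow> 'a set" where
  "commutator_subgroup G \<equiv> derived G (carrier G)"

text \<open>\<open>derived_set G (carrier G)\<close> is the set of all commutators of \<open>G\<close>.
  The functions \<open>cl\<close> and \<open>scl\<close> are only meaningful on the commutator subgroup. There the
  limit defining \<open>scl\<close> exists, since \<open>m \<mapsto> cl G (g [^] m)\<close> is subadditive.\<close>

definition cl :: "('a, 'b) monoid_scheme \<Rightarrow> 'a \<Rightarrow> nat" where
  "cl G g = (LEAST r. \<exists>cs. length cs = r \<and> set cs \<subseteq> derived_set G (carrier G) \<and> list_prod G cs = g)"

definition scl :: "('a, 'b) monoid_scheme \<Rightarrow> 'a \<Rightarrow> real" where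
  "scl G g = lim (\<lambda>m. real (cl G (g [^]\<^bsub>G\<^esub> m)) / real m)"

end

theory Submission
  imports Defs "HOL-Library.Poly_Mapping" "HOL-Real_Asymp.Real_Asymp"
begin

text \<open>
Why the bound holds. Let \<open>b = 2k - 1\<close>. Cancelling adjacent inverse letters turns a random word over
\<open>S\<close> into a reduced one. Its length performs a walk with drift \<open>(k - 1)/k\<close>, so that it is about
\<open>r = n(k - 1)/k\<close>, and given its length the reduced word \<open>w\<close> is uniformly distributed. In such a word
all reduced subwords of a length slightly below \<open>ln n / ln b\<close> occur almost equally often. Let \<open>L\<close> be
slightly below half that length, and match positions \<open>i\<close> and \<open>j\<close> of \<open>w\<close> when the \<open>L\<close> letters after \<open>i\<close>
are inverse to the \<open>L\<close> letters before \<open>j\<close>. Matched pairs are the edges of fatgraphs bounded by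
copies of \<open>w\<close>, and triples of pairwise matched positions are their trivalent vertices. Every edge
lies in almost the same number of triples, so that equal weights on all triples give, up to small
errors, a fractional fatgraph with boundary \<open>w\<close>. Each side of an edge uses \<open>L\<close> letters and each
vertex is the end of three edges, so there are \<open>r/(3L)\<close> vertices for one copy of \<open>w\<close>. Half as
many is \<open>-\<chi>\<close>, and \<open>scl\<close> is at most \<open>-\<chi>/2\<close>, which is \<open>r/(12L)\<close> or about \<open>r ln b / (6 ln n)\<close>.

The surfaces are replaced by algebra. A vertex is a relation \<open>abc = 1\<close>, called a triangle. If the
sides of \<open>R\<close> triangles, together with \<open>Q\<close> letters \<open>v\<close>, cancel in inverse pairs, then gluing the
triangles along common sides writes \<open>v\<close> to the power \<open>Q\<close> as a word of length about \<open>Q + R\<close> whose letters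
cancel in pairs. Such a word of length \<open>l\<close> is a product of at most \<open>l/4\<close> commutators, hence
\<open>scl v \<le> (R/Q + 1)/4\<close> (\<open>scl_le_filling\<close>). The best ratio \<open>R/Q\<close> is computed by duality
(\<open>scl_duality\<close>): it suffices to bound \<open>\<phi> v\<close> for all odd functions \<open>\<phi>\<close> with
\<open>\<bar>\<phi> a + \<phi> b - \<phi> (ab)\<bar> \<le> 1\<close>. Here \<open>\<phi>\<close> may be taken bounded on \<open>S\<close> by a constant that depends only on
\<open>G\<close> and \<open>S\<close>, because \<open>v\<close> lies in \<open>[G,G]\<close>; this makes the errors in the equidistribution harmless. For
such \<open>\<phi>\<close> the weighted count of vertices becomes a summation of inequalities over triples
(\<open>tame_cochain_equidistributed\<close>).

The exceptional events have probability at most \<open>exp (- n powr c)\<close> up to polynomial factors: a reduced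
word that is too long (\<open>card_long_reduction\<close>, by an exponential moment) and a reduced word that
is not equidistributed (\<open>card_not_equidistributed\<close>, by a Chernoff bound for windows that are separated
by gaps). Conditioning on \<open>[G,G]\<close> costs only a polynomial factor, because two
words of length \<open>n/2\<close> with the same letter counts give an element of \<open>[G,G]\<close> when one is
followed by the inverse of the other, and there are few possible letter counts
(\<open>card_words_in_derived\<close>).
\<close>

section \<open>Products of commutators\<close>

context group
begin

lemma list_prod_Nil [simp]: "list_prod G [] = \<one>"
  by (simp add: list_prod_def)

lemma list_prod_Cons [simp]: "list_prod G (x # xs) = x \<otimes> list_prod G xs"
  by (simp add: list_prod_def)

lemma list_prod_closed [simp, intro]: "set xs \<subseteq> carrier G \<Longrightarrow> list_prod G xs \<in> carrier G"
  by (induction xs) auto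

lemma list_prod_append [simp]:
  "set xs \<subseteq> carrier G \<Longrightarrow> set ys \<subseteq> carrier G \<Longrightarrow>
   list_prod G (xs @ ys) = list_prod G xs \<otimes> list_prod G ys"
  by (induction xs) (auto simp: m_assoc)

lemma list_prod_replicate:
  "x \<in> carrier G \<Longrightarrow> list_prod G (replicate n x) = x [^] n"
proof (induction n)
  case (Suc n)
  then show ?case using nat_pow_Suc2[of x n] by simp
qed simp

lemma inv_cancel_left:
  "p \<in> carrier G \<Longrightarrow> q \<in> carrier G \<Longrightarrow> p \<otimes> (inv p \<otimes> q) = q"
  "p \<in> carrier G \<Longrightarrow> q \<in> carrier G \<Longrightarrow> inv p \<otimes> (p \<otimes> q) = q"
  by (simp_all add: m_assoc[symmetric])

lemma list_prod_rev_inv: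
  "set xs \<subseteq> carrier G \<Longrightarrow> list_prod G (rev (map (m_inv G) xs)) = inv (list_prod G xs)"
proof (induction xs)
  case (Cons x xs)
  then have "set (rev (map (m_inv G) xs)) \<subseteq> carrier G" by auto
  with Cons show ?case by (simp add: inv_mult_group)
qed simp

definition commutators :: "'a set" where
  "commutators = derived_set G (carrier G)"

lemma commutators_iff:
  "c \<in> commutators \<longleftrightarrow> (\<exists>a\<in>carrier G. \<exists>b\<in>carrier G. c = a \<otimes> b \<otimes> inv a \<otimes> inv b)"
  by (simp add: commutators_def)

definition commutator_product :: "nat \<Rightarrow> 'a \<Rightarrow> bool" where
  "commutator_product r g \<longleftrightarrow>
     (\<exists>cs. length cs = r \<and> set cs \<subseteq> commutators \<and> list_prod G cs = g)"

lemma cl_eq_Least: "cl G g = (LEAST r. commutator_product r g)"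
  by (simp add: cl_def commutator_product_def commutators_def)

lemma commutators_carrier: "commutators \<subseteq> carrier G"
  unfolding commutators_def by (rule derived_set_in_carrier) simp

lemma commutator_product_carrier: "commutator_product r g \<Longrightarrow> g \<in> carrier G"
  unfolding commutator_product_def using commutators_carrier list_prod_closed by blast

lemma commutator_product_0: "commutator_product 0 \<one>"
  unfolding commutator_product_def by auto

lemma commutator_product_commutator:
  assumes "a \<in> carrier G" "b \<in> carrier G"
  shows "commutator_product 1 (a \<otimes> b \<otimes> inv a \<otimes> inv b)"
  unfolding commutator_product_def
  by (rule exI[of _ "[a \<otimes> b \<otimes> inv a \<otimes> inv b]"]) (use assms in \<open>auto simp: commutators_iff\<close>)

lemma commutator_product_mult:
  assumes "commutator_product r g" "commutator_product s h"
  shows "commutator_product (r + s) (g \<otimes> h)"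
proof -
  obtain cs ds where "length cs = r" "set cs \<subseteq> commutators" "list_prod G cs = g"
    "length ds = s" "set ds \<subseteq> commutators" "list_prod G ds = h"
    using assms unfolding commutator_product_def by blast
  moreover from this have "set cs \<subseteq> carrier G" "set ds \<subseteq> carrier G"
    using commutators_carrier by blast+
  ultimately show ?thesis unfolding commutator_product_def
    by (intro exI[of _ "cs @ ds"]) simp
qed

lemma commutator_product_mono:
  assumes "commutator_product r g" "r \<le> s"
  shows "commutator_product s g"
  using assms(2,1)
proof (induction rule: dec_induct)
  case (step n)
  then have "commutator_product n g" "commutator_product 1 \<one>"
    using commutator_product_commutator[of \<one> \<one>] by auto
  from commutator_product_mult[OF this] show ?case
    using commutator_product_carrier[OF step.prems] by simp
qed simp

lemma commutator_product_conj:
  assumes "commutator_product r g" "x \<in> carrier G"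
  shows "commutator_product r (x \<otimes> g \<otimes> inv x)"
proof -
  have conj: "x \<otimes> c \<otimes> inv x \<in> commutators" if c: "c \<in> commutators" for c
  proof -
    obtain a b where ab: "a \<in> carrier G" "b \<in> carrier G" "c = a \<otimes> b \<otimes> inv a \<otimes> inv b"
      using c unfolding commutators_iff by blast
    define a' where "a' = x \<otimes> a \<otimes> inv x"
    define b' where "b' = x \<otimes> b \<otimes> inv x"
    have cl: "a' \<in> carrier G" "b' \<in> carrier G" using ab assms by (auto simp: a'_def b'_def)
    have "x \<otimes> c \<otimes> inv x = a' \<otimes> b' \<otimes> inv a' \<otimes> inv b'"
      using ab assms(2) unfolding a'_def b'_def
      by (simp add: m_assoc inv_mult_group inv_cancel_left)
    with cl show ?thesis unfolding commutators_iff by blast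
  qed
  have "commutator_product (length cs) (x \<otimes> list_prod G cs \<otimes> inv x)"
    if "set cs \<subseteq> commutators" for cs
    using that
  proof (induction cs)
    case Nil
    then show ?case using assms(2) by (simp add: commutator_product_0)
  next
    case (Cons c cs)
    have cc: "c \<in> carrier G" "set cs \<subseteq> carrier G" using Cons.prems commutators_carrier by auto
    have "commutator_product 1 (x \<otimes> c \<otimes> inv x)"
      unfolding commutator_product_def
      by (rule exI[of _ "[x \<otimes> c \<otimes> inv x]"]) (use conj[of c] Cons.prems cc assms(2) in auto)
    from commutator_product_mult[OF this Cons.IH] Cons.prems
    have "commutator_product (1 + length cs) (x \<otimes> c \<otimes> inv x \<otimes> (x \<otimes> list_prod G cs \<otimes> inv x))" by auto
    moreover have "x \<otimes> c \<otimes> inv x \<otimes> (x \<otimes> list_prod G cs \<otimes> inv x) = x \<otimes> list_prod G (c # cs) \<otimes> inv x"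
      using cc assms(2) list_prod_closed[OF cc(2)]
      by (simp add: m_assoc inv_cancel_left)
    ultimately show ?case by simp
  qed
  with assms(1) show ?thesis unfolding commutator_product_def by metis
qed

lemma commutator_product_inv:
  assumes "commutator_product r g"
  shows "commutator_product r (inv g)"
proof -
  obtain cs where cs: "length cs = r" "set cs \<subseteq> commutators" "list_prod G cs = g"
    using assms unfolding commutator_product_def by blast
  have c: "set cs \<subseteq> carrier G" using cs commutators_carrier by blast
  have ginv: "inv c \<in> commutators" if c': "c \<in> commutators" for c
  proof -
    obtain a b where ab: "a \<in> carrier G" "b \<in> carrier G" "c = a \<otimes> b \<otimes> inv a \<otimes> inv b"
      using c' unfolding commutators_iff by blast
    have "inv c = b \<otimes> a \<otimes> inv b \<otimes> inv a" using ab by (simp add: inv_mult_group m_assoc)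
    then show ?thesis using ab unfolding commutators_iff by blast
  qed
  then have "set (rev (map (m_inv G) cs)) \<subseteq> commutators"
    using cs(2) by (simp only: set_rev set_map) blast
  then show ?thesis unfolding commutator_product_def
    using cs list_prod_rev_inv[OF c] by (intro exI[of _ "rev (map (m_inv G) cs)"]) simp
qed

lemma commutator_product_pow:
  assumes "commutator_product r g"
  shows "commutator_product (n * r) (g [^] (n::nat))"
proof (induction n)
  case (Suc n)
  from commutator_product_mult[OF this assms] show ?case by (simp add: add.commute)
qed (simp add: commutator_product_0)

lemma commutator_product_in_derived:
  assumes "commutator_product r g" shows "g \<in> derived G (carrier G)"
proof -
  obtain cs where cs: "set cs \<subseteq> commutators" "list_prod G cs = g"
    using assms unfolding commutator_product_def by blast
  have "list_prod G cs \<in> generate G (commutators)" using cs(1)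
    by (induction cs) (auto intro: generate.one generate.eng generate.incl)
  with cs show ?thesis by (simp add: derived_def commutators_def)
qed

lemma derived_commutator_product:
  assumes "g \<in> derived G (carrier G)" shows "\<exists>r. commutator_product r g"
proof -
  have *: "commutator_product 1 h" if "h \<in> commutators" for h
    using that commutator_product_commutator unfolding commutators_iff by blast
  have "g \<in> generate G (commutators)" using assms by (simp add: derived_def commutators_def)
  then show ?thesis
  proof (induction rule: generate.induct)
    case one then show ?case using commutator_product_0 by blast
  next
    case (incl h) then show ?case using * by blast
  next
    case (inv h) then show ?case using * commutator_product_inv by blast
  next
    case (eng h1 h2) then show ?case using commutator_product_mult by blast
  qed
qed

lemma derived_iff: "g \<in> derived G (carrier G) \<longleftrightarrow> (\<exists>r. commutator_product r g)"
  using commutator_product_in_derived derived_commutator_product by blast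

lemma cl_le: "commutator_product r g \<Longrightarrow> cl G g \<le> r"
  unfolding cl_eq_Least by (rule Least_le)

lemma commutator_product_cl: "g \<in> derived G (carrier G) \<Longrightarrow> commutator_product (cl G g) g"
  unfolding cl_eq_Least derived_iff by (rule LeastI_ex)

end

text \<open>Fekete's lemma: the limit exists and is the infimum of the quotients. Existence matters, since
\<open>lim\<close> has no meaning otherwise.\<close>

lemma lim_subadditive_le:
  fixes a :: "nat \<Rightarrow> real"
  assumes sub: "\<And>m n. a (m + n) \<le> a m + a n" and nonneg: "\<And>n. 0 \<le> a n" and N: "N \<ge> 1"
  shows "lim (\<lambda>m. a m / real m) \<le> a N / real N"
proof -
  define I where "I = (INF n\<in>{1..}. a n / real n)"
  have bdd: "bdd_below ((\<lambda>n. a n / real n) ` {1..})"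
    by (rule bdd_belowI[of _ 0]) (auto intro!: divide_nonneg_nonneg nonneg)
  have I_le: "I \<le> a n / n" if "n \<ge> 1" for n
    unfolding I_def by (rule cINF_lower[OF bdd]) (use that in auto)
  have mult: "a (q * n) \<le> q * a n" if "q \<ge> 1" for q n
    using that
  proof (induction q rule: dec_induct)
    case (step q)
    have "a (Suc q * n) \<le> a n + a (q * n)" using sub[of n "q * n"] by (simp add: add.commute)
    then show ?case using step by (simp add: algebra_simps)
  qed simp
  have "(\<lambda>m. a m / real m) \<longlonglongrightarrow> I"
  proof (rule LIMSEQ_I)
    fix e :: real assume e: "e > 0"
    have "\<exists>n\<in>{1..}. a n / real n < I + e / 2"
      using cINF_less_iff[OF _ bdd, of "I + e/2"] e unfolding I_def[symmetric] by auto
    then obtain n where n: "n \<ge> 1" "a n / real n < I + e / 2" by auto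
    define A where "A = (\<Sum>s\<le>2*n. a s)"
    have A: "a s \<le> A" if "s \<le> 2*n" for s
      unfolding A_def by (rule member_le_sum) (use that nonneg in auto)
    obtain M :: nat where M: "real M > 2 * A / e" using reals_Archimedean2 by blast
    show "\<exists>M. \<forall>m\<ge>M. norm (a m / m - I) < e"
    proof (intro exI[of _ "max (M + 1) (2*n)"] allI impI)
      fix m assume m: "m \<ge> max (M + 1) (2*n)"
      define q where "q = m div n"
      have q: "q \<ge> 1" using m n by (simp add: q_def div_greater_zero_iff Suc_leI)
      have meq: "m = q * n + m mod n" by (simp add: q_def)
      have "a m \<le> a (q * n) + a (m mod n)" using sub[of "q*n" "m mod n"] meq by simp
      also have "\<dots> \<le> q * a n + A" using mult[OF q, of n] A[of "m mod n"] n
        by (smt (verit) mod_less_divisor less_imp_le less_le_trans mult_2 trans_le_add1 Suc_le_eq One_nat_def)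
      also have "q * a n = (q * n) * (a n / n)" using n by simp
      also have "\<dots> \<le> m * (a n / n)"
        by (intro mult_right_mono) (use meq n nonneg in \<open>auto simp: of_nat_mult[symmetric] simp del: of_nat_mult\<close>)
      finally have am: "a m \<le> m * (a n / n) + A" by simp
      have mpos: "m > 0" using m by simp
      have "A / m < e / 2"
      proof -
        have "2 * A / e < m" using M m by linarith
        then show ?thesis using e mpos by (simp add: field_simps)
      qed
      moreover have "a m / m \<le> a n / n + A / m" using am mpos by (simp add: field_simps)
      ultimately have "a m / m < I + e" using n by linarith
      with I_le[of m] mpos show "norm (a m / m - I) < e" using e by (simp add: abs_if)
    qed
  qed
  then show ?thesis using I_le[OF N] by (simp add: limI)
qed

context group
begin

lemma scl_le_cl_pow:
  assumes g: "g \<in> derived G (carrier G)" and N: "N \<ge> 1" and r: "commutator_product r (g [^] (N::nat))"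
  shows "scl G g \<le> real r / real N"
proof -
  have gc: "g \<in> carrier G" using g derived_in_carrier by blast
  have pw: "g [^] m \<in> derived G (carrier G)" for m :: nat
    using g commutator_product_pow unfolding derived_iff by blast
  have "lim (\<lambda>m::nat. real (cl G (g [^] m)) / real m) \<le> real (cl G (g [^] N)) / real N"
  proof (rule lim_subadditive_le)
    fix m n :: nat
    have "commutator_product (cl G (g [^] m) + cl G (g [^] n)) (g [^] m \<otimes> g [^] n)"
      by (intro commutator_product_mult commutator_product_cl pw)
    then have "cl G (g [^] (m + n)) \<le> cl G (g [^] m) + cl G (g [^] n)"
      using gc by (intro cl_le) (simp add: nat_pow_mult)
    then show "real (cl G (g [^] (m + n))) \<le> real (cl G (g [^] m)) + real (cl G (g [^] n))" by simp
  qed (use N in auto)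
  also have "\<dots> \<le> real r / real N" using cl_le[OF r] by (simp add: divide_right_mono)
  finally show ?thesis unfolding scl_def .
qed

section \<open>Words whose letters cancel in pairs\<close>

text \<open>The condition that the letters can be grouped into pairs \<open>a\<close>, \<open>a\<inverse>\<close>. Equal counts do not suffice
for an involution, which has to be paired with another copy of itself.\<close>

definition balanced :: "'a multiset \<Rightarrow> bool" where
  "balanced M \<longleftrightarrow> (\<forall>a\<in>carrier G. count M a = count M (inv a) \<and> (a = inv a \<longrightarrow> even (count M a)))"

lemma balancedD:
  assumes "balanced M" "a \<in> carrier G"
  shows "count M a = count M (inv a)" "a = inv a \<Longrightarrow> even (count M a)"
  using assms unfolding balanced_def by blast+

lemma balanced_cancel:
  assumes a: "a \<in> carrier G"
  shows "balanced (add_mset a (add_mset (inv a) M)) \<longleftrightarrow> balanced M"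
  unfolding balanced_def
proof (rule ball_cong[OF refl])
  fix c assume c: "c \<in> carrier G"
  have "c = a \<longleftrightarrow> inv c = inv a" "c = inv a \<longleftrightarrow> inv c = a"
    using a c by (metis inv_inv)+
  then show "(count (add_mset a (add_mset (inv a) M)) c = count (add_mset a (add_mset (inv a) M)) (inv c) \<and>
          (c = inv c \<longrightarrow> even (count (add_mset a (add_mset (inv a) M)) c))) =
         (count M c = count M (inv c) \<and> (c = inv c \<longrightarrow> even (count M c)))"
    using a c by auto
qed

lemma balanced_empty [simp]: "balanced {#}"
  by (simp add: balanced_def)

lemma balanced_union: "balanced A \<Longrightarrow> balanced B \<Longrightarrow> balanced (A + B)"
  unfolding balanced_def count_union by (metis even_add)

lemma balanced_repeat: "balanced A \<Longrightarrow> balanced (repeat_mset n A)"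
  unfolding balanced_def count_repeat_mset by (metis even_mult_iff)

lemma balanced_split:
  assumes bal: "balanced (A + B)" and disj: "\<And>c. c \<in> carrier G \<Longrightarrow> c \<in># A \<Longrightarrow> inv c \<notin># B"
  shows "balanced A" "balanced B"
proof -
  have *: "count A c = count A (inv c) \<and> count B c = count B (inv c)" if c: "c \<in> carrier G" for c
  proof -
    have "count A c + count B c = count A (inv c) + count B (inv c)"
      using balancedD(1)[OF bal c] by (simp only: count_union)
    moreover have "count A c = 0 \<or> count B (inv c) = 0"
      using disj[of c] c by (metis count_eq_zero_iff)
    moreover have "count A (inv c) = 0 \<or> count B c = 0"
      using disj[of "inv c"] c by (metis count_eq_zero_iff inv_closed inv_inv)
    ultimately show ?thesis by linarith
  qed
  have ev: "even (count A c) \<and> even (count B c)" if c: "c \<in> carrier G" "c = inv c" for c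
  proof -
    have "even (count A c + count B c)" using balancedD(2)[OF bal c] by (simp only: count_union)
    moreover have "count A c = 0 \<or> count B c = 0"
      using disj[of c] c by (metis count_eq_zero_iff)
    ultimately show ?thesis by auto
  qed
  show "balanced A" "balanced B" using * ev unfolding balanced_def by blast+
qed

text \<open>Two crossing pairs of inverse letters form a handle: with \<open>h = xby\<close> and \<open>g = (zy)\<inverse>a\<close> the handle
is a conjugate of \<open>[g,h]\<close>, and the four remaining subwords survive in another order.\<close>

lemma crossing_identity:
  assumes "a \<in> carrier G" "b \<in> carrier G" "x \<in> carrier G" "y \<in> carrier G" "z \<in> carrier G" "w \<in> carrier G"
  shows "\<exists>u \<in> carrier G. \<exists>g \<in> carrier G. \<exists>h \<in> carrier G.
    a \<otimes> (x \<otimes> (b \<otimes> (y \<otimes> (inv a \<otimes> (z \<otimes> (inv b \<otimes> w)))))) =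
    u \<otimes> (g \<otimes> h \<otimes> inv g \<otimes> inv h) \<otimes> inv u \<otimes> (z \<otimes> (y \<otimes> (x \<otimes> w)))"
proof (intro bexI)
  let ?u = "z \<otimes> y" and ?g = "inv (z \<otimes> y) \<otimes> a" and ?h = "x \<otimes> (b \<otimes> y)"
  show "a \<otimes> (x \<otimes> (b \<otimes> (y \<otimes> (inv a \<otimes> (z \<otimes> (inv b \<otimes> w)))))) =
    ?u \<otimes> (?g \<otimes> ?h \<otimes> inv ?g \<otimes> inv ?h) \<otimes> inv ?u \<otimes> (z \<otimes> (y \<otimes> (x \<otimes> w)))"
    using assms by (simp add: m_assoc inv_mult_group inv_cancel_left)
qed (use assms in auto)

text \<open>Pair the first letter with an inverse copy of it. If some other pair crosses this one, a
commutator is split off and four letters disappear; otherwise the letters between and the letters after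
the pair are balanced separately.\<close>

lemma balanced_commutator_product:
  assumes "set Y \<subseteq> carrier G" "balanced (mset Y)"
  shows "commutator_product (length Y div 4) (list_prod G Y)"
  using assms
proof (induction Y rule: length_induct)
  case (1 Y)
  show ?case
  proof (cases Y)
    case Nil then show ?thesis by (simp add: commutator_product_0)
  next
    case (Cons a T)
    have a: "a \<in> carrier G" and T: "set T \<subseteq> carrier G" using 1 Cons by auto
    have "inv a \<in> set T"
    proof (rule ccontr)
      assume n: "inv a \<notin> set T"
      have c0: "count (mset T) (inv a) = 0" using n by (simp add: count_eq_zero_iff)
      have bal: "count (mset Y) a = count (mset Y) (inv a) \<and> (a = inv a \<longrightarrow> even (count (mset Y) a))"
        using balancedD[OF 1(3) a] by blast
      show False
      proof (cases "a = inv a")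
        case True
        then have "count (mset Y) a = 1" using c0 Cons by simp
        then show ?thesis using bal True by (metis odd_one)
      next
        case False
        then have "count (mset Y) (inv a) = 0" using c0 Cons by simp
        then show ?thesis using bal Cons by simp
      qed
    qed
    then obtain U V where UV: "T = U @ inv a # V" by (meson split_list)
    have UVc: "set U \<subseteq> carrier G" "set V \<subseteq> carrier G" using T UV by auto
    show ?thesis
    proof (cases "\<exists>b\<in>set U. inv b \<in> set V")
      case True
      then obtain b where b: "b \<in> set U" "inv b \<in> set V" by blast
      obtain X Y' where X: "U = X @ b # Y'" using b by (meson split_list)
      obtain Z W where Z: "V = Z @ inv b # W" using b by (meson split_list)
      have bc: "b \<in> carrier G" using b UVc by auto
      have cc: "set X \<subseteq> carrier G" "set Y' \<subseteq> carrier G" "set Z \<subseteq> carrier G" "set W \<subseteq> carrier G"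
        using UVc X Z by auto
      define R where "R = Z @ Y' @ X @ W"
      have Y: "Y = a # X @ b # Y' @ inv a # Z @ inv b # W" using Cons UV X Z by simp
      have "mset Y = add_mset a (add_mset (inv a) (add_mset b (add_mset (inv b) (mset R))))"
        unfolding Y R_def by (simp add: ac_simps)
      then have "balanced (mset R)" using 1(3) balanced_cancel a bc by metis
      moreover have "length R < length Y" "length Y = length R + 4" unfolding Y R_def by auto
      moreover have "set R \<subseteq> carrier G" using cc unfolding R_def by auto
      ultimately have IH: "commutator_product (length R div 4) (list_prod G R)" using 1(1) by blast
      obtain u g h where ugh: "u \<in> carrier G" "g \<in> carrier G" "h \<in> carrier G"
        and eq: "list_prod G Y = u \<otimes> (g \<otimes> h \<otimes> inv g \<otimes> inv h) \<otimes> inv u \<otimes> list_prod G R"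
        using crossing_identity[OF a bc list_prod_closed[OF cc(1)] list_prod_closed[OF cc(2)]
            list_prod_closed[OF cc(3)] list_prod_closed[OF cc(4)]] cc a bc
        unfolding Y R_def by auto
      from commutator_product_mult[OF commutator_product_conj[OF commutator_product_commutator[OF ugh(2,3)] ugh(1)] IH]
      show ?thesis using eq \<open>length Y = length R + 4\<close> by simp
    next
      case False
      have "mset Y = add_mset a (add_mset (inv a) (mset U + mset V))"
        using Cons UV by simp
      then have bal: "balanced (mset U + mset V)" using 1(3) balanced_cancel a by metis
      have "balanced (mset U)" "balanced (mset V)"
        using balanced_split[OF bal] False by auto
      moreover have "length U < length Y" "length V < length Y" using Cons UV by auto
      ultimately have IH: "commutator_product (length U div 4) (list_prod G U)"
         "commutator_product (length V div 4) (list_prod G V)" using 1(1) UVc by blast+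
      have "commutator_product (length U div 4 + length V div 4)
             (a \<otimes> list_prod G U \<otimes> inv a \<otimes> list_prod G V)"
        by (intro commutator_product_mult commutator_product_conj IH a)
      moreover have "list_prod G Y = a \<otimes> list_prod G U \<otimes> inv a \<otimes> list_prod G V"
        using Cons UV UVc a by (simp add: m_assoc list_prod_closed)
      moreover have "length U div 4 + length V div 4 \<le> length Y div 4" using Cons UV by simp
      ultimately show ?thesis using commutator_product_mono by metis
    qed
  qed
qed

section \<open>Gluing triangles\<close>

text \<open>The pair \<open>(a, b)\<close> stands for the relation between \<open>a\<close>, \<open>b\<close> and \<open>(ab)\<inverse>\<close>.\<close>

definition triangle :: "'a \<times> 'a \<Rightarrow> 'a list" where
  "triangle t = [fst t, snd t, inv (fst t \<otimes> snd t)]"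

lemma triangle_closed: "t \<in> carrier G \<times> carrier G \<Longrightarrow> set (triangle t) \<subseteq> carrier G"
  by (auto simp: triangle_def)

lemma list_prod_triangle: "t \<in> carrier G \<times> carrier G \<Longrightarrow> list_prod G (triangle t) = \<one>"
  by (auto simp: triangle_def m_assoc[symmetric])

lemma triangle_opposite:
  assumes "t \<in> carrier G \<times> carrier G" "e \<in> set (triangle t)"
  obtains x y where "x \<in> carrier G" "y \<in> carrier G" "mset (triangle t) = {#e, x, y#}" "inv e = x \<otimes> y"
proof -
  obtain a b where t: "t = (a, b)" "a \<in> carrier G" "b \<in> carrier G" using assms by auto
  consider "e = a" | "e = b" | "e = inv (a \<otimes> b)" using assms t by (auto simp: triangle_def)
  then show ?thesis
  proof cases
    case 1
    then show ?thesis using t by (intro that[of b "inv (a \<otimes> b)"])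
      (auto simp: triangle_def inv_mult_group m_assoc[symmetric])
  next
    case 2
    then show ?thesis using t by (intro that[of "inv (a \<otimes> b)" a])
      (auto simp: triangle_def inv_mult_group m_assoc)
  next
    case 3
    then show ?thesis using t by (intro that[of a b]) (auto simp: triangle_def)
  qed
qed

text \<open>While some triangle has a side inverse to a letter of \<open>X\<close>, that letter is replaced by the two
other sides of the triangle. This keeps the product and makes the word longer by one. When no triangle
fits, \<open>X\<close> is set aside and another triangle starts a new word, at the price of two more letters. By
balance no letter of the word set aside occurs in a remaining triangle, so the set of letters that are
left has become smaller. Hence new words are started at most \<open>\<kappa>\<close> times. The bound is independent of the
number of triangles, which is what makes it negligible for large multiples of a fixed filling.\<close>

lemma glue_triangles:
  assumes "set R \<subseteq> carrier G \<times> carrier G" "set X \<subseteq> carrier G"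
    and "balanced (mset X + mset (concat (map triangle R)))"
    and "card (set X \<union> set (concat (map triangle R))) \<le> \<kappa>"
  shows "\<exists>Y. set Y \<subseteq> carrier G \<and> balanced (mset Y) \<and> list_prod G Y = list_prod G X \<and>
    length Y + (if X = [] then 0 else 2) \<le> length X + length R + 2 * \<kappa>"
  using assms
proof (induction "length R" arbitrary: R X \<kappa> rule: less_induct)
  case less
  show ?case
  proof (cases "\<exists>t\<in>set R. \<exists>e\<in>set (triangle t). inv e \<in> set X")
    case True
    then obtain t e where te: "t \<in> set R" "e \<in> set (triangle t)" "inv e \<in> set X" by blast
    have tc: "t \<in> carrier G \<times> carrier G" using te less by auto
    have ec: "e \<in> carrier G" using te triangle_closed[OF tc] by auto
    obtain x y where xy: "x \<in> carrier G" "y \<in> carrier G" "mset (triangle t) = {#e, x, y#}" "inv e = x \<otimes> y"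
      using triangle_opposite[OF tc te(2)] by metis
    obtain X1 X2 where X: "X = X1 @ inv e # X2" using te by (meson split_list)
    have Xc: "set X1 \<subseteq> carrier G" "set X2 \<subseteq> carrier G" using less X by auto
    obtain R1 R2 where R: "R = R1 @ t # R2" using te by (meson split_list)
    define X' where "X' = X1 @ x # y # X2"
    define R' where "R' = R1 @ R2"
    have "mset X + mset (concat (map triangle R)) =
        add_mset e (add_mset (inv e) (mset X' + mset (concat (map triangle R'))))"
      unfolding X R X'_def R'_def using xy(3) by (simp add: ac_simps)
    then have bal: "balanced (mset X' + mset (concat (map triangle R')))"
      using less.prems(3) balanced_cancel ec by metis
    have xyt: "set (triangle t) = {e, x, y}" using arg_cong[OF xy(3), of set_mset] by simp
    have "set X' \<union> set (concat (map triangle R')) \<subseteq> set X \<union> set (concat (map triangle R))"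
      unfolding X R X'_def R'_def using xyt by auto
    then have card: "card (set X' \<union> set (concat (map triangle R'))) \<le> \<kappa>"
      using less.prems(4) by (meson card_mono le_trans finite_set finite_UnI)
    have "length R' < length R" "set R' \<subseteq> carrier G \<times> carrier G" "set X' \<subseteq> carrier G"
      using less Xc xy unfolding R R'_def X'_def by auto
    from less.hyps[OF this bal card] obtain Y where Y: "set Y \<subseteq> carrier G" "balanced (mset Y)"
      "list_prod G Y = list_prod G X'" "length Y + 2 \<le> length X' + length R' + 2 * \<kappa>"
      by (auto simp: X'_def)
    moreover have "list_prod G X' = list_prod G X"
      unfolding X X'_def using Xc xy ec by (simp add: m_assoc list_prod_closed)
    moreover have "length X' + length R' = length X + length R" unfolding X R X'_def R'_def by simp
    ultimately show ?thesis using X by (intro exI[of _ Y]) auto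
  next
    case False
    have disj: "c \<in># mset X \<Longrightarrow> inv c \<notin># mset (concat (map triangle R))" if "c \<in> carrier G" for c
      using False that by (auto simp: set_concat) (metis inv_inv)
    have balX: "balanced (mset X)" and balR: "balanced (mset (concat (map triangle R)))"
      using balanced_split[OF less.prems(3)] disj by auto
    show ?thesis
    proof (cases R)
      case Nil
      have "X \<noteq> [] \<Longrightarrow> \<kappa> \<ge> 1"
      proof -
        assume "X \<noteq> []"
        then have "card (set X) > 0" by (simp add: card_gt_0_iff)
        moreover have "card (set X) \<le> card (set X \<union> set (concat (map triangle R)))"
          by (rule card_mono) auto
        ultimately show ?thesis using less.prems(4) by linarith
      qed
      then show ?thesis using less.prems Nil balX by (intro exI[of _ X]) auto
    next
      case (Cons t R')
      define \<kappa>' where "\<kappa>' = (if X = [] then \<kappa> else \<kappa> - 1)"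
      have tc: "t \<in> carrier G \<times> carrier G" using less Cons by auto
      have card: "card (set (concat (map triangle R))) \<le> \<kappa>' \<and> (X \<noteq> [] \<longrightarrow> \<kappa> \<ge> 1)"
      proof (cases "X = []")
        case True then show ?thesis using less.prems(4) by (simp add: \<kappa>'_def)
      next
        case F: False
        then obtain a where a: "a \<in> set X" by (cases X) auto
        have ac: "a \<in> carrier G" using a less by auto
        have "inv a \<in># mset X" using balancedD(1)[OF balX ac] a
          by (metis count_eq_zero_iff in_multiset_in_set)
        then have "a \<notin> set (concat (map triangle R))" using disj[of "inv a"] ac by simp
        then have "card (insert a (set (concat (map triangle R)))) = Suc (card (set (concat (map triangle R))))"
          by simp
        moreover have "card (insert a (set (concat (map triangle R)))) \<le> card (set X \<union> set (concat (map triangle R)))"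
          by (rule card_mono) (use a in auto)
        ultimately show ?thesis using less.prems(4) F by (simp add: \<kappa>'_def)
      qed
      have "length R' < length R" "set R' \<subseteq> carrier G \<times> carrier G" "set (triangle t) \<subseteq> carrier G"
        using less Cons triangle_closed[OF tc] by auto
      moreover have "balanced (mset (triangle t) + mset (concat (map triangle R')))"
        using balR Cons by simp
      moreover have "card (set (triangle t) \<union> set (concat (map triangle R'))) \<le> \<kappa>'"
        using card Cons by simp
      ultimately obtain Y where Y: "set Y \<subseteq> carrier G" "balanced (mset Y)"
        "list_prod G Y = list_prod G (triangle t)"
        "length Y + 2 \<le> length (triangle t) + length R' + 2 * \<kappa>'"
        using less.hyps[of R' "triangle t" \<kappa>'] by (auto simp: triangle_def)
      show ?thesis
      proof (intro exI[of _ "X @ Y"] conjI)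
        show "list_prod G (X @ Y) = list_prod G X"
          using Y less.prems(2) list_prod_triangle[OF tc] by simp
        show "length (X @ Y) + (if X = [] then 0 else 2) \<le> length X + length R + 2 * \<kappa>"
          using Y(4) card Cons by (auto simp: triangle_def \<kappa>'_def)
      qed (use Y less.prems balX balanced_union in auto)
    qed
  qed
qed

text \<open>Many copies of the given filling are glued, so that the constant \<open>\<kappa>\<close>, which depends only on the
set of letters, disappears in the limit.\<close>

theorem scl_le_filling:
  assumes v: "v \<in> derived G (carrier G)" and Q: "Q \<ge> 1"
    and R: "set R \<subseteq> carrier G \<times> carrier G"
    and bal: "balanced (replicate_mset Q v + mset (concat (map triangle R)))"
  shows "scl G v \<le> (length R / Q + 1) / 4"
proof -
  have vc: "v \<in> carrier G" using v derived_in_carrier by blast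
  define \<kappa> where "\<kappa> = card (insert v (set (concat (map triangle R))))"
  have bound: "scl G v \<le> (length R / Q + 1) / 4 + (\<kappa> / (2 * Q)) * inverse (real (Suc n))" for n
  proof -
    let ?N = "Suc n"
    define X where "X = replicate (?N * Q) v"
    define R' where "R' = concat (replicate ?N R)"
    have "set (concat (map triangle R')) \<subseteq> set (concat (map triangle R))"
      unfolding R'_def by auto
    then have "set X \<union> set (concat (map triangle R')) \<subseteq> insert v (set (concat (map triangle R)))"
      unfolding X_def by auto
    then have card: "card (set X \<union> set (concat (map triangle R'))) \<le> \<kappa>"
      unfolding \<kappa>_def by (intro card_mono) auto
    have conc: "mset (concat (map triangle (concat (replicate m R)))) =
      repeat_mset m (mset (concat (map triangle R)))" for m
      by (induction m) (auto simp del: mset_concat)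
    have "mset X + mset (concat (map triangle R')) =
       repeat_mset ?N (replicate_mset Q v + mset (concat (map triangle R)))"
      unfolding X_def R'_def conc mset_replicate
      by (intro multiset_eqI) (auto simp add: distrib_left simp del: mset_concat)
    then have bal': "balanced (mset X + mset (concat (map triangle R')))"
      using balanced_repeat[OF bal] by presburger
    have len: "length R' = ?N * length R" unfolding R'_def by (simp add: length_concat sum_list_replicate)
    have "set R' \<subseteq> carrier G \<times> carrier G" "set X \<subseteq> carrier G"
      using R vc unfolding R'_def X_def by auto
    from glue_triangles[OF this bal' card] obtain Y where Y: "set Y \<subseteq> carrier G" "balanced (mset Y)"
      "list_prod G Y = list_prod G X" "length Y \<le> length X + length R' + 2 * \<kappa>" by auto
    have "commutator_product (length Y div 4) (v [^] (?N * Q))"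
      using balanced_commutator_product[OF Y(1,2)] Y(3) vc unfolding X_def by (simp add: list_prod_replicate)
    then have "scl G v \<le> real (length Y div 4) / real (?N * Q)"
      by (intro scl_le_cl_pow v) (use Q in auto)
    also have "\<dots> \<le> (real (length Y) / 4) / real (?N * Q)"
    proof (intro divide_right_mono)
      have "4 * (length Y div 4) \<le> length Y" by simp
      then show "real (length Y div 4) \<le> real (length Y) / 4" by linarith
    qed simp
    also have "\<dots> \<le> (real (?N * Q + ?N * length R + 2 * \<kappa>) / 4) / real (?N * Q)"
    proof (intro divide_right_mono)
      have "length Y \<le> ?N * Q + ?N * length R + 2 * \<kappa>"
        using Y(4) unfolding X_def len by (simp only: length_replicate)
      then show "real (length Y) \<le> real (?N * Q + ?N * length R + 2 * \<kappa>)"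
        by (simp only: of_nat_le_iff)
    qed simp_all
    also have "\<dots> = (length R / Q + 1) / 4 + (\<kappa> / (2 * Q)) * inverse (real ?N)"
    proof -
      have alg: "(x * q + x * l + 2 * d) / 4 / (x * q) = (l / q + 1) / 4 + d / (2 * q) * inverse x"
        if "x > 0" "q > 0" for x q l d :: real
        using that by (simp add: field_simps)
      show ?thesis unfolding of_nat_add of_nat_mult of_nat_numeral by (rule alg) (use Q in auto)
    qed
    finally show ?thesis .
  qed
  have "(\<lambda>n. (length R / Q + 1) / 4 + (\<kappa> / (2 * Q)) * inverse (real (Suc n))) \<longlonglongrightarrow>
     (length R / Q + 1) / 4 + (\<kappa> / (2 * Q)) * 0"
    by (intro tendsto_intros LIMSEQ_inverse_real_of_nat)
  from LIMSEQ_le_const[OF this] bound show ?thesis by auto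
qed

end

section \<open>A Hahn-Banach theorem for abelian groups\<close>

lemma le_cInf_add:
  fixes c :: real
  assumes "X \<noteq> {}" "Y \<noteq> {}" "\<And>a b. a \<in> X \<Longrightarrow> b \<in> Y \<Longrightarrow> c \<le> a + b"
  shows "c \<le> Inf X + Inf Y"
proof -
  have "c - b \<le> Inf X" if "b \<in> Y" for b
    by (rule cInf_greatest) (use assms that in \<open>auto simp: diff_le_eq\<close>)
  then have "c - Inf X \<le> Inf Y"
    by (intro cInf_greatest) (use assms in \<open>auto simp: algebra_simps\<close>)
  then show ?thesis by simp
qed

definition multiple :: "nat \<Rightarrow> 'a::ab_group_add \<Rightarrow> 'a" where
  "multiple n x = (\<Sum>i<n. x)"

lemma multiple_0 [simp]: "multiple 0 x = 0"
  and multiple_Suc: "multiple (Suc n) x = multiple n x + x"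
  and multiple_1 [simp]: "multiple (Suc 0) x = x"
  by (simp_all add: multiple_def)

lemma multiple_add: "multiple (m + n) x = multiple m x + multiple n x"
  by (induction n) (simp_all add: multiple_Suc)

lemma multiple_distrib: "multiple n (x + y) = multiple n x + multiple n y"
  by (simp add: multiple_def sum.distrib)

lemma multiple_mult: "multiple (m * n) x = multiple m (multiple n x)"
  by (induction m) (simp_all add: multiple_Suc multiple_add add.commute)

lemma multiple_minus: "multiple n (- x) = - multiple n x"
  by (simp add: multiple_def sum_negf)

lemma multiple_zero [simp]: "multiple n 0 = 0"
  by (simp add: multiple_def)

definition sublinear :: "('a::ab_group_add \<Rightarrow> real) \<Rightarrow> bool" where
  "sublinear q \<longleftrightarrow> (\<forall>x y. q (x + y) \<le> q x + q y) \<and> (\<forall>n x. q (multiple n x) = real n * q x)"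

lemma sublinearD:
  assumes "sublinear q"
  shows "q (x + y) \<le> q x + q y" "q (multiple n x) = real n * q x" "q 0 = 0" "- q (- x) \<le> q x"
proof -
  show *: "q (x + y) \<le> q x + q y" "q (multiple n x) = real n * q x" for x y n
    using assms unfolding sublinear_def by auto
  show z: "q 0 = 0" using *(2)[of 0 0] by simp
  show "- q (- x) \<le> q x" using *(1)[of x "-x"] z by simp
qed

lemma subadditive_multiple:
  assumes "\<And>x y. K (x + y) \<le> K x + K y" "n \<ge> 1"
  shows "K (multiple n x) \<le> real n * K x"
  using assms(2)
proof (induction n rule: dec_induct)
  case (step n)
  have "K (multiple (Suc n) x) \<le> K (multiple n x) + K x" unfolding multiple_Suc by (rule assms(1))
  with step show ?case by (simp add: algebra_simps)
qed simp

text \<open>Common core of the two constructions below, homogenization and descent, which are both infima of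
\<open>F m n x / m\<close> over \<open>m \<ge> 1\<close> and \<open>n\<close>.\<close>

lemma sublinear_Inf:
  fixes F :: "nat \<Rightarrow> nat \<Rightarrow> 'a::ab_group_add \<Rightarrow> real"
  assumes bdd: "\<And>m n x. m \<ge> 1 \<Longrightarrow> L x \<le> F m n x / real m"
    and sub: "\<And>m n m' n' x y. m \<ge> 1 \<Longrightarrow> m' \<ge> 1 \<Longrightarrow>
        F (m * m') (m' * n + m * n') (x + y) \<le> real m' * F m n x + real m * F m' n' y"
    and mult: "\<And>m n j x. F m n (multiple j x) = F (m * j) n x"
    and zero: "\<And>m n. F m n 0 = 0"
  shows "sublinear (\<lambda>x. Inf {F m n x / real m | m n. m \<ge> 1})"
proof -
  define X where "X x = {F m n x / real m | m n. m \<ge> 1}" for x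
  have ne: "X x \<noteq> {}" for x unfolding X_def by blast
  have bd: "bdd_below (X x)" for x by (rule bdd_belowI[of _ "L x"]) (auto simp: X_def intro: bdd)
  have low: "Inf (X x) \<le> F m n x / real m" if "m \<ge> 1" for m n x
    by (rule cInf_lower[OF _ bd]) (use that in \<open>auto simp: X_def\<close>)
  have add: "Inf (X (x + y)) \<le> Inf (X x) + Inf (X y)" for x y
  proof (rule le_cInf_add[OF ne ne])
    fix a b assume "a \<in> X x" "b \<in> X y"
    then obtain m n m' n' where *: "m \<ge> 1" "m' \<ge> 1" "a = F m n x / real m" "b = F m' n' y / real m'"
      by (auto simp: X_def)
    have "Inf (X (x + y)) \<le> F (m * m') (m' * n + m * n') (x + y) / real (m * m')"
      by (rule low) (use * in simp)
    also have "\<dots> \<le> (real m' * F m n x + real m * F m' n' y) / real (m * m')"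
      by (intro divide_right_mono sub) (use * in auto)
    also have "\<dots> = a + b" using * by (simp add: field_simps)
    finally show "Inf (X (x + y)) \<le> a + b" .
  qed
  have hom: "Inf (X (multiple j x)) = real j * Inf (X x)" for j x
  proof (cases "j = 0")
    case True
    have "X 0 = {0}" unfolding X_def zero by auto
    then show ?thesis using True by simp
  next
    case False
    then have j: "j \<ge> 1" by simp
    have "Inf (X (multiple j x)) \<le> real j * Inf (X x)"
      by (rule subadditive_multiple[of "\<lambda>x. Inf (X x)", OF add j])
    moreover have "real j * Inf (X x) \<le> Inf (X (multiple j x))"
    proof (rule cInf_greatest[OF ne])
      fix a assume "a \<in> X (multiple j x)"
      then obtain m n where *: "m \<ge> 1" "a = F m n (multiple j x) / real m" by (auto simp: X_def)
      have "Inf (X x) \<le> F (m * j) n x / real (m * j)" by (rule low) (use * j in simp)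
      also have "\<dots> = a / j" using * j by (simp add: mult field_simps)
      finally show "real j * Inf (X x) \<le> a" using j by (simp add: field_simps)
    qed
    ultimately show ?thesis by simp
  qed
  show ?thesis unfolding sublinear_def X_def[symmetric] using add hom by blast
qed

lemma sublinear_homogenization:
  assumes sub: "\<And>x y. K (x + y) \<le> K x + K y" and nonneg: "\<And>x. 0 \<le> K x" and zero: "K 0 = 0"
  shows "sublinear (\<lambda>x. Inf {K (multiple m x) / real m | m n :: nat. m \<ge> 1})"
proof (rule sublinear_Inf[where L = "\<lambda>_. 0"])
  fix m n m' n' :: nat and x y assume m: "m \<ge> 1" "m' \<ge> 1"
  have "K (multiple (m * m') (x + y)) \<le> K (multiple (m' * m) x) + K (multiple (m * m') y)"
    unfolding multiple_distrib by (subst (2) mult.commute) (rule sub)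
  also have "\<dots> \<le> real m' * K (multiple m x) + real m * K (multiple m' y)"
    unfolding multiple_mult using m by (intro add_mono subadditive_multiple sub)
  finally show "K (multiple (m * m') (x + y)) \<le> real m' * K (multiple m x) + real m * K (multiple m' y)" .
qed (auto simp: nonneg zero multiple_mult)

text \<open>A sublinear function that is not odd at \<open>y\<close> can be lowered. The new function is the infimum of
\<open>(q (mx + ny) - n q y) / m\<close>, and \<open>m = n = 1\<close> gives the value at \<open>-y\<close>.\<close>

lemma sublinear_descent:
  assumes q: "sublinear q"
  obtains q' where "sublinear q'" "q' \<le> q" "q' (- y) \<le> - q y"
proof -
  let ?F = "\<lambda>m n x. q (multiple m x + multiple n y) - real n * q y"
  define q' where "q' = (\<lambda>x. Inf {?F m n x / real m | m n. m \<ge> 1})"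
  have bdd: "- q (- x) \<le> ?F m n x / real m" if m: "m \<ge> 1" for m n x
  proof -
    have "real n * q y = q ((multiple m x + multiple n y) + multiple m (- x))"
      by (simp add: sublinearD(2)[OF q, symmetric] multiple_minus)
    also have "\<dots> \<le> q (multiple m x + multiple n y) + real m * q (- x)"
      using sublinearD(1)[OF q] by (simp add: sublinearD(2)[OF q, symmetric])
    finally show ?thesis using m by (simp add: field_simps)
  qed
  have low: "q' x \<le> ?F m n x / real m" if "m \<ge> 1" for m n x
    unfolding q'_def
    by (rule cInf_lower) (use that in \<open>auto intro!: bdd_belowI[of _ "- q (- x)"] bdd\<close>)
  show thesis
  proof
    show "sublinear q'" unfolding q'_def
    proof (rule sublinear_Inf[OF bdd])
      fix m n m' n' :: nat and x z assume m: "m \<ge> 1" "m' \<ge> 1"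
      have "multiple (m * m') (x + z) + multiple (m' * n + m * n') y =
         multiple m' (multiple m x + multiple n y) + multiple m (multiple m' z + multiple n' y)"
        by (simp add: multiple_distrib multiple_add multiple_mult[symmetric] mult.commute algebra_simps)
      then have "q (multiple (m * m') (x + z) + multiple (m' * n + m * n') y) \<le>
         real m' * q (multiple m x + multiple n y) + real m * q (multiple m' z + multiple n' y)"
        using sublinearD(1)[OF q, of "multiple m' (multiple m x + multiple n y)"
            "multiple m (multiple m' z + multiple n' y)"]
        by (simp only: sublinearD(2)[OF q])
      then show "?F (m * m') (m' * n + m * n') (x + z) \<le> real m' * ?F m n x + real m * ?F m' n' z"
        by (simp add: algebra_simps)
    qed (simp_all add: multiple_mult sublinearD(2)[OF q])
    show "q' \<le> q" using low[of 1 _ 0] by (auto simp: le_fun_def)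
    show "q' (- y) \<le> - q y" using low[of 1 "-y" 1] by (simp add: sublinearD(3)[OF q])
  qed
qed

text \<open>By Zorn's lemma there is a minimal sublinear function below \<open>p\<close>. By descent it is odd, and an odd
sublinear function is additive.\<close>

lemma sublinear_above_additive:
  assumes p: "sublinear (p :: 'a::ab_group_add \<Rightarrow> real)"
  obtains f where "f \<le> p" "\<And>x y. f (x + y) = f x + f y"
proof -
  let ?A = "{q. sublinear q \<and> q \<le> p}" and ?P = "\<lambda>q q' :: 'a \<Rightarrow> real. q' \<le> q"
  have "\<exists>m\<in>?A. \<forall>a\<in>?A. ?P m a \<longrightarrow> a = m"
  proof (rule predicate_Zorn)
    show "partial_order_on ?A (relation_of ?P ?A)"
      by (rule partial_order_on_relation_ofI) auto
    fix C assume C: "C \<in> Chains (relation_of ?P ?A)"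
    then have CA: "C \<subseteq> ?A" and ch: "\<And>q q'. q \<in> C \<Longrightarrow> q' \<in> C \<Longrightarrow> q \<le> q' \<or> q' \<le> q"
      by (auto simp: Chains_def relation_of_def)
    show "\<exists>u\<in>?A. \<forall>a\<in>C. ?P a u"
    proof (cases "C = {}")
      case True
      then show ?thesis using p by auto
    next
      case False
      define u where "u x = Inf ((\<lambda>q. q x) ` C)" for x
      have bdd: "bdd_below ((\<lambda>q. q x) ` C)" for x
      proof (rule bdd_belowI2)
        fix q assume "q \<in> C"
        then have "sublinear q" "q \<le> p" using CA by auto
        then show "- p (- x) \<le> q x"
          using sublinearD(4)[of q x] le_funD[of q p "-x"] by linarith
      qed
      have low: "u x \<le> q x" if "q \<in> C" for q x
        unfolding u_def by (rule cInf_lower[OF _ bdd]) (use that in auto)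
      have add: "u (x + y) \<le> u x + u y" for x y
      proof (subst (2 3) u_def, rule le_cInf_add)
        fix a b assume "a \<in> (\<lambda>q. q x) ` C" "b \<in> (\<lambda>q. q y) ` C"
        then obtain q1 q2 where q: "q1 \<in> C" "a = q1 x" "q2 \<in> C" "b = q2 y" by auto
        then obtain q where q': "q \<in> C" "q \<le> q1" "q \<le> q2" using ch[of q1 q2] by blast
        have "u (x + y) \<le> q (x + y)" using low q' by blast
        also have "\<dots> \<le> q x + q y" using sublinearD(1) CA q' by blast
        also have "\<dots> \<le> a + b" using q q' by (auto simp: le_fun_def intro: add_mono)
        finally show "u (x + y) \<le> a + b" .
      qed (use False in auto)
      have hom: "u (multiple n x) = real n * u x" for n x
      proof -
        have "(\<lambda>q. q (multiple n x)) ` C = (\<lambda>q. real n * q x) ` C"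
          by (rule image_cong) (use CA sublinearD(2) in auto)
        then have "u (multiple n x) = Inf ((\<lambda>q. real n * q x) ` C)" by (simp add: u_def)
        also have "\<dots> = real n * u x"
        proof (cases "n = 0")
          case False
          have "mono (\<lambda>r. real n * r)" by (auto simp: mono_def mult_left_mono)
          moreover have "continuous (at_right (Inf ((\<lambda>q. q x) ` C))) (\<lambda>r. real n * r)"
            by (intro continuous_intros)
          ultimately show ?thesis
            using continuous_at_Inf_mono[of "\<lambda>r. real n * r" "(\<lambda>q. q x) ` C"] bdd \<open>C \<noteq> {}\<close>
            by (simp add: u_def image_image)
        qed (use \<open>C \<noteq> {}\<close> in simp)
        finally show ?thesis .
      qed
      obtain q0 where "q0 \<in> C" using False by blast
      then have "u \<le> p" using low[of q0] CA by (auto simp: le_fun_def intro: order_trans)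
      moreover have "sublinear u" using add hom by (auto simp: sublinear_def)
      ultimately show ?thesis using low by (intro bexI[of _ u]) (auto simp: le_fun_def)
    qed
  qed
  then obtain f where f: "sublinear f" "f \<le> p"
    and min: "\<And>q. sublinear q \<Longrightarrow> q \<le> p \<Longrightarrow> q \<le> f \<Longrightarrow> q = f" by blast
  have odd: "f (- y) = - f y" for y
  proof (rule antisym)
    obtain q' where q': "sublinear q'" "q' \<le> f" "q' (- y) \<le> - f y" by (rule sublinear_descent[OF f(1), of y])
    then have "q' = f" using min f order_trans by blast
    then show "f (- y) \<le> - f y" using q' by simp
    show "- f y \<le> f (- y)" using sublinearD(4)[OF f(1), of "-y"] by simp
  qed
  have "f (x + y) = f x + f y" for x y
  proof (rule antisym)
    show "f (x + y) \<le> f x + f y" by (rule sublinearD(1)[OF f(1)])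
    have "f (- x + - y) \<le> f (- x) + f (- y)" by (rule sublinearD(1)[OF f(1)])
    then show "f x + f y \<le> f (x + y)" using odd[of "x + y"] by (simp add: odd)
  qed
  with f that show thesis by blast
qed

text \<open>Descending once at \<open>x0\<close> before minimizing forces the additive function to take at \<open>x0\<close> the value of
the homogenization of \<open>K\<close>; so it is attained up to \<open>e\<close> by some multiple of \<open>x0\<close>.\<close>

theorem Hahn_Banach_subadditive:
  fixes K :: "'a::ab_group_add \<Rightarrow> real"
  assumes sub: "\<And>x y. K (x + y) \<le> K x + K y" and nonneg: "\<And>x. 0 \<le> K x" and zero: "K 0 = 0"
  obtains f where "\<And>x y. f (x + y) = f x + f y" "\<And>x. f x \<le> K x"
    "\<And>e. e > 0 \<Longrightarrow> \<exists>Q\<ge>1. K (multiple Q x0) < real Q * (f x0 + e)"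
proof -
  define X where "X x = {K (multiple m x) / real m | m n :: nat. m \<ge> 1}" for x
  define p where "p = (\<lambda>x. Inf (X x))"
  have p: "sublinear p" unfolding p_def X_def by (rule sublinear_homogenization[OF assms])
  have pK: "p x \<le> K x" for x unfolding p_def
    by (rule cInf_lower) (auto simp: X_def nonneg intro!: bdd_belowI[of _ 0] exI[of _ 1])
  obtain p' where p': "sublinear p'" "p' \<le> p" "p' (- x0) \<le> - p x0"
    by (rule sublinear_descent[OF p, of x0])
  obtain f where f: "f \<le> p'" and add: "\<And>x y. f (x + y) = f x + f y"
    by (rule sublinear_above_additive[OF p'(1)]) blast
  have f0: "f 0 = 0" using add[of 0 0] by simp
  have "f (- x0) \<le> - p x0" using f p'(3) by (auto simp: le_fun_def intro: order_trans)
  then have fp: "p x0 \<le> f x0" using add[of x0 "-x0"] f0 by simp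
  show thesis
  proof
    show "f (x + y) = f x + f y" for x y by (rule add)
    show "f x \<le> K x" for x
      using le_funD[OF f, of x] le_funD[OF p'(2), of x] pK[of x] by linarith
    fix e :: real assume e: "e > 0"
    have "Inf (X x0) < f x0 + e" using fp e unfolding p_def by simp
    moreover have "X x0 \<noteq> {}" unfolding X_def by blast
    moreover have "bdd_below (X x0)" unfolding X_def by (auto intro!: bdd_belowI[of _ 0] divide_nonneg_nonneg nonneg)
    ultimately obtain a where "a \<in> X x0" "a < f x0 + e" using cInf_less_iff by blast
    then obtain m where "m \<ge> 1" "K (multiple m x0) / real m < f x0 + e" by (auto simp: X_def)
    then show "\<exists>Q\<ge>1. K (multiple Q x0) < real Q * (f x0 + e)"
      by (intro exI[of _ m]) (simp add: field_simps)
  qed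
qed

section \<open>Fillings and their dual cochains\<close>

text \<open>Dickson's lemma. For the inductive step, the functions that are not dominated from below by the
finite set found for \<open>S\<close> take one of finitely many values at \<open>s\<close>.\<close>

lemma dickson:
  fixes A :: "('a \<Rightarrow> nat) set"
  assumes "finite S"
  shows "\<exists>B\<subseteq>A. finite B \<and> (\<forall>f\<in>A. \<exists>g\<in>B. \<forall>s\<in>S. g s \<le> f s)"
  using assms
proof (induction S arbitrary: A rule: finite_induct)
  case empty
  show ?case
  proof (cases "A = {}")
    case False
    then obtain f where "f \<in> A" by blast
    then show ?thesis by (intro exI[of _ "{f}"]) auto
  qed auto
next
  case (insert s S)
  obtain B0 where B0: "B0 \<subseteq> A" "finite B0" "\<forall>f\<in>A. \<exists>g\<in>B0. \<forall>s\<in>S. g s \<le> f s"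
    using insert.IH[of A] by blast
  define N where "N = (\<Sum>g\<in>B0. g s)"
  have N: "g s \<le> N" if "g \<in> B0" for g
    unfolding N_def by (rule member_le_sum) (use that B0 in auto)
  define P where "P j B \<longleftrightarrow> B \<subseteq> {f\<in>A. f s = j} \<and> finite B \<and>
    (\<forall>f\<in>{f\<in>A. f s = j}. \<exists>g\<in>B. \<forall>s\<in>S. g s \<le> f s)" for j B
  have "\<forall>j. \<exists>B. P j B" unfolding P_def using insert.IH by blast
  then obtain Bj where Bj': "\<And>j. P j (Bj j)" by metis
  have Bj: "Bj j \<subseteq> {f\<in>A. f s = j}" "finite (Bj j)"
    "f \<in> A \<Longrightarrow> f s = j \<Longrightarrow> \<exists>g\<in>Bj j. \<forall>s\<in>S. g s \<le> f s" for j f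
    using Bj'[of j] unfolding P_def by auto
  define B where "B = B0 \<union> (\<Union>j<N. Bj j)"
  have "\<exists>g\<in>B. \<forall>t\<in>insert s S. g t \<le> f t" if f: "f \<in> A" for f
  proof (cases "f s < N")
    case True
    obtain g where g: "g \<in> Bj (f s)" "\<forall>t\<in>S. g t \<le> f t" using Bj(3)[OF f refl] by blast
    then have "g s = f s" using Bj(1) by blast
    with g True show ?thesis by (intro bexI[of _ g]) (auto simp: B_def)
  next
    case False
    obtain g where "g \<in> B0" "\<forall>t\<in>S. g t \<le> f t" using B0 f by blast
    with N[of g] False show ?thesis by (intro bexI[of _ g]) (auto simp: B_def)
  qed
  moreover have "B \<subseteq> A" "finite B" using B0 Bj(1,2) unfolding B_def by blast+
  ultimately show ?case by blast
qed

type_synonym 'a chain = "'a \<Rightarrow>\<^sub>0 int"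

abbreviation cell :: "'a \<Rightarrow> 'a chain" where
  "cell a \<equiv> Poly_Mapping.single a 1"

definition chain :: "'a list \<Rightarrow> 'a chain" where
  "chain xs = sum_list (map cell xs)"

lemma chain_Nil [simp]: "chain [] = 0"
  and chain_Cons [simp]: "chain (x # xs) = cell x + chain xs"
  and chain_append [simp]: "chain (xs @ ys) = chain xs + chain ys"
  by (simp_all add: chain_def)

lemma lookup_chain: "Poly_Mapping.lookup (chain xs) a = int (count (mset xs) a)"
  by (induction xs) (auto simp: lookup_add lookup_single)

lemma chain_mset_eq: "mset xs = mset ys \<Longrightarrow> chain xs = chain ys"
  by (rule poly_mapping_eqI) (simp add: lookup_chain)

lemma chain_replicate: "chain (replicate n a) = multiple n (cell a)"
  by (induction n) (simp_all add: multiple_Suc add.commute)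

context group
begin

text \<open>The chains that vanish once \<open>a\<inverse>\<close> is identified with \<open>-a\<close> and twice an involution
with zero. Coefficients outside the carrier are ignored.\<close>

definition null_chain :: "'a chain \<Rightarrow> bool" where
  "null_chain c \<longleftrightarrow> (\<forall>a\<in>carrier G. Poly_Mapping.lookup c a = Poly_Mapping.lookup c (inv a) \<and> (a = inv a \<longrightarrow> even (Poly_Mapping.lookup c a)))"

lemma triangles_closed:
  "set R \<subseteq> carrier G \<times> carrier G \<Longrightarrow> set (concat (map triangle R)) \<subseteq> carrier G"
  unfolding set_concat set_map using triangle_closed by blast

lemma list_prod_triangles:
  "set R \<subseteq> carrier G \<times> carrier G \<Longrightarrow> list_prod G (concat (map triangle R)) = \<one>"
proof (induction R)
  case (Cons t R)
  have t: "t \<in> carrier G \<times> carrier G" and R: "set R \<subseteq> carrier G \<times> carrier G" using Cons.prems by auto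
  show ?case using Cons.IH[OF R] list_prod_append[OF triangle_closed[OF t] triangles_closed[OF R]]
      list_prod_triangle[OF t] by simp
qed simp

lemma null_chain_iff_balanced: "null_chain (chain xs) \<longleftrightarrow> balanced (mset xs)"
  unfolding null_chain_def balanced_def lookup_chain by simp

lemma null_chain_add: "null_chain c \<Longrightarrow> null_chain d \<Longrightarrow> null_chain (c + d)"
  unfolding null_chain_def lookup_add by (metis even_add)

lemma null_chain_minus: "null_chain c \<Longrightarrow> null_chain (- c)"
  unfolding null_chain_def by (metis even_minus lookup_uminus)

lemma null_chain_0: "null_chain 0"
  by (simp add: null_chain_def)

lemma null_chain_outside: "a \<notin> carrier G \<Longrightarrow> null_chain (Poly_Mapping.single a n)"
  unfolding null_chain_def lookup_single by (auto simp: when_def)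

lemma balanced_inverses:
  "set_mset M \<subseteq> carrier G \<Longrightarrow> balanced (M + image_mset (m_inv G) M)"
proof (induction M)
  case (add x M)
  then show ?case using balanced_cancel[of x "M + image_mset (m_inv G) M"]
    by (simp add: add_mset_commute)
qed simp

lemma null_chain_cell_inv: "a \<in> carrier G \<Longrightarrow> null_chain (cell a + cell (inv a))"
  using null_chain_iff_balanced[of "[a, inv a]"] balanced_cancel[of a "{#}"] by simp

lemma balanced_cancel_inverses:
  assumes "set_mset M \<subseteq> carrier G" "balanced (N + (M + image_mset (m_inv G) M))"
  shows "balanced N"
  using assms by (induction M arbitrary: N) (auto simp: balanced_cancel add_mset_commute)

definition boundary :: "('a \<times> 'a) list \<Rightarrow> 'a chain" where
  "boundary R = chain (concat (map triangle R))"

lemma boundary_Nil [simp]: "boundary [] = 0"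
  and boundary_append [simp]: "boundary (R @ R') = boundary R + boundary R'"
  by (simp_all add: boundary_def)

text \<open>Fillings in which a triangle costs \<open>1\<close> and a letter of \<open>S\<close> costs \<open>C\<close>. Letters are admitted in order that every
chain has a filling; their cost will bound the dual functions on \<open>S\<close>.\<close>

definition fillable :: "'a set \<Rightarrow> nat \<Rightarrow> 'a chain \<Rightarrow> nat \<Rightarrow> bool" where
  "fillable S C c k \<longleftrightarrow> (\<exists>R D. set R \<subseteq> carrier G \<times> carrier G \<and> set D \<subseteq> S \<and>
     null_chain (c + boundary R + chain D) \<and> k = length R + C * length D)"

lemma fillable_null: "null_chain c \<Longrightarrow> fillable S C c 0"
  unfolding fillable_def by (intro exI[of _ "[]"]) simp

lemma fillable_add:
  assumes "fillable S C c k" "fillable S C c' k'"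
  shows "fillable S C (c + c') (k + k')"
proof -
  obtain R D R' D' where *: "set R \<subseteq> carrier G \<times> carrier G" "set D \<subseteq> S"
     "null_chain (c + boundary R + chain D)" "k = length R + C * length D"
     "set R' \<subseteq> carrier G \<times> carrier G" "set D' \<subseteq> S"
     "null_chain (c' + boundary R' + chain D')" "k' = length R' + C * length D'"
    using assms unfolding fillable_def by blast
  have "null_chain ((c + boundary R + chain D) + (c' + boundary R' + chain D'))"
    using * null_chain_add by blast
  then have "null_chain (c + c' + boundary (R @ R') + chain (D @ D'))"
    by (simp add: algebra_simps)
  then show ?thesis unfolding fillable_def
    using * by (intro exI[of _ "R @ R'"] exI[of _ "D @ D'"]) (auto simp: algebra_simps)
qed

lemma fillable_cong:
  assumes "fillable S C c k" "null_chain (c' - c)"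
  shows "fillable S C c' k"
  using fillable_add[OF assms(1) fillable_null[OF assms(2)]] by simp

lemma fillable_triangle:
  assumes t: "a \<in> carrier G" "b \<in> carrier G"
  shows "fillable S C (cell (a \<otimes> b) - cell a - cell b) 1" (is ?A)
    "fillable S C (cell a + cell b - cell (a \<otimes> b)) 1" (is ?B)
proof -
  have n: "null_chain (cell (a \<otimes> b) + cell (inv (a \<otimes> b)))"
    using t by (intro null_chain_cell_inv) simp
  have "null_chain (cell (a \<otimes> b) - cell a - cell b + boundary [(a, b)] + chain [])"
    using n by (simp add: boundary_def triangle_def algebra_simps)
  then show ?A unfolding fillable_def
    using t by (intro exI[of _ "[(a, b)]"] exI[of _ "[]"]) auto
  have "null_chain ((cell a + cell (inv a)) + (cell b + cell (inv b)))"
    using t by (intro null_chain_add null_chain_cell_inv)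
  moreover have "inv (inv b \<otimes> inv a) = a \<otimes> b" using t by (simp add: inv_mult_group)
  ultimately have "null_chain (cell a + cell b - cell (a \<otimes> b) + boundary [(inv b, inv a)] + chain [])"
    by (simp add: boundary_def triangle_def algebra_simps)
  then show ?B unfolding fillable_def
    using t by (intro exI[of _ "[(inv b, inv a)]"] exI[of _ "[]"]) auto
qed

lemma fillable_one: "fillable S C (cell \<one>) 1"
  using fillable_triangle(2)[of \<one> \<one> S C] by simp

lemma fillable_minus_cell:
  assumes "a \<in> carrier G" "fillable S C (cell (inv a)) k"
  shows "fillable S C (- cell a) k"
proof (rule fillable_cong[OF assms(2)])
  show "null_chain (- cell a - cell (inv a))"
    using null_chain_minus[OF null_chain_cell_inv[OF assms(1)]] by (simp add: algebra_simps)
qed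

lemma fillable_list_prod:
  assumes "set xs \<subseteq> carrier G"
  shows "\<exists>k. fillable S C (cell (list_prod G xs) - chain xs) k"
    "\<exists>k. fillable S C (chain xs - cell (list_prod G xs)) k"
proof -
  have "(\<exists>k. fillable S C (cell (list_prod G xs) - chain xs) k) \<and>
    (\<exists>k. fillable S C (chain xs - cell (list_prod G xs)) k)"
    using assms
  proof (induction xs)
    case Nil
    then show ?case using fillable_one[of S C] fillable_minus_cell[of \<one> S C 1] by auto
  next
    case (Cons x xs)
    then obtain k k' where k: "fillable S C (cell (list_prod G xs) - chain xs) k"
      "fillable S C (chain xs - cell (list_prod G xs)) k'" by auto
    have x: "x \<in> carrier G" "list_prod G xs \<in> carrier G" using Cons.prems by auto
    show ?case using fillable_add[OF fillable_triangle(1)[OF x] k(1)] fillable_add[OF fillable_triangle(2)[OF x] k(2)]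
      by (auto simp: algebra_simps)
  qed
  then show "\<exists>k. fillable S C (cell (list_prod G xs) - chain xs) k"
    "\<exists>k. fillable S C (chain xs - cell (list_prod G xs)) k" by auto
qed

lemma fillable_chain:
  assumes "\<And>x. x \<in> set xs \<Longrightarrow> \<exists>k. fillable S C (cell x) k"
  shows "\<exists>k. fillable S C (chain xs) k"
  using assms
proof (induction xs)
  case Nil
  then show ?case using fillable_null[OF null_chain_0] by auto
next
  case (Cons x xs)
  then obtain k k' where "fillable S C (cell x) k" "fillable S C (chain xs) k'"
    by (metis list.set_intros)
  from fillable_add[OF this] show ?case by auto
qed

lemma fillable_list_prod_cell:
  assumes "set xs \<subseteq> carrier G" "\<And>x. x \<in> set xs \<Longrightarrow> \<exists>k. fillable S C (cell x) k"
  shows "\<exists>k. fillable S C (cell (list_prod G xs)) k"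
proof -
  obtain k k' where "fillable S C (cell (list_prod G xs) - chain xs) k" "fillable S C (chain xs) k'"
    using fillable_list_prod(1)[OF assms(1)] fillable_chain[OF assms(2)] by metis
  from fillable_add[OF this] show ?thesis by auto
qed

lemma fillable_derived:
  assumes "g \<in> derived G (carrier G)"
  shows "\<exists>k. fillable S C (cell g) k"
proof -
  obtain cs where cs: "set cs \<subseteq> commutators" "list_prod G cs = g"
    using derived_commutator_product[OF assms] unfolding commutator_product_def by blast
  have "\<exists>k. fillable S C (cell c) k" if c: "c \<in> commutators" for c
  proof -
    obtain a b where ab: "a \<in> carrier G" "b \<in> carrier G" "c = a \<otimes> b \<otimes> inv a \<otimes> inv b"
      using c unfolding commutators_iff by blast
    let ?xs = "[a, b, inv a, inv b]"
    have "mset ?xs = {#a, b#} + image_mset (m_inv G) {#a, b#}" by simp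
    then have n: "null_chain (chain ?xs)" unfolding null_chain_iff_balanced
      using balanced_inverses[of "{#a, b#}"] ab by (simp only: mset.simps) (simp add: add_mset_commute)
    obtain k where "fillable S C (cell (list_prod G ?xs) - chain ?xs) k"
      using fillable_list_prod(1)[of ?xs S C] ab by auto
    from fillable_add[OF this fillable_null[OF n]]
    have "fillable S C (cell (list_prod G ?xs)) k" by simp
    moreover have "list_prod G ?xs = c" using ab by (simp add: m_assoc)
    ultimately show ?thesis by auto
  qed
  then show ?thesis using fillable_list_prod_cell[of cs S C] cs commutators_carrier by blast
qed

text \<open>A word followed by the inverse of a rearrangement of it is balanced.\<close>

lemma list_prod_perm_derived:
  assumes "set xs \<subseteq> carrier G" "mset xs = mset ys" "list_prod G xs \<in> derived G (carrier G)"
  shows "list_prod G ys \<in> derived G (carrier G)"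
proof -
  interpret D: subgroup "derived G (carrier G)" G by (rule derived_is_subgroup) simp
  have ys: "set ys \<subseteq> carrier G" using assms(1,2) by (metis set_mset_mset)
  have "mset (ys @ rev (map (m_inv G) xs)) = mset xs + image_mset (m_inv G) (mset xs)"
    using assms(2) by simp
  then have "balanced (mset (ys @ rev (map (m_inv G) xs)))"
    using balanced_inverses[of "mset xs"] assms(1) by simp
  moreover have c: "set (rev (map (m_inv G) xs)) \<subseteq> carrier G" using assms(1) by auto
  ultimately have "list_prod G ys \<otimes> inv (list_prod G xs) \<in> derived G (carrier G)"
    using balanced_commutator_product[of "ys @ rev (map (m_inv G) xs)"] ys
      commutator_product_in_derived list_prod_rev_inv[OF assms(1)] by simp
  from D.m_closed[OF this assms(3)] show ?thesis
    using ys assms(1) by (simp add: m_assoc)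
qed

text \<open>The letter counts of words with product in \<open>[G,G]\<close> are closed under differences, as far as these
are nonnegative. So by Dickson's lemma every such word splits, up to order, into words from a
finite list, and \<open>C\<close> is the largest number of triangles needed for a word of the list.\<close>

lemma derived_word_filling:
  assumes S: "finite S" "S \<subseteq> carrier G"
  shows "\<exists>C::nat. \<forall>D. set D \<subseteq> S \<longrightarrow> list_prod G D \<in> derived G (carrier G) \<longrightarrow>
    (\<exists>R. set R \<subseteq> carrier G \<times> carrier G \<and> length R \<le> C * length D \<and> null_chain (chain D + boundary R))"
proof -
  interpret H: subgroup "derived G (carrier G)" G by (rule derived_is_subgroup) simp
  define A where "A = {D. set D \<subseteq> S \<and> list_prod G D \<in> derived G (carrier G) \<and> D \<noteq> []}"
  obtain B where B: "B \<subseteq> (\<lambda>D. count (mset D)) ` A" "finite B"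
     "\<And>f. f \<in> (\<lambda>D. count (mset D)) ` A \<Longrightarrow> \<exists>g\<in>B. \<forall>s\<in>S. g s \<le> f s"
    using dickson[OF S(1), of "(\<lambda>D. count (mset D)) ` A"] by blast
  obtain A0 where A0: "A0 \<subseteq> A" "finite A0" "B = (\<lambda>D. count (mset D)) ` A0"
    using finite_subset_image[OF B(2,1)] by blast
  have fill: "\<exists>R. set R \<subseteq> carrier G \<times> carrier G \<and> null_chain (chain D + boundary R)" if D: "D \<in> A" for D
  proof -
    have DS: "set D \<subseteq> carrier G" using D S by (auto simp: A_def)
    obtain k k' where "fillable {} 0 (chain D - cell (list_prod G D)) k" "fillable {} 0 (cell (list_prod G D)) k'"
      using fillable_list_prod(2)[OF DS] fillable_derived[of "list_prod G D"] D by (auto simp: A_def) metis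
    from fillable_add[OF this] have "fillable {} 0 (chain D) (k + k')" by simp
    then show ?thesis unfolding fillable_def by auto
  qed
  then obtain r where r: "\<And>D. D \<in> A \<Longrightarrow> set (r D) \<subseteq> carrier G \<times> carrier G \<and> null_chain (chain D + boundary (r D))"
    by metis
  define C where "C = (\<Sum>D\<in>A0. length (r D))"
  have C: "length (r D) \<le> C" if "D \<in> A0" for D
    unfolding C_def by (rule member_le_sum) (use that A0 in auto)
  have "\<exists>R. set R \<subseteq> carrier G \<times> carrier G \<and> length R \<le> C * length D \<and> null_chain (chain D + boundary R)"
    if "set D \<subseteq> S" "list_prod G D \<in> derived G (carrier G)" for D
    using that
  proof (induction D rule: length_induct)
    case (1 D)
    show ?case
    proof (cases "D = []")
      case True
      then show ?thesis using null_chain_0 by (intro exI[of _ "[]"]) simp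
    next
      case False
      then have "D \<in> A" using 1 by (simp add: A_def)
      then obtain E where E: "E \<in> A0" "\<forall>s\<in>S. count (mset E) s \<le> count (mset D) s"
        using B(3)[of "count (mset D)"] A0(3) by auto
      have EA: "E \<in> A" using E A0 by auto
      have "mset E \<subseteq># mset D"
      proof (rule mset_subset_eqI)
        fix a show "count (mset E) a \<le> count (mset D) a"
        proof (cases "a \<in> S")
          case False
          then have "a \<notin># mset E" using EA by (auto simp: A_def)
          then have "count (mset E) a = 0" by (simp add: not_in_iff)
          then show ?thesis by linarith
        qed (use E(2) in blast)
      qed
      then obtain M where M: "mset D = mset E + M" by (metis subset_mset.le_iff_add)
      obtain D' where D': "mset D' = M" using ex_mset by blast
      have perm: "mset D = mset (E @ D')" using M D' by simp
      have "set D = set (E @ D')" using perm by (metis set_mset_mset)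
      then have D'S: "set D' \<subseteq> S" "set D \<subseteq> carrier G" "set D' \<subseteq> carrier G" "set E \<subseteq> carrier G"
        using 1(2) S by auto
      have pd: "list_prod G E \<otimes> list_prod G D' \<in> derived G (carrier G)"
        using list_prod_perm_derived[OF D'S(2) perm 1(3)] D'S by simp
      have pE: "list_prod G E \<in> derived G (carrier G)" using EA by (simp add: A_def)
      have "inv (list_prod G E) \<otimes> (list_prod G E \<otimes> list_prod G D') \<in> derived G (carrier G)"
        by (rule H.m_closed[OF H.m_inv_closed[OF pE] pd])
      then have pD': "list_prod G D' \<in> derived G (carrier G)"
        using D'S by (simp add: inv_cancel_left)
      have len: "length D = length E + length D'" using perm by (metis length_append mset_eq_length)
      have "length E > 0" using EA by (simp add: A_def)
      then have "length D' < length D" using len by linarith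
      then obtain R where R: "set R \<subseteq> carrier G \<times> carrier G" "length R \<le> C * length D'"
         "null_chain (chain D' + boundary R)" using 1(1) pD' D'S(1) by blast
      have "null_chain ((chain E + boundary (r E)) + (chain D' + boundary R))"
        using null_chain_add R r EA by blast
      moreover have "chain D = chain E + chain D'" using chain_mset_eq[OF perm] by simp
      ultimately have "null_chain (chain D + boundary (r E @ R))" by (simp add: algebra_simps)
      moreover have "length (r E @ R) \<le> C * length D"
      proof -
        have "length (r E) \<le> C * length E" using C[OF E(1)] \<open>length E > 0\<close>
          by (metis Suc_leI le_trans mult.right_neutral mult_le_mono2 One_nat_def)
        then show ?thesis using R(2) len by (simp add: distrib_left)
      qed
      ultimately show ?thesis using R(1) r[OF EA] by (intro exI[of _ "r E @ R"]) simp
    qed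
  qed
  then show ?thesis by blast
qed

text \<open>The functions dual to fillings; their bounds are the costs of triangles and of letters.\<close>

definition tame_cochain :: "'a set \<Rightarrow> real \<Rightarrow> ('a \<Rightarrow> real) \<Rightarrow> bool" where
  "tame_cochain S C \<phi> \<longleftrightarrow>
     (\<forall>a\<in>carrier G. \<phi> (inv a) = - \<phi> a) \<and>
     (\<forall>a\<in>carrier G. \<forall>b\<in>carrier G. \<bar>\<phi> a + \<phi> b - \<phi> (a \<otimes> b)\<bar> \<le> 1) \<and>
     (\<forall>s\<in>S. \<bar>\<phi> s\<bar> \<le> C)"

lemma generated_word:
  assumes "symmetric_generating_set G S" "g \<in> carrier G"
  shows "\<exists>xs. set xs \<subseteq> S \<and> list_prod G xs = g"
proof -
  have S: "S \<subseteq> carrier G" "\<And>s. s \<in> S \<Longrightarrow> inv s \<in> S" "g \<in> generate G S"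
    using assms unfolding symmetric_generating_set_def by auto
  from S(3) show ?thesis
  proof (induction rule: generate.induct)
    case one
    show ?case by (intro exI[of _ "[]"]) simp
  next
    case (incl h)
    then show ?case using S by (intro exI[of _ "[h]"]) auto
  next
    case (inv h)
    then show ?case using S by (intro exI[of _ "[inv h]"]) auto
  next
    case (eng h1 h2)
    then obtain xs ys where "set xs \<subseteq> S" "list_prod G xs = h1" "set ys \<subseteq> S" "list_prod G ys = h2" by blast
    then show ?case using S by (intro exI[of _ "xs @ ys"]) auto
  qed
qed

text \<open>Hahn-Banach gives a filling of a multiple of \<open>v\<close> whose cost is close to \<open>\<phi> v\<close> for a suitable \<open>\<phi>\<close>. The
letters used in it form a word with product in \<open>[G,G]\<close>, since everything else has trivial image in the
abelianization. By \<open>derived_word_filling\<close> triangles can take their place at no greater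
cost, and \<open>scl_le_filling\<close> applies.\<close>

theorem scl_duality:
  assumes gen: "symmetric_generating_set G S" and fin: "finite S"
  shows "\<exists>C\<ge>0. \<forall>v\<in>derived G (carrier G). \<forall>B.
    (\<forall>\<phi>. tame_cochain S C \<phi> \<longrightarrow> \<phi> v \<le> B) \<longrightarrow> scl G v \<le> (B + 1) / 4"
proof -
  interpret H: subgroup "derived G (carrier G)" G by (rule derived_is_subgroup) simp
  have S: "S \<subseteq> carrier G" "\<And>s. s \<in> S \<Longrightarrow> inv s \<in> S"
    using gen unfolding symmetric_generating_set_def by auto
  obtain C :: nat where C: "\<And>D. set D \<subseteq> S \<Longrightarrow> list_prod G D \<in> derived G (carrier G) \<Longrightarrow>
    \<exists>R. set R \<subseteq> carrier G \<times> carrier G \<and> length R \<le> C * length D \<and> null_chain (chain D + boundary R)"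
    using derived_word_filling[OF fin S(1)] by blast
  have fill_S: "fillable S C (cell s) C" if s: "s \<in> S" for s
    unfolding fillable_def
    by (intro exI[of _ "[]"] exI[of _ "[inv s]"]) (use s S null_chain_cell_inv in auto)
  have fill_cell: "\<exists>k. fillable S C (cell g) k" if g: "g \<in> carrier G" for g
  proof -
    obtain xs where xs: "set xs \<subseteq> S" "list_prod G xs = g" using generated_word[OF gen g] by blast
    have "\<exists>k. fillable S C (cell (list_prod G xs)) k"
      by (rule fillable_list_prod_cell) (use xs S fill_S in blast)+
    then show ?thesis using xs by simp
  qed
  have fill2: "(\<exists>k. fillable S C c k) \<and> (\<exists>k. fillable S C (- c) k)" for c
  proof -
  have "Poly_Mapping.keys c \<subseteq> UNIV" by simp
  then show ?thesis
  proof (induction c rule: frag_induction)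
    case zero
    show ?case using fillable_null[OF null_chain_0] by auto
  next
    case (one g)
    show ?case
    proof (cases "g \<in> carrier G")
      case True
      then show ?thesis using fill_cell[of g] fill_cell[of "inv g"] fillable_minus_cell[of g] by blast
    next
      case False
      then show ?thesis
        using fillable_null[OF null_chain_outside] fillable_null[OF null_chain_minus[OF null_chain_outside]] by blast
    qed
  next
    case (diff a b)
    then obtain k k' l l' where "fillable S C a k" "fillable S C (- a) k'" "fillable S C b l" "fillable S C (- b) l'"
      by blast
    then show ?case using fillable_add[of S C a k "- b" l'] fillable_add[of S C b l "- a" k'] by auto
  qed
  qed
  have fill: "\<exists>k. fillable S C c k" for c using fill2 by blast
  define K where "K c = Inf {real k | k. fillable S C c k}" for c
  have bdd: "bdd_below {real k | k. fillable S C c k}" for c by (rule bdd_belowI[of _ 0]) auto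
  have ne: "{real k | k. fillable S C c k} \<noteq> {}" for c using fill by auto
  have K_le: "K c \<le> real k" if "fillable S C c k" for c k
    unfolding K_def by (rule cInf_lower[OF _ bdd]) (use that in auto)
  have K_sub: "K (c + d) \<le> K c + K d" for c d
  proof (subst (2 3) K_def, rule le_cInf_add[OF ne ne])
    fix a b assume "a \<in> {real k | k. fillable S C c k}" "b \<in> {real k | k. fillable S C d k}"
    then obtain k l where kl: "fillable S C c k" "fillable S C d l" "a = real k" "b = real l" by blast
    then show "K (c + d) \<le> a + b" using K_le[OF fillable_add[OF kl(1,2)]] by simp
  qed
  have K_nonneg: "0 \<le> K c" for c unfolding K_def by (rule cInf_greatest[OF ne]) auto
  have K_0: "K 0 = 0" using K_le[OF fillable_null[OF null_chain_0]] K_nonneg[of 0] by simp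
  have "scl G v \<le> (B + 1) / 4"
    if v: "v \<in> derived G (carrier G)" and B: "\<And>\<phi>. tame_cochain S (real C) \<phi> \<Longrightarrow> \<phi> v \<le> B" for v B
  proof -
    have vc: "v \<in> carrier G" using v by simp
    obtain f where f: "\<And>x y. f (x + y) = f x + f y" "\<And>x. f x \<le> K x"
      "\<And>e. e > 0 \<Longrightarrow> \<exists>Q\<ge>1. K (multiple Q (cell v)) < real Q * (f (cell v) + e)"
      by (rule Hahn_Banach_subadditive[of K "cell v", OF K_sub K_nonneg K_0]) blast
    have f0: "f 0 = 0" using f(1)[of 0 0] by simp
    have fm: "f (- x) = - f x" for x using f(1)[of x "-x"] f0 by simp
    have fd: "f (x - y) = f x - f y" for x y using f(1)[of x "-y"] fm by simp
    have f_fill: "f c \<le> real k" if "fillable S C c k" for c k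
      using f(2)[of c] K_le[OF that] by simp
    have fnull: "f c = 0" if "null_chain c" for c
      using f_fill[OF fillable_null[OF that]] f_fill[OF fillable_null[OF null_chain_minus[OF that]]] fm[of c] by simp
    define \<phi> where "\<phi> a = f (cell a)" for a
    have odd: "\<phi> (inv a) = - \<phi> a" if "a \<in> carrier G" for a
      using fnull[OF null_chain_cell_inv[OF that]] by (simp add: \<phi>_def f(1))
    have "tame_cochain S (real C) \<phi>" unfolding tame_cochain_def
    proof (intro conjI ballI)
      show "\<phi> (inv a) = - \<phi> a" if "a \<in> carrier G" for a by (rule odd[OF that])
      show "\<bar>\<phi> a + \<phi> b - \<phi> (a \<otimes> b)\<bar> \<le> 1" if "a \<in> carrier G" "b \<in> carrier G" for a b
        using f_fill[OF fillable_triangle(1)[OF that]] f_fill[OF fillable_triangle(2)[OF that]]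
        by (simp add: \<phi>_def f(1) fd abs_le_iff)
      show "\<bar>\<phi> s\<bar> \<le> real C" if "s \<in> S" for s
        using f_fill[OF fill_S[OF that]] f_fill[OF fill_S[OF S(2)[OF that]]] odd[of s] that S
        by (auto simp: \<phi>_def abs_le_iff)
    qed
    then have Bv: "f (cell v) \<le> B" using B unfolding \<phi>_def by blast
    show ?thesis
    proof (rule field_le_epsilon)
      fix e :: real assume e: "e > 0"
      obtain Q where Q: "Q \<ge> 1" "K (multiple Q (cell v)) < real Q * (f (cell v) + 4 * e)"
        using f(3)[of "4 * e"] e by auto
      obtain k where k: "fillable S C (multiple Q (cell v)) k" "real k < real Q * (f (cell v) + 4 * e)"
        using Q(2) cInf_less_iff[OF ne bdd] unfolding K_def by blast
      obtain R D where RD: "set R \<subseteq> carrier G \<times> carrier G" "set D \<subseteq> S" "k = length R + C * length D"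
        "null_chain (multiple Q (cell v) + boundary R + chain D)" using k(1) unfolding fillable_def by blast
      let ?T = "concat (map triangle R)"
      have T: "set ?T \<subseteq> carrier G" "list_prod G ?T = \<one>"
        by (rule triangles_closed[OF RD(1)], rule list_prod_triangles[OF RD(1)])
      have DS: "set D \<subseteq> carrier G" using RD S by auto
      have bal: "balanced (mset (replicate Q v @ ?T @ D))"
        using RD(4) unfolding null_chain_iff_balanced[symmetric]
        by (simp add: chain_replicate boundary_def add.assoc)
      have "list_prod G (replicate Q v @ ?T @ D) \<in> derived G (carrier G)"
        by (rule commutator_product_in_derived, rule balanced_commutator_product[OF _ bal])
          (use vc T DS in auto)
      then have "v [^] Q \<otimes> list_prod G D \<in> derived G (carrier G)"
        using vc T DS by (simp add: list_prod_replicate set_replicate_conv_if del: set_concat)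
      moreover have vQ: "v [^] Q \<in> derived G (carrier G)"
        by (induction Q) (use v in auto)
      ultimately have "inv (v [^] Q) \<otimes> (v [^] Q \<otimes> list_prod G D) \<in> derived G (carrier G)"
        using H.m_closed[OF H.m_inv_closed] by blast
      then have pD: "list_prod G D \<in> derived G (carrier G)" by (subst (asm) inv_cancel_left(2)) (use vc DS in auto)
      \<comment> \<open>Adding \<open>D\<close> inverted and a filling of it by triangles cancels the letters of \<open>D\<close>.\<close>
      let ?D' = "rev (map (m_inv G) D)"
      have "list_prod G ?D' \<in> derived G (carrier G)" "set ?D' \<subseteq> S"
        using pD list_prod_rev_inv[OF DS] RD(2) S by auto
      then obtain R' where R': "set R' \<subseteq> carrier G \<times> carrier G" "length R' \<le> C * length D"
        "null_chain (chain ?D' + boundary R')" using C[of ?D'] by auto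
      have "null_chain ((multiple Q (cell v) + boundary R + chain D) + (chain ?D' + boundary R'))"
        by (rule null_chain_add[OF RD(4) R'(3)])
      also have "(multiple Q (cell v) + boundary R + chain D) + (chain ?D' + boundary R') =
         chain ((replicate Q v @ concat (map triangle (R @ R'))) @ (D @ ?D'))"
        by (simp add: chain_replicate boundary_def algebra_simps)
      finally have "balanced (mset (replicate Q v @ concat (map triangle (R @ R'))) +
           (mset D + image_mset (m_inv G) (mset D)))"
        unfolding null_chain_iff_balanced by (simp add: add.assoc)
      from balanced_cancel_inverses[OF _ this] DS
      have "balanced (replicate_mset Q v + mset (concat (map triangle (R @ R'))))" by simp
      then have "scl G v \<le> (real (length (R @ R')) / real Q + 1) / 4"
        by (intro scl_le_filling v Q(1)) (use RD R' in auto)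
      also have "\<dots> \<le> (real k / real Q + 1) / 4"
        using R'(2) RD(3) by (intro divide_right_mono add_mono) (auto simp flip: of_nat_add of_nat_mult)
      also have "real k / real Q \<le> f (cell v) + 4 * e" using k(2) Q(1) by (simp add: field_simps)
      finally show "scl G v \<le> (B + 1) / 4 + e" using Bv by (simp add: field_simps)
    qed
  qed
  then show ?thesis by (intro exI[of _ "real C"]) auto
qed

end

section \<open>Matched subwords of a reduced word\<close>

text \<open>Fixed points of \<open>bar\<close> are allowed, since a generating set may contain involutions and the neutral
element. In every case the reduced words are the vertices of a \<open>2k\<close>-regular tree, in which prepending a
letter and cancelling is a step to a neighbour.\<close>

locale involutive_alphabet =
  fixes S :: "'a set" and bar :: "'a \<Rightarrow> 'a" and k :: nat
  assumes finite_S: "finite S" and card_S: "card S = 2 * k" and k_pos: "k \<ge> 1"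
    and bar_in: "s \<in> S \<Longrightarrow> bar s \<in> S" and bar_bar: "s \<in> S \<Longrightarrow> bar (bar s) = s"
begin

lemma bar_eq_iff: "s \<in> S \<Longrightarrow> t \<in> S \<Longrightarrow> bar s = t \<longleftrightarrow> s = bar t"
  using bar_bar by auto

definition reduced :: "'a list \<Rightarrow> bool" where
  "reduced = successively (\<lambda>x y. y \<noteq> bar x)"

lemma reduced_append:
  "reduced (xs @ ys) \<longleftrightarrow> reduced xs \<and> reduced ys \<and> (xs = [] \<or> ys = [] \<or> hd ys \<noteq> bar (last xs))"
  unfolding reduced_def successively_append_iff by auto

lemma reduced_take: "reduced xs \<Longrightarrow> reduced (take n xs)"
  by (metis append_take_drop_id reduced_append)

lemma reduced_drop: "reduced xs \<Longrightarrow> reduced (drop n xs)"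
  by (metis append_take_drop_id reduced_append)

lemma reduced_nth: "reduced xs \<Longrightarrow> Suc i < length xs \<Longrightarrow> xs ! Suc i \<noteq> bar (xs ! i)"
  unfolding reduced_def by (simp add: successively_conv_nth)

definition word_inv :: "'a list \<Rightarrow> 'a list" where
  "word_inv xs = rev (map bar xs)"

lemma length_word_inv [simp]: "length (word_inv xs) = length xs"
  by (simp add: word_inv_def)

lemma word_inv_inv: "set xs \<subseteq> S \<Longrightarrow> word_inv (word_inv xs) = xs"
  by (induction xs) (auto simp: word_inv_def bar_bar)

lemma set_word_inv: "set xs \<subseteq> S \<Longrightarrow> set (word_inv xs) \<subseteq> S"
  by (auto simp: word_inv_def bar_in)

lemma reduced_word_inv: "set xs \<subseteq> S \<Longrightarrow> reduced xs \<Longrightarrow> reduced (word_inv xs)"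
proof (induction xs)
  case (Cons x xs)
  then have IH: "reduced (word_inv xs)" using reduced_append[of "[x]" xs] by simp
  have eq: "word_inv (x # xs) = word_inv xs @ [bar x]" by (simp add: word_inv_def)
  show ?case
  proof (cases "xs = []")
    case False
    then have "last (word_inv xs) = bar (hd xs)" by (simp add: word_inv_def last_rev hd_map)
    moreover have "hd xs \<noteq> bar x" using Cons.prems(2) reduced_append[of "[x]" xs] False by simp
    moreover have "x \<in> S" "hd xs \<in> S" using Cons.prems(1) False by auto
    ultimately show ?thesis unfolding eq reduced_append using IH bar_bar bar_eq_iff
      by (auto simp: reduced_def)
  qed (simp add: eq word_inv_def reduced_def)
qed (simp add: word_inv_def)

definition occurrences :: "'a list \<Rightarrow> 'a list \<Rightarrow> nat set" where
  "occurrences w y = {p. p + length y \<le> length w \<and> take (length y) (drop p w) = y}"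

lemma finite_occurrences: "finite (occurrences w y)"
  by (rule finite_subset[of _ "{..length w}"]) (auto simp: occurrences_def)

text \<open>The reciprocal of the number of reduced words of length \<open>m\<close>.\<close>

definition freq :: "nat \<Rightarrow> real" where
  "freq m = 1 / (2 * real k * (2 * real k - 1) ^ (m - 1))"

definition equidistributed :: "'a list \<Rightarrow> nat \<Rightarrow> real \<Rightarrow> bool" where
  "equidistributed w m \<delta> \<longleftrightarrow> (\<forall>y. set y \<subseteq> S \<and> reduced y \<and> length y = m \<longrightarrow>
     \<bar>real (card (occurrences w y)) - length w * freq m\<bar> \<le> \<delta> * (length w * freq m))"

lemma subword_ends:
  assumes "p + m + 2 \<le> length w"
  shows "take (m + 2) (drop p w) = w ! p # take m (drop (Suc p) w) @ [w ! (p + m + 1)]"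
proof -
  have "drop p w = w ! p # drop (Suc p) w" using assms by (simp add: Cons_nth_drop_Suc)
  then have "take (m + 2) (drop p w) = w ! p # take (Suc m) (drop (Suc p) w)" by simp
  also have "take (Suc m) (drop (Suc p) w) = take m (drop (Suc p) w) @ [drop (Suc p) w ! m]"
    using assms by (intro take_Suc_conv_app_nth) simp
  finally show ?thesis using assms by (simp add: add.commute)
qed

text \<open>On each side, one letter is excluded by \<open>u\<close> or \<open>u'\<close> and another one by reducedness, and these two
are different. So \<open>(2k - 2)\<^sup>2\<close> extended words remain, each of which occurs about equally often.\<close>

lemma pattern_count:
  assumes w: "set w \<subseteq> S" "reduced w" and eq: "equidistributed w (m + 2) \<delta>"
    and z: "length z = m" "m \<ge> 1" "set z \<subseteq> S" "reduced z"
    and u: "u \<in> S" "u \<noteq> bar (hd z)" and u': "u' \<in> S" "u' \<noteq> bar (last z)"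
  defines "P \<equiv> {p. p + m + 2 \<le> length w \<and> take m (drop (Suc p) w) = z \<and> w ! p \<noteq> u \<and> w ! (p + m + 1) \<noteq> u'}"
    and "N \<equiv> (2 * real k - 2)\<^sup>2 * (length w * freq (m + 2))"
  shows "\<bar>real (card P) - N\<bar> \<le> \<delta> * N"
proof -
  define X where "X = S - {u, bar (hd z)}"
  define X' where "X' = S - {u', bar (last z)}"
  have zne: "z \<noteq> []" using z by auto
  have hl: "hd z \<in> S" "last z \<in> S" using z(3) zne by auto
  have cardX: "card X = 2 * k - 2" "card X' = 2 * k - 2"
    unfolding X_def X'_def using u u' hl bar_in finite_S card_S by (auto simp: card_Diff_subset)
  have fin: "finite X" "finite X'" using finite_S by (auto simp: X_def X'_def)
  let ?y = "\<lambda>(x, x'). x # z @ [x']"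
  have P_eq: "P = (\<Union>q\<in>X \<times> X'. occurrences w (?y q))"
  proof (intro equalityI subsetI)
    fix p assume p: "p \<in> P"
    then have len: "p + m + 2 \<le> length w" by (simp add: P_def)
    have sub: "take (m + 2) (drop p w) = w ! p # z @ [w ! (p + m + 1)]"
      using subword_ends[OF len] p by (simp add: P_def)
    have "reduced (w ! p # z @ [w ! (p + m + 1)])"
      using reduced_take[OF reduced_drop[OF w(2)]] sub by metis
    then have red: "hd z \<noteq> bar (w ! p)" "w ! (p + m + 1) \<noteq> bar (last z)"
      using reduced_append[of "[w ! p]" "z @ [w ! (p + m + 1)]"] reduced_append[of z "[w ! (p + m + 1)]"] zne
      by auto
    have inS: "w ! p \<in> S" "w ! (p + m + 1) \<in> S" using w(1) len by (auto simp: subset_iff)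
    have "w ! p \<in> X" using p inS red hl by (auto simp: X_def P_def bar_bar)
    moreover have "w ! (p + m + 1) \<in> X'" using p inS red by (simp add: X'_def P_def)
    moreover have "p \<in> occurrences w (?y (w ! p, w ! (p + m + 1)))"
      using sub len z(1) by (simp add: occurrences_def)
    ultimately show "p \<in> (\<Union>q\<in>X \<times> X'. occurrences w (?y q))" by blast
  next
    fix p assume "p \<in> (\<Union>q\<in>X \<times> X'. occurrences w (?y q))"
    then obtain x x' where x: "x \<in> X" "x' \<in> X'" "p \<in> occurrences w (x # z @ [x'])" by auto
    then have len: "p + m + 2 \<le> length w" using z(1) by (simp add: occurrences_def)
    have "take (m + 2) (drop p w) = x # z @ [x']" using x(3) z(1) by (simp add: occurrences_def)
    then have "w ! p = x" "take m (drop (Suc p) w) @ [w ! (p + m + 1)] = z @ [x']"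
      using subword_ends[OF len] by auto
    then show "p \<in> P" using x(1,2) len by (auto simp: P_def X_def X'_def)
  qed
  have disj: "occurrences w (?y q) \<inter> occurrences w (?y q') = {}" if "q \<noteq> q'" for q q'
    using that z(1) by (auto simp: occurrences_def split: prod.splits)
  have "real (card P) = (\<Sum>q\<in>X \<times> X'. real (card (occurrences w (?y q))))"
    unfolding P_eq by (subst card_UN_disjoint) (use fin disj finite_occurrences in auto)
  moreover have "N = (\<Sum>q\<in>X \<times> X'. length w * freq (m + 2))"
  proof -
    have "real (2 * k - 2) = 2 * real k - 2" using k_pos by (simp add: of_nat_diff)
    then show ?thesis by (simp add: N_def card_cartesian_product cardX power2_eq_square)
  qed
  ultimately have "\<bar>real (card P) - N\<bar> =
     \<bar>\<Sum>q\<in>X \<times> X'. real (card (occurrences w (?y q))) - length w * freq (m + 2)\<bar>"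
    by (simp add: sum_subtractf)
  also have "\<dots> \<le> (\<Sum>q\<in>X \<times> X'. \<bar>real (card (occurrences w (?y q))) - length w * freq (m + 2)\<bar>)"
    by (rule sum_abs)
  also have "\<dots> \<le> (\<Sum>q\<in>X \<times> X'. \<delta> * (length w * freq (m + 2)))"
  proof (rule sum_mono)
    fix q assume "q \<in> X \<times> X'"
    then obtain x x' where q: "q = (x, x')" "x \<in> X" "x' \<in> X'" by auto
    have "hd z \<noteq> bar x" using q(2) hl bar_eq_iff[of x "hd z"] by (auto simp: X_def)
    then have "reduced (x # z @ [x'])"
      using reduced_append[of "[x]" "z @ [x']"] reduced_append[of z "[x']"] z(4) q zne
      by (auto simp: X'_def reduced_def)
    moreover have "set (x # z @ [x']) \<subseteq> S" using q z by (auto simp: X_def X'_def)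
    ultimately show "\<bar>real (card (occurrences w (?y q))) - length w * freq (m + 2)\<bar> \<le> \<delta> * (length w * freq (m + 2))"
      using eq z(1) q(1) unfolding equidistributed_def by auto
  qed
  also have "\<dots> = \<delta> * (\<Sum>q\<in>X \<times> X'. length w * freq (m + 2))" by (simp add: sum_distrib_left)
  also have "\<dots> = \<delta> * N" using \<open>N = _\<close> by simp
  finally show ?thesis .
qed

text \<open>A pair \<open>(i, j)\<close> is an edge when the subword of length \<open>L\<close> starting at position \<open>i\<close> and the one ending at \<open>j\<close>
are inverse to each other, and this match cannot be prolonged at either end. Prolongable matches are
left out because no third position could complete them to a vertex at that end: it would have to be the
centre of a subword that is not reduced.\<close>

definition edges :: "'a list \<Rightarrow> nat \<Rightarrow> (nat \<times> nat) set" where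
  "edges w L = {(i, j). 1 \<le> i \<and> i + L + 1 \<le> length w \<and> L + 1 \<le> j \<and> j + 1 \<le> length w \<and>
     take L (drop (j - L) w) = word_inv (take L (drop i w)) \<and>
     w ! (i - 1) \<noteq> bar (w ! j) \<and> w ! (i + L) \<noteq> bar (w ! (j - L - 1))}"

lemma finite_edges: "finite (edges w L)"
  by (rule finite_subset[of _ "{..length w} \<times> {..length w}"]) (auto simp: edges_def)

lemma sub_S: "set w \<subseteq> S \<Longrightarrow> set (take n (drop p w)) \<subseteq> S"
  using set_take_subset set_drop_subset by (metis subset_trans)

text \<open>The same edge, seen from its other end.\<close>

lemma edges_flip:
  assumes w: "set w \<subseteq> S" and e: "(i, j) \<in> edges w L"
  shows "(j - L, i + L) \<in> edges w L"
proof -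
  have *: "1 \<le> i" "i + L + 1 \<le> length w" "L + 1 \<le> j" "j + 1 \<le> length w"
     "take L (drop (j - L) w) = word_inv (take L (drop i w))"
     "w ! (i - 1) \<noteq> bar (w ! j)" "w ! (i + L) \<noteq> bar (w ! (j - L - 1))"
    using e by (auto simp: edges_def)
  have S: "w ! (i - 1) \<in> S" "w ! j \<in> S" "w ! (i + L) \<in> S" "w ! (j - L - 1) \<in> S"
    using w * by (auto simp: subset_iff)
  have "take L (drop i w) = word_inv (take L (drop (j - L) w))"
    using *(5) word_inv_inv[OF sub_S[OF w]] by metis
  moreover have "w ! (j - L - 1) \<noteq> bar (w ! (i + L))" "w ! j \<noteq> bar (w ! (i - 1))"
    using * S bar_bar by metis+
  ultimately show ?thesis using * by (simp add: edges_def)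
qed

lemma degree_count:
  assumes w: "set w \<subseteq> S" "reduced w" and eq: "equidistributed w (L + 2) \<delta>"
    and i: "1 \<le> i" "i + L + 1 \<le> length w" and L: "L \<ge> 1"
  defines "N \<equiv> (2 * real k - 2)\<^sup>2 * (length w * freq (L + 2))"
  shows "\<bar>real (card {j. (i, j) \<in> edges w L}) - N\<bar> \<le> \<delta> * N"
proof -
  let ?B = "take L (drop i w)"
  let ?z = "word_inv ?B"
  have B: "length ?B = L" "set ?B \<subseteq> S" "reduced ?B" "?B \<noteq> []"
    using i L sub_S[OF w(1)] reduced_take[OF reduced_drop[OF w(2)]] by auto
  have S: "w ! (i - 1) \<in> S" "w ! (i + L) \<in> S" "w ! i \<in> S" "w ! (i + L - 1) \<in> S"
    using w i L by (auto simp: subset_iff)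
  have "hd ?B = w ! i" using i L by (simp add: hd_drop_conv_nth)
  moreover have "last ?B = w ! (i + L - 1)" using i L B(4) by (simp add: last_conv_nth)
  ultimately have ends: "hd ?z = bar (w ! (i + L - 1))" "last ?z = bar (w ! i)"
    using B(4) by (simp_all add: word_inv_def hd_rev last_rev hd_map last_map)
  have r: "w ! (i + L) \<noteq> bar (w ! (i + L - 1))" "w ! i \<noteq> bar (w ! (i - 1))"
    using reduced_nth[OF w(2), of "i + L - 1"] reduced_nth[OF w(2), of "i - 1"] i L by auto
  define P where "P = {p. p + L + 2 \<le> length w \<and> take L (drop (Suc p) w) = ?z \<and>
      w ! p \<noteq> bar (w ! (i + L)) \<and> w ! (p + L + 1) \<noteq> bar (w ! (i - 1))}"
  have "\<bar>real (card P) - N\<bar> \<le> \<delta> * N" unfolding P_def N_def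
  proof (rule pattern_count[OF w eq])
    show "bar (w ! (i + L)) \<noteq> bar (hd ?z)" using ends S r bar_bar bar_in by metis
    show "bar (w ! (i - 1)) \<noteq> bar (last ?z)" using ends S r bar_bar bar_in by metis
  qed (use B L S bar_in set_word_inv reduced_word_inv in auto)
  moreover have "{j. (i, j) \<in> edges w L} = (\<lambda>p. p + L + 1) ` P"
  proof (intro equalityI subsetI)
    fix j assume "j \<in> {j. (i, j) \<in> edges w L}"
    then have j: "L + 1 \<le> j" "j + 1 \<le> length w" "take L (drop (j - L) w) = ?z"
     "w ! (i - 1) \<noteq> bar (w ! j)" "w ! (i + L) \<noteq> bar (w ! (j - L - 1))"
      by (auto simp: edges_def)
    have Sj: "w ! j \<in> S" "w ! (j - L - 1) \<in> S" using w j by (auto simp: subset_iff)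
    have "Suc (j - L - 1) = j - L" "j - L - 1 + L + 1 = j" using j by auto
    then have "j - L - 1 \<in> P" unfolding P_def
      using j S Sj bar_bar by (simp, metis)
    then show "j \<in> (\<lambda>p. p + L + 1) ` P" using j by (intro image_eqI[of _ _ "j - L - 1"]) auto
  next
    fix j assume "j \<in> (\<lambda>p. p + L + 1) ` P"
    then obtain p where p: "p \<in> P" "j = p + L + 1" by auto
    then have j: "p + L + 2 \<le> length w" "take L (drop (Suc p) w) = ?z"
      "w ! p \<noteq> bar (w ! (i + L))" "w ! (p + L + 1) \<noteq> bar (w ! (i - 1))" by (auto simp: P_def)
    have Sp: "w ! p \<in> S" "w ! (p + L + 1) \<in> S" using w j by (auto simp: subset_iff)
    have "w ! (i - 1) \<noteq> bar (w ! j)" "w ! (i + L) \<noteq> bar (w ! p)"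
      using j p Sp S bar_bar by metis+
    then show "j \<in> {j. (i, j) \<in> edges w L}" using p j i by (simp add: edges_def)
  qed
  ultimately show ?thesis by (simp add: card_image inj_on_def)
qed

text \<open>A third position completes the edge \<open>(a, b)\<close> to a vertex exactly if it is the centre of a certain
reduced word of length \<open>2L\<close>, flanked by letters that make both new matches maximal.\<close>

lemma tripod_count:
  assumes w: "set w \<subseteq> S" "reduced w" and eq: "equidistributed w (2 * L + 2) \<delta>"
    and e: "(a, b) \<in> edges w L" and ab: "L < a" "b + L < length w" and L: "L \<ge> 1"
  defines "M \<equiv> (2 * real k - 2)\<^sup>2 * (length w * freq (2 * L + 2))"
  shows "\<bar>real (card {c. (b, c) \<in> edges w L \<and> (c, a) \<in> edges w L}) - M\<bar> \<le> \<delta> * M"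
proof -
  have E: "1 \<le> a" "a + L + 1 \<le> length w" "L + 1 \<le> b" "b + 1 \<le> length w"
     "take L (drop (b - L) w) = word_inv (take L (drop a w))"
     "w ! (a - 1) \<noteq> bar (w ! b)"
    using e by (auto simp: edges_def)
  let ?B = "take L (drop b w)" and ?A = "take L (drop (a - L) w)"
  let ?z = "word_inv ?B @ word_inv ?A"
  have B: "length ?B = L" "set ?B \<subseteq> S" "reduced ?B" "?B \<noteq> []"
    using ab L sub_S[OF w(1)] reduced_take[OF reduced_drop[OF w(2)]] by auto
  have A: "length ?A = L" "set ?A \<subseteq> S" "reduced ?A" "?A \<noteq> []"
    using ab E L sub_S[OF w(1)] reduced_take[OF reduced_drop[OF w(2)]] by auto
  have last_take: "last (take L (drop q w)) = w ! (q + L - 1)" if "q + L \<le> length w" for q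
    using that L by (subst last_conv_nth) auto
  have hd_take: "hd (take L (drop q w)) = w ! q" if "q + L \<le> length w" for q
    using that L by (simp add: hd_drop_conv_nth)
  have hdi: "hd (word_inv (take L (drop q w))) = bar (w ! (q + L - 1))" if "q + L \<le> length w" for q
    using last_take[OF that] that L by (simp add: word_inv_def hd_rev last_map)
  have lasti: "last (word_inv (take L (drop q w))) = bar (w ! q)" if "q + L \<le> length w" for q
    using hd_take[OF that] that L by (simp add: word_inv_def last_rev hd_map)
  have ne: "word_inv ?B \<noteq> []" "word_inv ?A \<noteq> []" using A B by (auto simp: word_inv_def)
  have S: "w ! (a - 1) \<in> S" "w ! a \<in> S" "w ! b \<in> S" "w ! (b - 1) \<in> S" "w ! (b + L) \<in> S" "w ! (b + L - 1) \<in> S"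
    "w ! (a - L - 1) \<in> S" "w ! (a - L) \<in> S"
    using w E ab L by (auto simp: subset_iff)
  have zends: "hd ?z = bar (w ! (b + L - 1))" "last ?z = bar (w ! (a - L))"
    using ne hdi[of b] lasti[of "a - L"] ab E by auto
  have zred: "reduced ?z"
  proof -
    have "bar (w ! (a - 1)) \<noteq> bar (bar (w ! b))" using E(6) S bar_bar by metis
    moreover have "a - L + L - 1 = a - 1" using ab by simp
    ultimately show ?thesis unfolding reduced_append
      using reduced_word_inv[OF B(2,3)] reduced_word_inv[OF A(2,3)] lasti[of b] hdi[of "a - L"] ab E by auto
  qed
  have Sa: "Suc (a - L - 1) = a - L" using ab by simp
  have r: "w ! (b + L) \<noteq> bar (w ! (b + L - 1))" "w ! (a - L) \<noteq> bar (w ! (a - L - 1))"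
    "w ! a \<noteq> bar (w ! (a - 1))" "w ! b \<noteq> bar (w ! (b - 1))"
    using reduced_nth[OF w(2), of "b + L - 1"] reduced_nth[OF w(2), of "a - L - 1"]
      reduced_nth[OF w(2), of "a - 1"] reduced_nth[OF w(2), of "b - 1"] ab E L unfolding Sa by auto
  have ba: "w ! (b - 1) = bar (w ! a)"
    using last_take[of "b - L"] lasti[of a] E by simp
  define P where "P = {p. p + 2 * L + 2 \<le> length w \<and> take (2 * L) (drop (Suc p) w) = ?z \<and>
      w ! p \<noteq> bar (w ! (b + L)) \<and> w ! (p + 2 * L + 1) \<noteq> bar (w ! (a - L - 1))}"
  have "\<bar>real (card P) - M\<bar> \<le> \<delta> * M" unfolding P_def M_def
  proof (rule pattern_count[OF w eq])
    show "bar (w ! (b + L)) \<noteq> bar (hd ?z)" using zends S r bar_bar bar_in by metis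
    show "bar (w ! (a - L - 1)) \<noteq> bar (last ?z)" using zends S r bar_bar bar_in by metis
    show "set ?z \<subseteq> S" using A B set_word_inv by auto
    show "length ?z = 2 * L" using A B by simp
  qed (use L S bar_in zred in auto)
  moreover have "{c. (b, c) \<in> edges w L \<and> (c, a) \<in> edges w L} = (\<lambda>p. p + L + 1) ` P"
  proof (intro equalityI subsetI)
    fix c assume "c \<in> {c. (b, c) \<in> edges w L \<and> (c, a) \<in> edges w L}"
    then have c: "L + 1 \<le> c" "c + L + 1 \<le> length w" "take L (drop (c - L) w) = word_inv ?B"
      "?A = word_inv (take L (drop c w))"
      "w ! (b + L) \<noteq> bar (w ! (c - L - 1))" "w ! (c + L) \<noteq> bar (w ! (a - L - 1))"
      by (auto simp: edges_def)
    have Sc: "w ! (c - L - 1) \<in> S" using w c by (auto simp: subset_iff)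
    have "take L (drop c w) = word_inv ?A" using c(4) word_inv_inv[OF sub_S[OF w(1)]] by metis
    moreover have "take (2 * L) (drop (c - L) w) = take L (drop (c - L) w) @ take L (drop c w)"
      using c by (simp add: mult_2 take_add)
    ultimately have "take (2 * L) (drop (c - L) w) = ?z" using c by simp
    moreover have "Suc (c - L - 1) = c - L" "c - L - 1 + 2 * L + 1 = c + L" using c by auto
    moreover have "w ! (c - L - 1) \<noteq> bar (w ! (b + L))" using c S Sc bar_bar by metis
    ultimately have "c - L - 1 \<in> P" unfolding P_def using c by (simp add: add.commute)
    then show "c \<in> (\<lambda>p. p + L + 1) ` P" using c by (intro image_eqI[of _ _ "c - L - 1"]) auto
  next
    fix c assume "c \<in> (\<lambda>p. p + L + 1) ` P"
    then obtain p where p: "p \<in> P" "c = p + L + 1" by auto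
    then have j: "p + 2 * L + 2 \<le> length w" "take (2 * L) (drop (Suc p) w) = ?z"
      "w ! p \<noteq> bar (w ! (b + L))" "w ! (p + 2 * L + 1) \<noteq> bar (w ! (a - L - 1))" by (auto simp: P_def)
    have "take (2 * L) (drop (Suc p) w) = take L (drop (Suc p) w) @ take L (drop c w)"
      using p(2) by (simp add: mult_2 take_add add.commute)
    then have blocks: "take L (drop (Suc p) w) = word_inv ?B" "take L (drop c w) = word_inv ?A"
      using j A B by auto
    have A': "?A = word_inv (take L (drop c w))" using blocks(2) word_inv_inv[OF A(2)] by simp
    have wc: "w ! c = bar (w ! (a - 1))" using hd_take[of c] hdi[of "a - L"] blocks j p ab E by simp
    have wc1: "w ! (c - 1) = bar (w ! b)" using last_take[of "Suc p"] lasti[of b] blocks j p ab by simp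
    have Sp: "w ! p \<in> S" using w j by (auto simp: subset_iff)
    have "w ! (b + L) \<noteq> bar (w ! p)" using j Sp S bar_bar by metis
    moreover have "w ! (b - 1) \<noteq> bar (w ! c)" using wc ba r S bar_bar by metis
    ultimately have bc: "(b, c) \<in> edges w L" using p j E ab blocks by (simp add: edges_def)
    have "w ! (c - 1) \<noteq> bar (w ! a)" using wc1 ba r S bar_bar by metis
    moreover have "w ! (c + L) \<noteq> bar (w ! (a - L - 1))" "c + L + 1 \<le> length w"
    proof -
      have cL: "c + L = p + 2 * L + 1" using p by simp
      show "w ! (c + L) \<noteq> bar (w ! (a - L - 1))" "c + L + 1 \<le> length w"
        unfolding cL using j by simp_all
    qed
    ultimately have "(c, a) \<in> edges w L" using p E ab A' by (simp add: edges_def)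
    with bc show "c \<in> {c. (b, c) \<in> edges w L \<and> (c, a) \<in> edges w L}" by simp
  qed
  ultimately show ?thesis by (simp add: card_image inj_on_def)
qed

end

text \<open>Sum \<open>h3\<close> over all triples. Each edge is counted three times as often as it has completions; these
numbers of completions are nearly equal on \<open>F\<close>, and the few remaining edges are estimated by \<open>h1\<close>.\<close>

lemma sum_edges_le:
  fixes h :: "nat \<Rightarrow> nat \<Rightarrow> real" and E :: "(nat \<times> nat) set"
  defines "T \<equiv> \<lambda>(a, b). {c. (b, c) \<in> E \<and> (c, a) \<in> E}"
  assumes fin: "finite E" and good: "F \<subseteq> E" and \<delta>: "0 \<le> \<delta>" and M: "M > 0"
    and h1: "\<And>a b. (a, b) \<in> E \<Longrightarrow> \<bar>h a b\<bar> \<le> 1"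
    and h3: "\<And>a b c. (a, b) \<in> E \<Longrightarrow> (b, c) \<in> E \<Longrightarrow> (c, a) \<in> E \<Longrightarrow> h a b + h b c + h c a \<le> 1"
    and T: "\<And>e. e \<in> F \<Longrightarrow> \<bar>real (card (T e)) - M\<bar> \<le> \<delta> * M"
    and T0: "\<And>e. e \<in> E - F \<Longrightarrow> T e = {}"
  shows "3 * (\<Sum>(a, b)\<in>E. h a b) \<le> (1 + 4 * \<delta>) * card E + 3 * real (card (E - F))"
proof -
  define t where "t e = real (card (T e))" for e
  let ?h = "\<lambda>(a, b). h a b"
  have finT: "finite (T e)" for e
  proof (rule finite_subset[of _ "fst ` E"])
    show "T e \<subseteq> fst ` E" unfolding T_def by (auto split: prod.splits) force
  qed (use fin in simp)
  have finF: "finite F" using fin good finite_subset by blast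
  let ?Tr = "SIGMA e:E. T e"
  have finTr: "finite ?Tr" using fin finT by auto
  have s1: "(\<Sum>((a, b), c)\<in>?Tr. h a b) = (\<Sum>e\<in>E. t e * ?h e)"
  proof -
    have "(\<Sum>((a, b), c)\<in>?Tr. h a b) = (\<Sum>(e, c)\<in>?Tr. ?h e)" by (simp add: split_def)
    also have "\<dots> = (\<Sum>e\<in>E. \<Sum>c\<in>T e. ?h e)" using fin finT by (subst sum.Sigma) auto
    finally show ?thesis by (simp add: t_def)
  qed
  have s2: "(\<Sum>((a, b), c)\<in>?Tr. h b c) = (\<Sum>((a, b), c)\<in>?Tr. h a b)"
    by (rule sum.reindex_bij_witness[of _ "\<lambda>((a, b), c). ((c, a), b)" "\<lambda>((a, b), c). ((b, c), a)"])
      (auto simp: T_def)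
  have s3: "(\<Sum>((a, b), c)\<in>?Tr. h c a) = (\<Sum>((a, b), c)\<in>?Tr. h a b)"
    by (rule sum.reindex_bij_witness[of _ "\<lambda>((a, b), c). ((b, c), a)" "\<lambda>((a, b), c). ((c, a), b)"])
      (auto simp: T_def)
  have "3 * (\<Sum>e\<in>E. t e * ?h e) = (\<Sum>((a, b), c)\<in>?Tr. h a b + h b c + h c a)"
    using s1 s2 s3 by (simp add: split_def sum.distrib)
  also have "\<dots> \<le> (\<Sum>((a, b), c)\<in>?Tr. 1)"
    by (rule sum_mono) (auto simp: T_def intro: h3)
  also have "\<dots> = (\<Sum>e\<in>E. t e)"
    using fin finT by (simp add: split_def card_SigmaI t_def)
  finally have main: "3 * (\<Sum>e\<in>E. t e * ?h e) \<le> (\<Sum>e\<in>E. t e)" .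
  have restrict: "(\<Sum>e\<in>E. t e * g e) = (\<Sum>e\<in>F. t e * g e)" for g
    by (rule sum.mono_neutral_right) (use fin good T0 in \<open>auto simp: t_def\<close>)
  have "3 * M * (\<Sum>e\<in>F. ?h e) = 3 * (\<Sum>e\<in>F. t e * ?h e) + (\<Sum>e\<in>F. 3 * ((M - t e) * ?h e))"
    by (simp add: sum_distrib_left algebra_simps sum_subtractf sum.distrib)
  also have "\<dots> \<le> (\<Sum>e\<in>F. t e) + (\<Sum>e\<in>F. 3 * (\<delta> * M))"
  proof (intro add_mono sum_mono)
    show "3 * (\<Sum>e\<in>F. t e * ?h e) \<le> (\<Sum>e\<in>F. t e)"
      using main restrict[of ?h] restrict[of "\<lambda>_. 1"] by simp
    fix e assume e: "e \<in> F"
    have "(M - t e) * ?h e \<le> \<bar>M - t e\<bar> * \<bar>?h e\<bar>" by (metis abs_ge_self abs_mult)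
    also have "\<dots> \<le> (\<delta> * M) * 1"
    proof (rule mult_mono)
      show "\<bar>M - t e\<bar> \<le> \<delta> * M" using T[OF e] by (simp add: t_def abs_minus_commute)
      show "\<bar>?h e\<bar> \<le> 1" using h1[of "fst e" "snd e"] e good by (auto simp: split_def)
    qed (use \<delta> M in auto)
    finally show "3 * ((M - t e) * ?h e) \<le> 3 * (\<delta> * M)" by simp
  qed
  also have "\<dots> \<le> (\<Sum>e\<in>F. M + \<delta> * M) + (\<Sum>e\<in>F. 3 * (\<delta> * M))"
  proof (intro add_mono sum_mono order_refl)
    fix e assume "e \<in> F"
    then show "t e \<le> M + \<delta> * M" using T[of e] by (simp add: t_def abs_le_iff)
  qed
  also have "\<dots> = M * ((1 + 4 * \<delta>) * card F)" by (simp add: algebra_simps)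
  finally have "3 * (\<Sum>e\<in>F. ?h e) \<le> (1 + 4 * \<delta>) * card F" using M by (simp add: mult.assoc mult.left_commute)
  moreover have "(1 + 4 * \<delta>) * card F \<le> (1 + 4 * \<delta>) * card E"
    using \<delta> card_mono[OF fin good] by (intro mult_left_mono) auto
  moreover have "(\<Sum>e\<in>E - F. ?h e) \<le> (\<Sum>e\<in>E - F. 1)"
  proof (rule sum_mono)
    fix e assume "e \<in> E - F"
    then show "?h e \<le> 1" using h1[of "fst e" "snd e"] by (auto simp: split_def abs_le_iff)
  qed
  moreover have "(\<Sum>e\<in>E. ?h e) = (\<Sum>e\<in>E - F. ?h e) + (\<Sum>e\<in>F. ?h e)"
    by (rule sum.subset_diff[OF good fin])
  ultimately show ?thesis by simp
qed

context group
begin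

lemma symmetric_alphabet:
  assumes "symmetric_generating_set G S" "finite S" "card S = 2 * k" "k \<ge> 1"
  shows "involutive_alphabet S (m_inv G) k"
  by standard (use assms in \<open>auto simp: symmetric_generating_set_def\<close>)

lemma tame_cochain_word:
  assumes \<phi>: "tame_cochain S C \<phi>" and S: "S \<subseteq> carrier G" and w: "set w \<subseteq> S" and C: "C \<ge> 0"
  shows "\<bar>\<phi> (list_prod G w)\<bar> \<le> (C + 1) * length w"
  using w
proof (induction w)
  case Nil
  have "\<phi> \<one> = - \<phi> \<one>" using \<phi> unfolding tame_cochain_def by (metis inv_one one_closed)
  then show ?case by simp
next
  case (Cons s w)
  have c: "s \<in> carrier G" "list_prod G w \<in> carrier G" using Cons.prems S by auto
  have "\<bar>\<phi> s + \<phi> (list_prod G w) - \<phi> (s \<otimes> list_prod G w)\<bar> \<le> 1" "\<bar>\<phi> s\<bar> \<le> C"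
    using \<phi> c Cons.prems unfolding tame_cochain_def by auto
  moreover have "\<bar>\<phi> (list_prod G w)\<bar> \<le> (C + 1) * length w" using Cons by auto
  ultimately show ?case by (simp add: algebra_simps abs_le_iff)
qed

text \<open>Let \<open>p i\<close> be the product of the first \<open>i\<close> letters. The coboundary
\<open>h i j = \<phi> (p i (p j)\<inverse>) - \<phi> (p i) + \<phi> (p j)\<close> is bounded by one and its sum over a triangle of positions is at
most one, so that \<open>sum_edges_le\<close> bounds its sum over all edges. On the other hand, the group element
\<open>p i (p j)\<inverse>\<close> is the same at both ends of an edge. So \<open>h\<close> at one end plus \<open>h\<close> at the other end only
involves the increments \<open>d\<close> of \<open>\<phi>\<close> along the two sides of the edge. As every position has nearly the
same degree \<open>N\<close>, the sum over all edges is about \<open>N\<close> times the sum of all increments, which telescopes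
to \<open>N L \<phi> w\<close>. Comparing the two evaluations gives the term \<open>r/(3L)\<close>. The other terms come from
positions close to the ends of \<open>w\<close> and from \<open>\<delta>\<close>.\<close>

theorem tame_cochain_equidistributed:
  assumes alph: "involutive_alphabet S (m_inv G) k" and S: "S \<subseteq> carrier G" and k: "k \<ge> 2"
    and \<phi>: "tame_cochain S C \<phi>" and C: "C \<ge> 0"
    and w: "set w \<subseteq> S" "involutive_alphabet.reduced (m_inv G) w"
    and L: "L \<ge> 1" "L + 1 < length w" and \<delta>: "0 \<le> \<delta>" "\<delta> \<le> 1"
    and eq1: "involutive_alphabet.equidistributed S (m_inv G) k w (L + 2) \<delta>"
    and eq2: "involutive_alphabet.equidistributed S (m_inv G) k w (2 * L + 2) \<delta>"
  shows "\<phi> (list_prod G w) \<le> (1 + \<delta>) * (1 + 4 * \<delta>) * length w / (3 * L) + 2 * (1 + \<delta>)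
     + (C + 1) * (L + 1) + \<delta> * (C + 1) * length w"
proof -
  interpret A: involutive_alphabet S "m_inv G" k by (rule alph)
  define r where "r = length w"
  define p where "p i = list_prod G (take i w)" for i
  define E where "E = A.edges w L"
  define N where "N = (2 * real k - 2)\<^sup>2 * (length w * A.freq (L + 2))"
  define M where "M = (2 * real k - 2)\<^sup>2 * (length w * A.freq (2 * L + 2))"
  have NM: "N > 0" "M > 0" 
  proof -
    have "A.freq m > 0" for m using k unfolding A.freq_def by (intro divide_pos_pos mult_pos_pos zero_less_power) auto
    then show "N > 0" "M > 0" using k L unfolding N_def M_def
      by (intro mult_pos_pos zero_less_power; force)+
  qed
  have wc: "set w \<subseteq> carrier G" using w S by auto
  have tc: "set (take i w) \<subseteq> carrier G" "set (take i (drop j w)) \<subseteq> carrier G" for i j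
    using wc set_take_subset set_drop_subset by (metis subset_trans)+
  have pc: "p i \<in> carrier G" for i unfolding p_def using tc by auto
  have odd: "\<phi> (inv a) = - \<phi> a" if "a \<in> carrier G" for a using \<phi> that by (simp add: tame_cochain_def)
  have tri: "\<bar>\<phi> a + \<phi> b - \<phi> (a \<otimes> b)\<bar> \<le> 1" if "a \<in> carrier G" "b \<in> carrier G" for a b
    using \<phi> that by (simp add: tame_cochain_def)
  have phi0: "\<phi> \<one> = 0" using odd[of \<one>] by simp
  define h where "h i j = \<phi> (p i \<otimes> inv p j) - \<phi> (p i) + \<phi> (p j)" for i j
  define d where "d i = \<phi> (p (i + L)) - \<phi> (p i)" for i
  have h1: "\<bar>h i j\<bar> \<le> 1" for i j
    using tri[OF pc inv_closed[OF pc], of i j] odd[OF pc, of j] by (simp add: h_def abs_le_iff)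
  have h3: "h a b + h b c + h c a \<le> 1" for a b c
  proof -
    let ?x = "p a \<otimes> inv p b" and ?y = "p b \<otimes> inv p c"
    have "?x \<otimes> ?y = p a \<otimes> inv p c" using pc by (simp add: m_assoc inv_cancel_left)
    moreover have "\<phi> (p c \<otimes> inv p a) = - \<phi> (p a \<otimes> inv p c)"
      using odd[of "p a \<otimes> inv p c"] pc by (simp add: inv_mult_group)
    ultimately show ?thesis using tri[of ?x ?y] pc by (simp add: h_def abs_le_iff)
  qed
  have p_add: "p (i + n) = p i \<otimes> list_prod G (take n (drop i w))" for i n
    unfolding p_def take_add using tc by simp
  have flip: "h i j + h (j - L) (i + L) = d i + d (j - L)" if e: "(i, j) \<in> E" for i j
  proof -
    have j: "L + 1 \<le> j" and m: "take L (drop (j - L) w) = A.word_inv (take L (drop i w))"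
      using e by (auto simp: E_def A.edges_def)
    let ?b = "list_prod G (take L (drop i w))"
    have b: "?b \<in> carrier G" using tc by auto
    have "list_prod G (take L (drop (j - L) w)) = inv ?b"
      unfolding m A.word_inv_def by (rule list_prod_rev_inv[OF tc(2)])
    then have pj: "p j = p (j - L) \<otimes> inv ?b" using p_add[of "j - L" L] j by simp
    have "p i \<otimes> inv p j = p i \<otimes> (?b \<otimes> inv p (j - L))" unfolding pj using pc b by (simp add: inv_mult_group)
    also have "\<dots> = p (i + L) \<otimes> inv p (j - L)" unfolding p_add using pc b by (simp add: m_assoc)
    finally have "p i \<otimes> inv p j = p (i + L) \<otimes> inv p (j - L)" .
    then have "\<phi> (p (j - L) \<otimes> inv p (i + L)) = - \<phi> (p i \<otimes> inv p j)"
      using odd[of "p (i + L) \<otimes> inv p (j - L)"] pc by (simp add: inv_mult_group)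
    then show ?thesis using j by (simp add: h_def d_def)
  qed
  have finE: "finite E" unfolding E_def by (rule A.finite_edges)
  have flipE: "(j - L, i + L) \<in> E" if "(i, j) \<in> E" for i j
    using A.edges_flip[OF w(1)] that unfolding E_def by blast
  have Lj: "L + 1 \<le> j" if "(i, j) \<in> E" for i j using that by (auto simp: E_def A.edges_def)
  have flip_sum: "(\<Sum>(i, j)\<in>E. g (j - L) (i + L)) = (\<Sum>(i, j)\<in>E. g i j)" for g :: "nat \<Rightarrow> nat \<Rightarrow> real"
    by (rule sum.reindex_bij_witness[of _ "\<lambda>(i, j). (j - L, i + L)" "\<lambda>(i, j). (j - L, i + L)"])
      (use flipE Lj in \<open>auto, fastforce+\<close>)
  have hd: "(\<Sum>(i, j)\<in>E. h i j) = (\<Sum>(i, j)\<in>E. d i)"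
  proof -
    have "2 * (\<Sum>(i, j)\<in>E. h i j) = (\<Sum>(i, j)\<in>E. h i j) + (\<Sum>(i, j)\<in>E. h (j - L) (i + L))"
      using flip_sum[of h] by simp
    also have "\<dots> = (\<Sum>(i, j)\<in>E. d i + d (j - L))"
      unfolding sum.distrib[symmetric] by (rule sum.cong) (auto simp: flip)
    also have "\<dots> = (\<Sum>(i, j)\<in>E. d i) + (\<Sum>(i, j)\<in>E. d (j - L))"
      by (simp add: split_def sum.distrib)
    also have "(\<Sum>(i, j)\<in>E. d (j - L)) = (\<Sum>(i, j)\<in>E. d i)" using flip_sum[of "\<lambda>i j. d i"] by simp
    finally show ?thesis by simp
  qed
  define D where "D i = {j. (i, j) \<in> E}" for i
  define I where "I = {1..<r - L}"
  have finD: "finite (D i)" for i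
  proof (rule finite_subset[of _ "snd ` E"])
    show "D i \<subseteq> snd ` E" unfolding D_def by force
  qed (use finE in simp)
  have E_Sigma: "E = (SIGMA i:I. D i)"
    by (auto simp: D_def I_def E_def A.edges_def r_def)
  have deg: "\<bar>real (card (D i)) - N\<bar> \<le> \<delta> * N" if "i \<in> I" for i
    unfolding D_def E_def N_def by (rule A.degree_count[OF w eq1]) (use that L in \<open>auto simp: I_def r_def\<close>)
  have sum_E: "(\<Sum>(i, j)\<in>E. g i) = (\<Sum>i\<in>I. card (D i) * g i)" for g :: "nat \<Rightarrow> real"
  proof -
    have "(\<Sum>(i, j)\<in>E. g i) = (\<Sum>i\<in>I. \<Sum>j\<in>D i. g i)"
      unfolding E_Sigma using finD by (subst sum.Sigma) (auto simp: I_def)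
    then show ?thesis by simp
  qed
  have cardE_le: "real (card {e\<in>E. fst e \<in> J}) \<le> card J * (N * (1 + \<delta>))" if J: "J \<subseteq> I" for J
  proof -
    have finJ: "finite J" using J finite_subset by (auto simp: I_def)
    have "{e\<in>E. fst e \<in> J} = (SIGMA i:J. D i)" using J by (auto simp: E_Sigma)
    then have "real (card {e\<in>E. fst e \<in> J}) = (\<Sum>i\<in>J. real (card (D i)))"
      using finJ finD by (simp add: card_SigmaI)
    also have "\<dots> \<le> (\<Sum>i\<in>J. N * (1 + \<delta>))"
    proof (rule sum_mono)
      fix i assume "i \<in> J"
      then show "real (card (D i)) \<le> N * (1 + \<delta>)" using deg[of i] J by (auto simp: abs_le_iff algebra_simps)
    qed
    finally show ?thesis by simp
  qed
  have cardI: "card I \<le> r" by (simp add: I_def)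
  have N1: "0 \<le> N * (1 + \<delta>)" using NM \<delta> by simp
  have cardE: "real (card E) \<le> r * (N * (1 + \<delta>))"
  proof -
    have "{e\<in>E. fst e \<in> I} = E" by (auto simp: E_Sigma)
    then have "real (card E) \<le> card I * (N * (1 + \<delta>))" using cardE_le[of I] by simp
    also have "\<dots> \<le> r * (N * (1 + \<delta>))" using cardI N1 by (intro mult_right_mono) auto
    finally show ?thesis .
  qed
  \<comment> \<open>For the other edges, a completion to a vertex would need positions outside of \<open>w\<close>.\<close>
  define F where "F = {(a, b)\<in>E. L < a \<and> b + L < r}"
  have cardF: "real (card (E - F)) \<le> 2 * real L * (N * (1 + \<delta>))"
  proof -
    let ?J1 = "{1..L} \<inter> I" and ?J2 = "{r - 2 * L..<r - L} \<inter> I"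
    let ?E1 = "{e\<in>E. fst e \<in> ?J1}" and ?E2 = "{e\<in>E. fst e \<in> ?J2}"
    have "E - F \<subseteq> ?E1 \<union> (\<lambda>(i, j). (j - L, i + L)) ` ?E2"
    proof
      fix e assume e: "e \<in> E - F"
      then obtain a b where ab: "e = (a, b)" "(a, b) \<in> E" "a \<le> L \<or> r \<le> b + L"
        by (cases e) (auto simp: F_def)
      have aI: "a \<in> I" using ab(2) E_Sigma by auto
      show "e \<in> ?E1 \<union> (\<lambda>(i, j). (j - L, i + L)) ` ?E2"
      proof (cases "a \<le> L")
        case True
        then show ?thesis using ab aI by (auto simp: I_def)
      next
        case False
        then have b: "r \<le> b + L" using ab by simp
        have e': "(b - L, a + L) \<in> E" by (rule flipE[OF ab(2)])
        have bI: "b - L \<in> I" using e' E_Sigma by auto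
        have "L + 1 \<le> b" by (rule Lj[OF ab(2)])
        moreover have "b < r" using ab(2) by (auto simp: E_def A.edges_def r_def)
        ultimately have "(b - L, a + L) \<in> ?E2" "(\<lambda>(i, j). (j - L, i + L)) (b - L, a + L) = e"
          using e' b bI ab by auto
        then show ?thesis by (metis (no_types, lifting) UnI2 image_eqI)
      qed
    qed
    then have "card (E - F) \<le> card (?E1 \<union> (\<lambda>(i, j). (j - L, i + L)) ` ?E2)"
      by (rule card_mono[rotated]) (use finE in auto)
    also have "\<dots> \<le> card ?E1 + card ?E2"
      using finE by (intro order_trans[OF card_Un_le] add_mono order_refl card_image_le) auto
    finally have "real (card (E - F)) \<le> real (card ?E1) + real (card ?E2)" by linarith
    also have "\<dots> \<le> card ?J1 * (N * (1 + \<delta>)) + card ?J2 * (N * (1 + \<delta>))"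
      by (intro add_mono cardE_le) auto
    also have "\<dots> \<le> L * (N * (1 + \<delta>)) + L * (N * (1 + \<delta>))"
    proof (intro add_mono mult_right_mono N1)
      show "real (card ?J1) \<le> real L" using card_mono[of "{1..L}" ?J1] by simp
      have "card ?J2 \<le> card {r - 2 * L..<r - L}" by (rule card_mono) auto
      then show "real (card ?J2) \<le> real L" by simp
    qed
    finally show ?thesis by (simp only: mult_2 distrib_right of_nat_add)
  qed
  have "3 * (\<Sum>(a, b)\<in>E. h a b) \<le> (1 + 4 * \<delta>) * card E + 3 * real (card (E - F))"
  proof (rule sum_edges_le[OF finE _ \<delta>(1) NM(2)])
    show "F \<subseteq> E" by (auto simp: F_def)
    show "\<bar>real (card (case e of (a, b) \<Rightarrow> {c. (b, c) \<in> E \<and> (c, a) \<in> E})) - M\<bar> \<le> \<delta> * M" if "e \<in> F" for e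
      using A.tripod_count[OF w eq2, of "fst e" "snd e"] that L
      by (auto simp: F_def E_def M_def r_def)
    show "(case e of (a, b) \<Rightarrow> {c. (b, c) \<in> E \<and> (c, a) \<in> E}) = {}" if "e \<in> E - F" for e
      using that by (auto simp: F_def E_def A.edges_def r_def)
  qed (use h1 h3 in auto)
  also have "\<dots> \<le> (1 + 4 * \<delta>) * (r * (N * (1 + \<delta>))) + 3 * (2 * real L * (N * (1 + \<delta>)))"
  proof (rule add_mono)
    show "(1 + 4 * \<delta>) * card E \<le> (1 + 4 * \<delta>) * (r * (N * (1 + \<delta>)))"
      by (rule mult_left_mono[OF cardE]) (use \<delta> in auto)
    show "3 * real (card (E - F)) \<le> 3 * (2 * real L * (N * (1 + \<delta>)))"
      by (rule mult_left_mono[OF cardF]) simp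
  qed
  finally have upper: "3 * (\<Sum>(a, b)\<in>E. h a b) \<le> N * ((1 + \<delta>) * (1 + 4 * \<delta>) * r + 6 * real L * (1 + \<delta>))"
    by (simp add: algebra_simps)
  have step: "\<bar>\<phi> (p (Suc i)) - \<phi> (p i)\<bar> \<le> C + 1" if "i < r" for i
  proof -
    have "\<bar>\<phi> (p i) + \<phi> (w ! i) - \<phi> (p i \<otimes> w ! i)\<bar> \<le> 1"
      by (rule tri) (use pc wc that in \<open>auto simp: r_def subset_iff\<close>)
    moreover have "\<bar>\<phi> (w ! i)\<bar> \<le> C" using \<phi> w that by (auto simp: tame_cochain_def r_def subset_iff)
    moreover have "p (Suc i) = p i \<otimes> w ! i"
      using that wc tc by (auto simp: p_def take_Suc_conv_app_nth r_def subset_iff)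
    ultimately show ?thesis by (simp add: abs_le_iff)
  qed
  have steps: "\<bar>\<phi> (p (i + n)) - \<phi> (p i)\<bar> \<le> (C + 1) * n" if "i + n \<le> r" for i n
    using that
  proof (induction n)
    case (Suc n)
    then show ?case using step[of "i + n"] by (auto simp: algebra_simps abs_le_iff)
  qed simp
  have dI: "\<bar>d i\<bar> \<le> (C + 1) * L" if "i \<in> I" for i
    unfolding d_def by (rule steps) (use that in \<open>auto simp: I_def\<close>)
  have tele: "(\<Sum>i\<in>I. d i) \<ge> L * (\<phi> (p r) - (C + 1) * (L + 1))"
  proof -
    have "(\<Sum>i\<in>I. d i) = (\<Sum>i\<in>I. \<Sum>t<L. \<phi> (p (i + Suc t)) - \<phi> (p (i + t)))"
    proof (intro sum.cong refl)
      fix i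
      show "d i = (\<Sum>t<L. \<phi> (p (i + Suc t)) - \<phi> (p (i + t)))"
        using sum_lessThan_telescope[of "\<lambda>t. \<phi> (p (i + t))" L] by (simp add: d_def)
    qed
    also have "\<dots> = (\<Sum>t<L. \<Sum>i\<in>I. \<phi> (p (Suc i + t)) - \<phi> (p (i + t)))"
      by (subst sum.swap) simp
    also have "\<dots> = (\<Sum>t<L. \<phi> (p (r - L + t)) - \<phi> (p (1 + t)))"
      unfolding I_def using L by (intro sum.cong refl sum_Suc_diff') (auto simp: r_def)
    also have "\<dots> \<ge> (\<Sum>t<L. \<phi> (p r) - (C + 1) * (L + 1))"
    proof (rule sum_mono)
      fix t assume t: "t \<in> {..<L}"
      have "\<bar>\<phi> (p ((r - L + t) + (L - t))) - \<phi> (p (r - L + t))\<bar> \<le> (C + 1) * (L - t)"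
        by (rule steps) (use t L in \<open>auto simp: r_def\<close>)
      moreover have "(r - L + t) + (L - t) = r" using t L by (auto simp: r_def)
      moreover have "\<bar>\<phi> (p (0 + (1 + t))) - \<phi> (p 0)\<bar> \<le> (C + 1) * (1 + t)"
        by (rule steps) (use t L in \<open>auto simp: r_def\<close>)
      moreover have "\<phi> (p 0) = 0" using phi0 by (simp add: p_def)
      moreover have "(C + 1) * real (L - t) + (C + 1) * real (1 + t) = (C + 1) * (L + 1)"
        using t by (simp add: of_nat_diff algebra_simps)
      ultimately show "\<phi> (p r) - (C + 1) * (L + 1) \<le> \<phi> (p (r - L + t)) - \<phi> (p (1 + t))"
        by (simp add: abs_le_iff)
    qed
    finally show ?thesis by simp
  qed
  have "N * (L * (\<phi> (p r) - (C + 1) * (L + 1))) - \<delta> * N * (r * ((C + 1) * L)) \<le> (\<Sum>i\<in>I. card (D i) * d i)"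
  proof -
    have "(\<Sum>i\<in>I. \<delta> * N * ((C + 1) * L)) \<le> r * (\<delta> * N * ((C + 1) * L))"
      using cardI \<delta> NM C by (simp add: mult_right_mono)
    moreover have "N * (L * (\<phi> (p r) - (C + 1) * (L + 1))) \<le> N * (\<Sum>i\<in>I. d i)"
      using tele NM by (intro mult_left_mono) auto
    moreover have "(\<Sum>i\<in>I. N * d i - \<delta> * N * ((C + 1) * L)) \<le> (\<Sum>i\<in>I. card (D i) * d i)"
    proof (rule sum_mono)
      fix i assume i: "i \<in> I"
      have "(N - card (D i)) * d i \<le> \<bar>N - card (D i)\<bar> * \<bar>d i\<bar>" by (metis abs_ge_self abs_mult)
      also have "\<dots> \<le> (\<delta> * N) * ((C + 1) * L)"
        using deg[OF i] dI[OF i] by (intro mult_mono) (auto simp: abs_minus_commute)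
      finally show "N * d i - \<delta> * N * ((C + 1) * L) \<le> card (D i) * d i" by (simp add: algebra_simps)
    qed
    ultimately show ?thesis by (simp add: sum_subtractf sum_distrib_left algebra_simps)
  qed
  also have "\<dots> = (\<Sum>(a, b)\<in>E. h a b)" unfolding hd sum_E ..
  finally have lower: "N * (L * (\<phi> (p r) - (C + 1) * (L + 1))) - \<delta> * N * (r * ((C + 1) * L)) \<le>
     (\<Sum>(a, b)\<in>E. h a b)" .
  have "3 * (N * (L * (\<phi> (p r) - (C + 1) * (L + 1))) - \<delta> * N * (r * ((C + 1) * L))) \<le>
     3 * (\<Sum>(a, b)\<in>E. h a b)" by (rule mult_left_mono[OF lower]) simp
  from order_trans[OF this upper]
  have "3 * (N * (L * (\<phi> (p r) - (C + 1) * (L + 1))) - \<delta> * N * (r * ((C + 1) * L))) \<le>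
     N * ((1 + \<delta>) * (1 + 4 * \<delta>) * r + 6 * real L * (1 + \<delta>))" .
  then have "N * (3 * L * (\<phi> (p r) - (C + 1) * (L + 1) - \<delta> * (C + 1) * r)) \<le>
     N * ((1 + \<delta>) * (1 + 4 * \<delta>) * r + 6 * real L * (1 + \<delta>))" by (simp add: algebra_simps)
  then have "3 * L * (\<phi> (p r) - (C + 1) * (L + 1) - \<delta> * (C + 1) * r) \<le>
     (1 + \<delta>) * (1 + 4 * \<delta>) * r + 6 * real L * (1 + \<delta>)" using NM by (simp only: mult_le_cancel_left_pos)
  then have "\<phi> (p r) - (C + 1) * (L + 1) - \<delta> * (C + 1) * r \<le>
     ((1 + \<delta>) * (1 + 4 * \<delta>) * r + 6 * real L * (1 + \<delta>)) / (3 * L)"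
    using L by (simp add: pos_le_divide_eq mult.commute)
  also have "\<dots> = (1 + \<delta>) * (1 + 4 * \<delta>) * r / (3 * L) + 2 * (1 + \<delta>)"
    using L by (simp add: add_divide_distrib)
  finally have "\<phi> (p r) \<le> (1 + \<delta>) * (1 + 4 * \<delta>) * r / (3 * L) + 2 * (1 + \<delta>)
     + (C + 1) * (L + 1) + \<delta> * (C + 1) * r" by linarith
  moreover have "p r = list_prod G w" by (simp add: p_def r_def)
  ultimately show ?thesis by (simp add: r_def)
qed

end

section \<open>Equidistribution of random reduced words\<close>

context involutive_alphabet
begin

definition branching :: real where "branching = 2 * real k - 1"

lemma branching_ge_1: "branching \<ge> 1"
  using k_pos by (simp add: branching_def)

lemma freq_branching: "freq m = 1 / (2 * real k * branching ^ (m - 1))"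
  by (simp add: freq_def branching_def)

definition extensions :: "'a \<Rightarrow> nat \<Rightarrow> 'a list set" where
  "extensions a n = {w. length w = n \<and> set w \<subseteq> S \<and> reduced (a # w)}"

lemma finite_extensions: "finite (extensions a n)"
  by (rule finite_subset[OF _ finite_lists_length_eq[OF finite_S, of n]]) (auto simp: extensions_def)

lemma extensions_0 [simp]: "extensions a 0 = {[]}"
  by (auto simp: extensions_def reduced_def)

lemma reduced_Cons: "reduced (a # w) \<longleftrightarrow> reduced w \<and> (w = [] \<or> hd w \<noteq> bar a)"
  using reduced_append[of "[a]" w] by (auto simp: reduced_def)

lemma reduced_Cons_append:
  "reduced (a # u @ v) \<longleftrightarrow> reduced (a # u) \<and> reduced (last (a # u) # v)"
  using reduced_append[of "a # u" v] reduced_Cons[of "last (a # u)" v] by (auto simp: reduced_Cons)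

lemma sum_extensions_split:
  "(\<Sum>w\<in>extensions a (m + n). f w) =
   (\<Sum>u\<in>extensions a m. \<Sum>v\<in>extensions (last (a # u)) n. f (u @ v))"
proof -
  have "(\<Sum>w\<in>extensions a (m + n). f w) =
    (\<Sum>(u, v)\<in>(SIGMA u:extensions a m. extensions (last (a # u)) n). f (u @ v))"
  proof (rule sum.reindex_bij_witness[of _ "\<lambda>(u, v). u @ v" "\<lambda>w. (take m w, drop m w)"])
    fix w assume w: "w \<in> extensions a (m + n)"
    have "reduced (a # take m w @ drop m w)" using w by (simp add: extensions_def)
    then have "reduced (a # take m w)" "reduced (last (a # take m w) # drop m w)"
      by (simp_all only: reduced_Cons_append)
    then show "(take m w, drop m w) \<in> (SIGMA u:extensions a m. extensions (last (a # u)) n)"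
      using w set_take_subset[of m w] set_drop_subset[of m w] by (auto simp: extensions_def)
  next
    fix x assume "x \<in> (SIGMA u:extensions a m. extensions (last (a # u)) n)"
    then obtain u v where x: "x = (u, v)" "length u = m" "set u \<subseteq> S" "reduced (a # u)"
      "length v = n" "set v \<subseteq> S" "reduced (last (a # u) # v)" by (auto simp: extensions_def)
    then show "(case x of (u, v) \<Rightarrow> u @ v) \<in> extensions a (m + n)"
      using reduced_Cons_append[of a u v] by (simp add: extensions_def)
    show "(take m (case x of (u, v) \<Rightarrow> u @ v), drop m (case x of (u, v) \<Rightarrow> u @ v)) = x"
      using x by simp
  qed auto
  also have "\<dots> = (\<Sum>u\<in>extensions a m. \<Sum>v\<in>extensions (last (a # u)) n. f (u @ v))"
    by (rule sum.Sigma[symmetric]) (auto simp: finite_extensions)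
  finally show ?thesis .
qed

lemma extensions_1: "extensions a (Suc 0) = (\<lambda>s. [s]) ` (S - {bar a})"
proof (intro equalityI subsetI)
  fix w assume "w \<in> extensions a (Suc 0)"
  then obtain s where "w = [s]" "s \<in> S" "s \<noteq> bar a"
    by (auto simp: extensions_def reduced_Cons length_Suc_conv)
  then show "w \<in> (\<lambda>s. [s]) ` (S - {bar a})" by auto
qed (auto simp: extensions_def reduced_Cons reduced_def)

lemma last_in_S: "a \<in> S \<Longrightarrow> u \<in> extensions a n \<Longrightarrow> last (a # u) \<in> S"
  by (auto simp: extensions_def)

lemma card_extensions:
  assumes "a \<in> S" shows "real (card (extensions a n)) = branching ^ n"
  using assms
proof (induction n arbitrary: a)
  case (Suc n)
  have "real (card (extensions a (Suc n))) = (\<Sum>w\<in>extensions a (n + 1). 1)" by simp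
  also have "\<dots> = (\<Sum>u\<in>extensions a n. \<Sum>v\<in>extensions (last (a # u)) 1. 1)"
    by (rule sum_extensions_split)
  also have "\<dots> = (\<Sum>u\<in>extensions a n. branching)"
  proof (rule sum.cong[OF refl])
    fix u assume u: "u \<in> extensions a n"
    have "last (a # u) \<in> S" by (rule last_in_S[OF Suc.prems u])
    then have "card (extensions (last (a # u)) 1) = 2 * k - 1"
      unfolding One_nat_def extensions_1
      by (subst card_image) (auto simp: inj_on_def card_Diff_singleton_if bar_in card_S)
    then show "(\<Sum>v\<in>extensions (last (a # u)) 1. 1) = branching"
      using k_pos by (simp add: branching_def of_nat_diff)
  qed
  also have "\<dots> = branching ^ Suc n" using Suc by simp
  finally show ?case .
qed simp

text \<open>The deviation from the mean changes its sign and keeps its absolute value in each step, since the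
words with last letter \<open>s\<close> arise from all words except those with last letter \<open>bar s\<close>.
Relative to the total number the deviation is therefore exponentially small.\<close>

lemma card_extensions_last:
  assumes "a \<in> S" "s \<in> S"
  shows "\<bar>real (card {u \<in> extensions a q. last (a # u) = s}) - branching ^ q / (2 * real k)\<bar> \<le> 1"
  using assms(2)
proof (induction q arbitrary: s)
  case 0
  have eq: "{u \<in> extensions a 0. last (a # u) = s} = (if a = s then {[]} else {})" by auto
  have "0 \<le> 1 / (2 * real k)" "1 / (2 * real k) \<le> 1" using k_pos by auto
  then show ?case unfolding eq by auto
next
  case (Suc q)
  let ?e = "\<lambda>q s. real (card {u \<in> extensions a q. last (a # u) = s})"
  have bs: "bar s \<in> S" using Suc.prems bar_in by simp
  have fin: "finite {u \<in> extensions a n. P u}" for n P using finite_extensions by auto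
  have "?e (Suc q) s = (\<Sum>w\<in>extensions a (q + 1). if last (a # w) = s then 1 else 0)"
    by (subst sum.If_cases) (auto simp: finite_extensions Int_def)
  also have "\<dots> = (\<Sum>u\<in>extensions a q. \<Sum>v\<in>extensions (last (a # u)) 1. if last (a # u @ v) = s then 1 else 0)"
    by (rule sum_extensions_split)
  also have "\<dots> = (\<Sum>u\<in>extensions a q. if last (a # u) = bar s then 0 else 1)"
  proof (rule sum.cong[OF refl])
    fix u assume u: "u \<in> extensions a q"
    let ?t = "last (a # u)"
    have t: "?t \<in> S" by (rule last_in_S[OF assms(1) u])
    have "(\<Sum>v\<in>extensions ?t 1. if last (a # u @ v) = s then 1 else (0::real)) =
       (\<Sum>x\<in>S - {bar ?t}. if x = s then 1 else 0)"
      unfolding One_nat_def extensions_1 by (subst sum.reindex) (auto simp: inj_on_def)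
    also have "\<dots> = (if s \<in> S - {bar ?t} then 1 else 0)"
      using finite_S by (simp add: sum.delta')
    also have "\<dots> = (if ?t = bar s then 0 else 1)"
      using Suc.prems t bar_eq_iff[of s ?t] bar_bar by auto
    finally show "(\<Sum>v\<in>extensions ?t 1. if last (a # u @ v) = s then 1 else (0::real)) =
       (if ?t = bar s then 0 else 1)" .
  qed
  also have "\<dots> = (\<Sum>u\<in>extensions a q. 1 - (if last (a # u) = bar s then 1 else 0))"
    by (rule sum.cong) auto
  also have "\<dots> = real (card (extensions a q)) - ?e q (bar s)"
    by (subst sum_subtractf, subst sum.If_cases) (auto simp: finite_extensions Int_def)
  also have "\<dots> = branching ^ q - ?e q (bar s)" using card_extensions[OF assms(1)] by simp
  finally have *: "?e (Suc q) s = branching ^ q - ?e q (bar s)" .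
  have "branching ^ Suc q / (2 * real k) = branching ^ q - branching ^ q / (2 * real k)"
    using k_pos by (simp add: branching_def field_simps)
  then show ?case using * Suc.IH[OF bs] by (simp add: abs_le_iff)
qed

lemma card_extensions_suffix:
  assumes a: "a \<in> S" and y: "set y \<subseteq> S" "reduced y" "length y = m" "m \<ge> 1"
  shows "\<bar>real (card {w \<in> extensions a (q + m). drop q w = y}) - branching ^ Suc q / (2 * real k)\<bar> \<le> 1"
proof -
  have yne: "y \<noteq> []" using y by auto
  have hy: "hd y \<in> S" using y yne by auto
  have "real (card {w \<in> extensions a (q + m). drop q w = y}) =
     (\<Sum>w\<in>extensions a (q + m). if drop q w = y then 1 else 0)"
    by (subst sum.If_cases) (auto simp: finite_extensions Int_def)
  also have "\<dots> = (\<Sum>u\<in>extensions a q. \<Sum>v\<in>extensions (last (a # u)) m. if drop q (u @ v) = y then 1 else 0)"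
    by (rule sum_extensions_split)
  also have "\<dots> = (\<Sum>u\<in>extensions a q. 1 - (if last (a # u) = bar (hd y) then 1 else 0))"
  proof (rule sum.cong[OF refl])
    fix u assume u: "u \<in> extensions a q"
    let ?t = "last (a # u)"
    have t: "?t \<in> S" by (rule last_in_S[OF a u])
    have lu: "length u = q" using u by (simp add: extensions_def)
    have "(\<Sum>v\<in>extensions ?t m. if drop q (u @ v) = y then 1 else (0::real)) =
      (\<Sum>v\<in>extensions ?t m. if v = y then 1 else 0)"
      using lu by simp
    also have "\<dots> = (if y \<in> extensions ?t m then 1 else 0)"
      by (simp add: sum.delta' finite_extensions)
    also have "y \<in> extensions ?t m \<longleftrightarrow> hd y \<noteq> bar ?t"
      using y yne by (simp add: extensions_def reduced_Cons)
    also have "hd y \<noteq> bar ?t \<longleftrightarrow> ?t \<noteq> bar (hd y)" using bar_eq_iff[of ?t "hd y"] t hy by auto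
    finally show "(\<Sum>v\<in>extensions ?t m. if drop q (u @ v) = y then 1 else (0::real)) =
       1 - (if ?t = bar (hd y) then 1 else 0)" by simp
  qed
  also have "\<dots> = real (card (extensions a q)) - real (card {u \<in> extensions a q. last (a # u) = bar (hd y)})"
    by (subst sum_subtractf, subst sum.If_cases) (auto simp: finite_extensions Int_def)
  also have "\<dots> = branching ^ q - real (card {u \<in> extensions a q. last (a # u) = bar (hd y)})"
    using card_extensions[OF a] by simp
  finally have *: "real (card {w \<in> extensions a (q + m). drop q w = y}) =
    branching ^ q - real (card {u \<in> extensions a q. last (a # u) = bar (hd y)})" .
  have "branching ^ Suc q / (2 * real k) = branching ^ q - branching ^ q / (2 * real k)"
    using k_pos by (simp add: branching_def field_simps)
  then show ?thesis using * card_extensions_last[OF a bar_in[OF hy], of q] by (simp add: abs_le_iff)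
qed

text \<open>Cut \<open>w\<close> into \<open>N\<close> windows of length \<open>l = q + length y\<close>; count those windows that end with \<open>y\<close>. The
gap of length \<open>q\<close> makes the windows almost independent.\<close>

definition hits :: "'a list \<Rightarrow> nat \<Rightarrow> nat \<Rightarrow> nat \<Rightarrow> 'a list \<Rightarrow> nat" where
  "hits y q l N w = card {j. j < N \<and> take (length y) (drop (j * l + q) w) = y}"

lemma hits_append:
  assumes "length u = l" "l = q + length y"
  shows "hits y q l (Suc N) (u @ v) = (if drop q u = y then 1 else 0) + hits y q l N v"
proof -
  let ?P = "\<lambda>j. take (length y) (drop (j * l + q) (u @ v)) = y"
  have "{j. j < Suc N \<and> ?P j} = (if ?P 0 then {0} else {}) \<union> Suc ` {j. j < N \<and> ?P (Suc j)}"
    by (auto simp: image_iff less_Suc_eq_0_disj)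
  also have "card \<dots> = (if ?P 0 then 1 else 0) + card {j. j < N \<and> ?P (Suc j)}"
    by (subst card_Un_disjoint) (auto simp: card_image)
  also have "?P 0 \<longleftrightarrow> drop q u = y" using assms by simp
  also have "{j. j < N \<and> ?P (Suc j)} = {j. j < N \<and> take (length y) (drop (j * l + q) v) = y}"
    using assms by (simp add: add.assoc)
  finally show ?thesis unfolding hits_def .
qed

text \<open>Exponential moment of the number of hits: each window contributes at most the factor \<open>\<kappa>\<close>, whatever the
letter before it is.\<close>

lemma sum_power_hits:
  fixes \<theta> \<kappa> :: real
  assumes y: "set y \<subseteq> S" "reduced y" "length y = m" "m \<ge> 1" and a: "a \<in> S" and \<theta>: "\<theta> > 0"
    and \<kappa>: "\<And>a. a \<in> S \<Longrightarrow> branching ^ (q + m) + (\<theta> - 1) * card {w \<in> extensions a (q + m). drop q w = y}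
        \<le> branching ^ (q + m) * \<kappa>"
  shows "(\<Sum>w\<in>extensions a (N * (q + m)). \<theta> ^ hits y q (q + m) N w) \<le> (branching ^ (q + m) * \<kappa>) ^ N"
  using a
proof (induction N arbitrary: a)
  case 0
  then show ?case by (simp add: hits_def)
next
  case (Suc N)
  let ?l = "q + m" and ?K = "branching ^ (q + m) * \<kappa>"
  have "0 \<le> branching ^ ?l + (\<theta> - 1) * card {w \<in> extensions a ?l. drop q w = y}"
  proof -
    have "card {w \<in> extensions a ?l. drop q w = y} \<le> card (extensions a ?l)"
      by (rule card_mono) (auto simp: finite_extensions)
    then have "real (card {w \<in> extensions a ?l. drop q w = y}) \<le> branching ^ ?l"
      using card_extensions[OF Suc.prems, of ?l] by linarith
    moreover have "(\<theta> - 1) * card {w \<in> extensions a ?l. drop q w = y} \<ge>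
       - real (card {w \<in> extensions a ?l. drop q w = y})"
      using \<theta> by (simp add: left_diff_distrib)
    ultimately show ?thesis by linarith
  qed
  then have K0: "0 \<le> ?K" using \<kappa>[OF Suc.prems] by linarith
  have "(\<Sum>w\<in>extensions a (Suc N * ?l). \<theta> ^ hits y q ?l (Suc N) w) =
    (\<Sum>w\<in>extensions a (?l + N * ?l). \<theta> ^ hits y q ?l (Suc N) w)" by simp
  also have "\<dots> = (\<Sum>u\<in>extensions a ?l. \<Sum>v\<in>extensions (last (a # u)) (N * ?l).
      \<theta> ^ hits y q ?l (Suc N) (u @ v))" by (rule sum_extensions_split)
  also have "\<dots> = (\<Sum>u\<in>extensions a ?l. (if drop q u = y then \<theta> else 1) *
      (\<Sum>v\<in>extensions (last (a # u)) (N * ?l). \<theta> ^ hits y q ?l N v))"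
  proof (rule sum.cong[OF refl])
    fix u assume "u \<in> extensions a ?l"
    then have "length u = ?l" by (simp add: extensions_def)
    then show "(\<Sum>v\<in>extensions (last (a # u)) (N * ?l). \<theta> ^ hits y q ?l (Suc N) (u @ v)) =
      (if drop q u = y then \<theta> else 1) * (\<Sum>v\<in>extensions (last (a # u)) (N * ?l). \<theta> ^ hits y q ?l N v)"
      using y(3) by (simp add: hits_append sum_distrib_left)
  qed
  also have "\<dots> \<le> (\<Sum>u\<in>extensions a ?l. (if drop q u = y then \<theta> else 1) * ?K ^ N)"
    using \<theta> by (intro sum_mono mult_left_mono Suc.IH last_in_S[OF Suc.prems]) auto
  also have "\<dots> = (\<Sum>u\<in>extensions a ?l. 1 + (\<theta> - 1) * (if drop q u = y then 1 else 0)) * ?K ^ N"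
    unfolding sum_distrib_right by (rule sum.cong) auto
  also have "(\<Sum>u\<in>extensions a ?l. 1 + (\<theta> - 1) * (if drop q u = y then 1 else 0)) =
     card (extensions a ?l) + (\<theta> - 1) * (\<Sum>u\<in>extensions a ?l. if drop q u = y then 1 else 0)"
    by (simp add: sum.distrib sum_distrib_left)
  also have "(\<Sum>u\<in>extensions a ?l. if drop q u = y then 1 else 0) = real (card {w \<in> extensions a ?l. drop q w = y})"
    by (subst sum.If_cases) (auto simp: finite_extensions Int_def)
  also have "(real (card (extensions a ?l)) + (\<theta> - 1) * real (card {w \<in> extensions a ?l. drop q w = y})) * ?K ^ N \<le> ?K * ?K ^ N"
    using \<kappa>[OF Suc.prems] K0 card_extensions[OF Suc.prems, of ?l] by (intro mult_right_mono) auto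
  finally show ?case by simp
qed

lemma exp_le_quadratic:
  assumes "\<bar>x\<bar> \<le> (1::real)" shows "exp x \<le> 1 + x + x\<^sup>2"
proof (cases "x \<ge> 0")
  case True
  then show ?thesis using exp_bound[of x] assms by simp
next
  case False
  have "1 - x \<le> exp (- x)" using exp_ge_add_one_self[of "-x"] by simp
  then have "exp x \<le> 1 / (1 - x)"
    using False by (simp add: exp_minus field_simps)
  also have "\<dots> \<le> 1 + x + x\<^sup>2"
  proof -
    have "(1 + x + x\<^sup>2) * (1 - x) = 1 - x ^ 3" by (simp add: algebra_simps power2_eq_square power3_eq_cube)
    moreover have "x ^ 3 \<le> 0" using False by (simp add: power3_eq_cube mult_nonneg_nonpos2 mult_nonpos_nonpos mult_le_0_iff)
    ultimately show ?thesis using False by (simp add: divide_le_eq)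
  qed
  finally show ?thesis .
qed

text \<open>Chernoff bound. The hypothesis on \<open>q\<close> says that the gaps make the conditional
probability of a hit equal to \<open>\<rho>\<close> up to the relative error \<open>\<delta>/4\<close>.\<close>

lemma hits_concentration:
  assumes y: "set y \<subseteq> S" "reduced y" "length y = m" "m \<ge> 1" and a: "a \<in> S"
    and \<delta>: "0 < \<delta>" "\<delta> \<le> 1" and q: "2 * real k / branching ^ Suc q \<le> \<delta> / 4"
  defines "\<rho> \<equiv> freq m"
  shows "real (card {w \<in> extensions a (N * (q + m)). \<not> \<bar>real (hits y q (q + m) N w) - N * \<rho>\<bar> \<le> \<delta> * (N * \<rho>)})
    \<le> 2 * exp (- (\<delta>\<^sup>2 * (N * \<rho>) / 16)) * branching ^ (N * (q + m))"
proof -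
  define l where "l = q + m"
  define \<tau> where "\<tau> = 2 * real k / branching ^ Suc q"
  define c where "c a = real (card {w \<in> extensions a l. drop q w = y})" for a
  define H where "H w = real (hits y q l N w)" for w
  have b1: "branching > 0" using branching_ge_1 by simp
  have \<rho>: "\<rho> > 0" using b1 k_pos by (simp add: \<rho>_def freq_branching)
  have \<tau>: "0 \<le> \<tau>" "\<tau> \<le> \<delta> / 4" using b1 q by (auto simp: \<tau>_def)
  have bl: "branching ^ l * \<rho> = branching ^ Suc q / (2 * real k)"
  proof -
    have "l = Suc q + (m - 1)" using y by (simp add: l_def)
    then show ?thesis using b1 unfolding \<rho>_def freq_branching by (simp add: power_add)
  qed
  have bl1: "branching ^ l * \<rho> * \<tau> = 1" unfolding bl \<tau>_def using b1 k_pos by simp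
  have c: "\<bar>c a - branching ^ l * \<rho>\<bar> \<le> branching ^ l * \<rho> * \<tau>" if "a \<in> S" for a
    using card_extensions_suffix[OF that y, of q] unfolding bl1 unfolding bl unfolding c_def l_def .
  have tail: "real (card {w \<in> extensions a (N * l). P w}) \<le> exp (- (\<delta>\<^sup>2 * (N * \<rho>) / 16)) * branching ^ (N * l)"
    if P: "\<And>w. P w \<Longrightarrow> \<sigma> * H w \<ge> \<mu> * (N * \<rho>)"
      and \<kappa>: "\<And>a. a \<in> S \<Longrightarrow> (exp \<sigma> - 1) * c a \<le> branching ^ l * \<rho> * \<nu>"
      and ex: "\<nu> - \<mu> \<le> - (\<delta>\<^sup>2 / 16)" for P \<sigma> \<mu> \<nu>
  proof -
    have "real (card {w \<in> extensions a (N * l). P w}) * exp (\<mu> * (N * \<rho>)) =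
       (\<Sum>w\<in>{w \<in> extensions a (N * l). P w}. exp (\<mu> * (N * \<rho>)))" by simp
    also have "\<dots> \<le> (\<Sum>w\<in>{w \<in> extensions a (N * l). P w}. exp \<sigma> ^ hits y q l N w)"
      by (rule sum_mono) (use P in \<open>auto simp: H_def exp_of_nat2_mult[symmetric] mult.commute\<close>)
    also have "\<dots> \<le> (\<Sum>w\<in>extensions a (N * l). exp \<sigma> ^ hits y q l N w)"
      by (rule sum_mono2) (auto simp: finite_extensions)
    also have "\<dots> \<le> (branching ^ l * exp (\<rho> * \<nu>)) ^ N"
      unfolding l_def
    proof (rule sum_power_hits[OF y a])
      fix a assume "a \<in> S"
      then have "branching ^ l + (exp \<sigma> - 1) * c a \<le> branching ^ l + branching ^ l * \<rho> * \<nu>"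
        using \<kappa> by simp
      also have "\<dots> = branching ^ l * (1 + \<rho> * \<nu>)" by (simp add: algebra_simps)
      also have "\<dots> \<le> branching ^ l * exp (\<rho> * \<nu>)"
        using b1 by (intro mult_left_mono exp_ge_add_one_self) auto
      finally show "branching ^ (q + m) + (exp \<sigma> - 1) * real (card {w \<in> extensions a (q + m). drop q w = y})
         \<le> branching ^ (q + m) * exp (\<rho> * \<nu>)" by (simp add: c_def l_def)
    qed simp
    also have "\<dots> = branching ^ (N * l) * exp (N * \<rho> * \<nu>)"
      by (simp add: power_mult_distrib power_mult[symmetric] exp_of_nat_mult[symmetric] mult.commute mult.assoc)
    finally have "real (card {w \<in> extensions a (N * l). P w}) \<le> branching ^ (N * l) * exp (N * \<rho> * \<nu> - \<mu> * (N * \<rho>))"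
      by (simp add: exp_diff field_simps)
    also have "\<dots> \<le> branching ^ (N * l) * exp (- (\<delta>\<^sup>2 * (N * \<rho>) / 16))"
    proof -
      have "(N * \<rho>) * (\<nu> - \<mu>) \<le> (N * \<rho>) * (- (\<delta>\<^sup>2 / 16))"
        using ex \<rho> by (intro mult_left_mono) auto
      then have "N * \<rho> * \<nu> - \<mu> * (N * \<rho>) \<le> - (\<delta>\<^sup>2 * (N * \<rho>) / 16)" by (simp add: algebra_simps)
      then show ?thesis using b1 by (intro mult_left_mono) auto
    qed
    finally show ?thesis by (simp add: mult.commute)
  qed
  \<comment> \<open>Minimizes \<open>\<sigma>\<^sup>2 - \<sigma> \<delta> / 2\<close>, where half of \<open>\<delta>\<close> has been used up by the error \<open>\<tau>\<close>.\<close>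
  define \<sigma> where "\<sigma> = \<delta> / 4"
  have \<sigma>: "0 < \<sigma>" "\<sigma> \<le> 1" using \<delta> by (auto simp: \<sigma>_def)
  have \<sigma>2: "\<sigma>\<^sup>2 \<le> \<sigma>" using \<sigma> by (simp add: power2_eq_square mult_left_le)
  have \<sigma>\<tau>: "\<tau> * \<sigma> \<le> \<sigma> * \<delta> / 4" using mult_right_mono[OF \<tau>(2), of \<sigma>] \<sigma> by (simp add: mult.commute)
  have eq16: "\<sigma>\<^sup>2 = \<delta>\<^sup>2 / 16" "\<sigma> * \<delta> = \<delta>\<^sup>2 / 4" by (simp_all add: \<sigma>_def power2_eq_square)
  have upper: "real (card {w \<in> extensions a (N * l). H w > (1 + \<delta>) * (N * \<rho>)}) \<le> exp (- (\<delta>\<^sup>2 * (N * \<rho>) / 16)) * branching ^ (N * l)"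
  proof (rule tail[where \<sigma> = \<sigma> and \<mu> = "\<sigma> * (1 + \<delta>)" and \<nu> = "(1 + \<tau>) * (\<sigma> + \<sigma>\<^sup>2)"])
    fix a assume a: "a \<in> S"
    have "c a \<le> branching ^ l * \<rho> * (1 + \<tau>)" using c[OF a] by (simp add: abs_le_iff algebra_simps)
    moreover have "exp \<sigma> - 1 \<le> \<sigma> + \<sigma>\<^sup>2" using exp_le_quadratic[of \<sigma>] \<sigma> by simp
    ultimately have "(exp \<sigma> - 1) * c a \<le> (\<sigma> + \<sigma>\<^sup>2) * (branching ^ l * \<rho> * (1 + \<tau>))"
      using \<sigma> by (intro mult_mono) (auto simp: c_def)
    then show "(exp \<sigma> - 1) * c a \<le> branching ^ l * \<rho> * ((1 + \<tau>) * (\<sigma> + \<sigma>\<^sup>2))" by (simp add: mult_ac)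
  next
    have "\<tau> * \<sigma>\<^sup>2 \<le> \<tau> * \<sigma>" using \<tau> \<sigma>2 by (intro mult_left_mono) auto
    moreover have "(1 + \<tau>) * (\<sigma> + \<sigma>\<^sup>2) - \<sigma> * (1 + \<delta>) = \<sigma>\<^sup>2 + \<tau> * \<sigma> + \<tau> * \<sigma>\<^sup>2 - \<sigma> * \<delta>" by (simp add: algebra_simps)
    ultimately show "(1 + \<tau>) * (\<sigma> + \<sigma>\<^sup>2) - \<sigma> * (1 + \<delta>) \<le> - (\<delta>\<^sup>2 / 16)"
      using \<sigma>\<tau> eq16 by linarith
  next
    fix w assume "H w > (1 + \<delta>) * (N * \<rho>)"
    then have "\<sigma> * ((1 + \<delta>) * (N * \<rho>)) \<le> \<sigma> * H w" using \<sigma> by (intro mult_left_mono) auto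
    then show "\<sigma> * (1 + \<delta>) * (N * \<rho>) \<le> \<sigma> * H w" by (simp add: mult.assoc)
  qed
  have lower: "real (card {w \<in> extensions a (N * l). H w < (1 - \<delta>) * (N * \<rho>)}) \<le> exp (- (\<delta>\<^sup>2 * (N * \<rho>) / 16)) * branching ^ (N * l)"
  proof (rule tail[where \<sigma> = "- \<sigma>" and \<mu> = "- (\<sigma> * (1 - \<delta>))" and \<nu> = "- ((1 - \<tau>) * (\<sigma> - \<sigma>\<^sup>2))"])
    fix a assume a: "a \<in> S"
    have t1: "0 \<le> 1 - \<tau>" using \<tau> \<delta> by simp
    have "branching ^ l * \<rho> * (1 - \<tau>) \<le> c a" using c[OF a] by (simp add: abs_le_iff algebra_simps)
    moreover have "\<sigma> - \<sigma>\<^sup>2 \<le> 1 - exp (- \<sigma>)" using exp_le_quadratic[of "- \<sigma>"] \<sigma> by simp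
    ultimately have "(\<sigma> - \<sigma>\<^sup>2) * (branching ^ l * \<rho> * (1 - \<tau>)) \<le> (1 - exp (- \<sigma>)) * c a"
      using \<sigma> \<sigma>2 b1 \<rho> t1 by (intro mult_mono) (auto simp: c_def)
    then show "(exp (- \<sigma>) - 1) * c a \<le> branching ^ l * \<rho> * - ((1 - \<tau>) * (\<sigma> - \<sigma>\<^sup>2))"
      by (simp add: algebra_simps)
  next
    have "- ((1 - \<tau>) * (\<sigma> - \<sigma>\<^sup>2)) - - (\<sigma> * (1 - \<delta>)) = \<sigma>\<^sup>2 + \<tau> * \<sigma> - \<tau> * \<sigma>\<^sup>2 - \<sigma> * \<delta>" by (simp add: algebra_simps)
    moreover have "0 \<le> \<tau> * \<sigma>\<^sup>2" using \<tau> by simp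
    moreover have "0 \<le> \<delta>\<^sup>2" by simp
    ultimately show "- ((1 - \<tau>) * (\<sigma> - \<sigma>\<^sup>2)) - - (\<sigma> * (1 - \<delta>)) \<le> - (\<delta>\<^sup>2 / 16)"
      using \<sigma>\<tau> eq16 by linarith
  next
    fix w assume "H w < (1 - \<delta>) * (N * \<rho>)"
    then have "\<sigma> * H w \<le> \<sigma> * ((1 - \<delta>) * (N * \<rho>))" using \<sigma> by (intro mult_left_mono) auto
    then show "- (\<sigma> * (1 - \<delta>)) * (N * \<rho>) \<le> - \<sigma> * H w" by (simp add: mult.assoc)
  qed
  have "{w \<in> extensions a (N * l). \<not> \<bar>H w - N * \<rho>\<bar> \<le> \<delta> * (N * \<rho>)} \<subseteq>
     {w \<in> extensions a (N * l). H w > (1 + \<delta>) * (N * \<rho>)} \<union> {w \<in> extensions a (N * l). H w < (1 - \<delta>) * (N * \<rho>)}"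
    by (auto simp: abs_le_iff algebra_simps)
  then have "card {w \<in> extensions a (N * l). \<not> \<bar>H w - N * \<rho>\<bar> \<le> \<delta> * (N * \<rho>)} \<le>
     card {w \<in> extensions a (N * l). H w > (1 + \<delta>) * (N * \<rho>)} + card {w \<in> extensions a (N * l). H w < (1 - \<delta>) * (N * \<rho>)}"
    by (intro order_trans[OF card_mono card_Un_le]) (auto simp: finite_extensions)
  with upper lower show ?thesis unfolding H_def l_def by simp
qed

definition reduced_words :: "nat \<Rightarrow> 'a list set" where
  "reduced_words r = {w. length w = r \<and> set w \<subseteq> S \<and> reduced w}"

lemma finite_reduced_words: "finite (reduced_words r)"
  by (rule finite_subset[OF _ finite_lists_length_eq[OF finite_S, of r]]) (auto simp: reduced_words_def)

lemma sum_reduced_words_Suc: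
  "(\<Sum>w\<in>reduced_words (Suc n). f w) = (\<Sum>x\<in>S. \<Sum>u\<in>extensions x n. f (x # u))"
proof -
  have "(\<Sum>w\<in>reduced_words (Suc n). f w) = (\<Sum>(x, u)\<in>(SIGMA x:S. extensions x n). f (x # u))"
    by (rule sum.reindex_bij_witness[of _ "\<lambda>(x, u). x # u" "\<lambda>w. (hd w, tl w)"])
      (auto simp: reduced_words_def extensions_def length_Suc_conv)
  also have "\<dots> = (\<Sum>x\<in>S. \<Sum>u\<in>extensions x n. f (x # u))"
    by (rule sum.Sigma[symmetric]) (auto simp: finite_S finite_extensions)
  finally show ?thesis .
qed

lemma card_reduced_words: "real (card (reduced_words (Suc n))) = 2 * real k * branching ^ n"
proof -
  have "real (card (reduced_words (Suc n))) = (\<Sum>w\<in>reduced_words (Suc n). 1)" by simp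
  also have "\<dots> = (\<Sum>x\<in>S. \<Sum>u\<in>extensions x n. 1)" by (rule sum_reduced_words_Suc)
  finally show ?thesis by (simp add: card_extensions card_S)
qed

lemma card_filter_sum:
  "finite A \<Longrightarrow> real (card {x \<in> A. P x}) = (\<Sum>x\<in>A. if P x then 1 else 0)"
  by (subst sum.If_cases) (auto simp: Int_def)

lemma card_reduced_words_window:
  assumes P: "\<And>a. a \<in> S \<Longrightarrow> real (card {v \<in> extensions a n. P v}) \<le> e * branching ^ n"
    and r: "Suc d + n \<le> r"
  shows "real (card {w \<in> reduced_words r. P (take n (drop (Suc d) w))}) \<le> e * real (card (reduced_words r))"
proof -
  obtain t where t: "r = Suc (d + (n + t))" using r by (metis add.assoc add_Suc le_iff_add)
  let ?i = "\<lambda>b. if b then 1 else (0::real)"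
  have b0: "branching \<ge> 0" using branching_ge_1 by simp
  have 1: "(\<Sum>v\<in>extensions a (n + t). ?i (P (take n v))) \<le> e * branching ^ (n + t)" if a: "a \<in> S" for a
  proof -
    have "(\<Sum>v\<in>extensions a (n + t). ?i (P (take n v))) =
      (\<Sum>u\<in>extensions a n. \<Sum>v\<in>extensions (last (a # u)) t. ?i (P (take n (u @ v))))"
      by (rule sum_extensions_split)
    also have "\<dots> = (\<Sum>u\<in>extensions a n. ?i (P u) * branching ^ t)"
    proof (rule sum.cong[OF refl])
      fix u assume u: "u \<in> extensions a n"
      then have "length u = n" by (simp add: extensions_def)
      then show "(\<Sum>v\<in>extensions (last (a # u)) t. ?i (P (take n (u @ v)))) = ?i (P u) * branching ^ t"
        using card_extensions[OF last_in_S[OF a u], of t] by simp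
    qed
    also have "\<dots> = real (card {v \<in> extensions a n. P v}) * branching ^ t"
      unfolding sum_distrib_right[symmetric] by (simp add: card_filter_sum finite_extensions)
    also have "\<dots> \<le> e * branching ^ n * branching ^ t"
      using P[OF a] b0 by (intro mult_right_mono) auto
    finally show ?thesis by (simp add: power_add mult.assoc)
  qed
  have 2: "(\<Sum>w\<in>extensions x (d + (n + t)). ?i (P (take n (drop d w)))) \<le> e * branching ^ (d + (n + t))"
    if x: "x \<in> S" for x
  proof -
    have "(\<Sum>w\<in>extensions x (d + (n + t)). ?i (P (take n (drop d w)))) =
      (\<Sum>u\<in>extensions x d. \<Sum>v\<in>extensions (last (x # u)) (n + t). ?i (P (take n (drop d (u @ v)))))"
      by (rule sum_extensions_split)
    also have "\<dots> = (\<Sum>u\<in>extensions x d. \<Sum>v\<in>extensions (last (x # u)) (n + t). ?i (P (take n v)))"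
      by (intro sum.cong refl) (auto simp: extensions_def)
    also have "\<dots> \<le> (\<Sum>u\<in>extensions x d. e * branching ^ (n + t))"
      by (intro sum_mono 1 last_in_S[OF x])
    finally show ?thesis using card_extensions[OF x, of d] by (simp add: power_add algebra_simps)
  qed
  have "real (card {w \<in> reduced_words r. P (take n (drop (Suc d) w))}) =
     (\<Sum>w\<in>reduced_words r. ?i (P (take n (drop (Suc d) w))))"
    by (simp add: card_filter_sum finite_reduced_words)
  also have "\<dots> = (\<Sum>x\<in>S. \<Sum>u\<in>extensions x (d + (n + t)). ?i (P (take n (drop (Suc d) (x # u)))))"
    unfolding t by (rule sum_reduced_words_Suc)
  also have "\<dots> \<le> (\<Sum>x\<in>S. e * branching ^ (d + (n + t)))"
    by (rule sum_mono) (use 2 in simp)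
  also have "\<dots> = e * real (card (reduced_words r))"
    unfolding t card_reduced_words by (simp add: card_S)
  finally show ?thesis .
qed

text \<open>The window counts for all \<open>l\<close> offsets together count every occurrence once, except those that start
in one of the \<open>length w - N * l\<close> positions not reached.\<close>

lemma occurrences_hits:
  assumes l: "l = q + m" and m: "length y = m" "m \<ge> 1" and r: "(N + 1) * l \<le> length w"
  defines "H \<equiv> (\<Sum>d<l. hits y q l N (take (N * l) (drop (Suc d) w)))"
  shows "H \<le> card (occurrences w y)" "card (occurrences w y) + N * l \<le> H + length w"
proof -
  define f where "f = (\<lambda>(d, j). Suc d + j * l + q)"
  define X where "X = {..<l} \<times> {..<N}"
  have l0: "l > 0" using l m by simp
  have le: "f (d, j) + m \<le> length w" if "d < l" "j < N" for d j
  proof -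
    have "j * l + l \<le> N * l" using mult_le_mono1[of "Suc j" N l] that by simp
    moreover have "N * l + l \<le> length w" using r by simp
    ultimately show ?thesis using that l by (simp add: f_def)
  qed
  have inj: "inj_on f X"
  proof (rule inj_onI)
    fix x x' assume x: "x \<in> X" "x' \<in> X" and eq: "f x = f x'"
    obtain d j d' j' where [simp]: "x = (d, j)" "x' = (d', j')" by fastforce
    have *: "d + j * l = d' + j' * l" "d < l" "d' < l" using eq x by (auto simp: f_def X_def)
    have "(d + j * l) mod l = (d' + j' * l) mod l" "(d + j * l) div l = (d' + j' * l) div l"
      by (simp_all only: *(1))
    then show "x = x'" using *(2,3) l0 by simp
  qed
  have hits_eq: "hits y q l N (take (N * l) (drop (Suc d) w)) = card {j \<in> {..<N}. f (d, j) \<in> occurrences w y}"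
    if d: "d < l" for d
  proof -
    have "take m (drop (j * l + q) (take (N * l) (drop (Suc d) w))) = take m (drop (f (d, j)) w)" if j: "j < N" for j
    proof -
      have "j * l + l \<le> N * l" using mult_le_mono1[of "Suc j" N l] j by simp
      then have "m \<le> N * l - (j * l + q)" using l by simp
      then show ?thesis by (simp add: drop_take f_def min_absorb1 add.commute add.left_commute)
    qed
    then show ?thesis unfolding hits_def using le[OF d] m
      by (intro arg_cong[where f = card]) (auto simp: occurrences_def)
  qed
  have finX: "finite X" by (simp add: X_def)
  have HX: "H = card {x \<in> X. f x \<in> occurrences w y}"
  proof -
    have "{x \<in> X. f x \<in> occurrences w y} = (SIGMA d:{..<l}. {j \<in> {..<N}. f (d, j) \<in> occurrences w y})"
      by (auto simp: X_def)
    then show ?thesis unfolding H_def by (simp add: hits_eq)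
  qed
  let ?A = "f ` {x \<in> X. f x \<in> occurrences w y}"
  have cA: "card ?A = H" unfolding HX by (rule card_image) (rule inj_on_subset[OF inj], auto)
  have "?A \<subseteq> occurrences w y" by auto
  from card_mono[OF finite_occurrences this] cA show "H \<le> card (occurrences w y)" by simp
  have "occurrences w y \<subseteq> ?A \<union> ({..<length w} - f ` X)"
    using m by (auto simp: occurrences_def)
  then have "card (occurrences w y) \<le> card (?A \<union> ({..<length w} - f ` X))"
    by (rule card_mono[rotated]) (use finX in auto)
  also have "\<dots> \<le> card ?A + card ({..<length w} - f ` X)" by (rule card_Un_le)
  also have "card ({..<length w} - f ` X) = length w - N * l"
  proof -
    have "f ` X \<subseteq> {..<length w}"
    proof
      fix p assume "p \<in> f ` X"
      then obtain d j where "p = f (d, j)" "d < l" "j < N" by (auto simp: X_def)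
      then show "p \<in> {..<length w}" using le[of d j] m by simp
    qed
    then show ?thesis using finX card_image[OF inj] by (simp add: card_Diff_subset X_def mult.commute)
  qed
  finally show "card (occurrences w y) + N * l \<le> H + length w" using cA r by simp
qed

lemma equidistributed_if_hits:
  assumes m: "m \<ge> 1" and \<delta>: "0 < \<delta>" "\<delta> \<le> 1" and r: "(N + 1) * (2 * m) \<le> length w" "length w \<le> (N + 2) * (2 * m)"
    and err: "4 * real m \<le> \<delta> * (length w * freq m)"
    and hits: "\<And>y d. y \<in> reduced_words m \<Longrightarrow> d < 2 * m \<Longrightarrow>
      \<bar>real (hits y m (2 * m) N (take (N * (2 * m)) (drop (Suc d) w))) - N * freq m\<bar> \<le> \<delta> * (N * freq m)"
  shows "equidistributed w m (2 * \<delta>)"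
  unfolding equidistributed_def
proof (intro allI impI)
  fix y assume y: "set y \<subseteq> S \<and> reduced y \<and> length y = m"
  define l where "l = 2 * m"
  define H where "H = (\<Sum>d<l. hits y m l N (take (N * l) (drop (Suc d) w)))"
  define \<rho> where "\<rho> = freq m"
  define r where "r = real (length w)"
  have \<rho>: "0 \<le> \<rho>" "\<rho> \<le> 1"
  proof -
    have "1 \<le> 2 * real k * branching ^ (m - 1)"
      using branching_ge_1 k_pos one_le_power[OF branching_ge_1, of "m - 1"]
        mult_mono[of 1 "2 * real k" 1 "branching ^ (m - 1)"] by simp
    then show "0 \<le> \<rho>" "\<rho> \<le> 1" unfolding \<rho>_def freq_branching by (auto simp: divide_le_eq)
  qed
  have occ: "H \<le> card (occurrences w y)" "card (occurrences w y) + N * l \<le> H + length w"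
    unfolding H_def using occurrences_hits[of l m m y N w] y m r by (auto simp: l_def)
  have yr: "y \<in> reduced_words m" using y by (simp add: reduced_words_def)
  have "\<bar>real H - l * (N * \<rho>)\<bar> = \<bar>\<Sum>d<l. real (hits y m l N (take (N * l) (drop (Suc d) w))) - N * \<rho>\<bar>"
    by (simp add: H_def sum_subtractf)
  also have "\<dots> \<le> (\<Sum>d<l. \<bar>real (hits y m l N (take (N * l) (drop (Suc d) w))) - N * \<rho>\<bar>)" by (rule sum_abs)
  also have "\<dots> \<le> (\<Sum>d<l. \<delta> * (N * \<rho>))"
    using hits[OF yr] by (intro sum_mono) (auto simp: l_def \<rho>_def)
  finally have H: "\<bar>real H - l * (N * \<rho>)\<bar> \<le> \<delta> * (l * (N * \<rho>))" by (simp add: algebra_simps)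
  have Nl: "real N * real l \<le> r" "r \<le> real N * real l + 2 * real l"
  proof -
    have "N * l \<le> length w" "length w \<le> N * l + 2 * l" using assms(4,5) by (auto simp: l_def algebra_simps)
    then have "real (N * l) \<le> real (length w)" "real (length w) \<le> real (N * l + 2 * l)" by (simp_all only: of_nat_le_iff)
    then show "real N * real l \<le> r" "r \<le> real N * real l + 2 * real l" by (simp_all add: r_def)
  qed
  have X: "l * (N * \<rho>) \<le> r * \<rho>" "r * \<rho> - 2 * real l \<le> l * (N * \<rho>)"
  proof -
    show "l * (N * \<rho>) \<le> r * \<rho>" using mult_right_mono[OF Nl(1) \<rho>(1)] by (simp add: mult_ac)
    have "r * \<rho> \<le> (real N * real l + 2 * real l) * \<rho>" by (rule mult_right_mono[OF Nl(2) \<rho>(1)])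
    also have "\<dots> = l * (N * \<rho>) + 2 * real l * \<rho>" by (simp add: algebra_simps)
    also have "2 * real l * \<rho> \<le> 2 * real l" using \<rho> by (simp add: mult_left_le)
    finally show "r * \<rho> - 2 * real l \<le> l * (N * \<rho>)" by simp
  qed
  have \<delta>X: "\<delta> * (l * (N * \<rho>)) \<le> \<delta> * (r * \<rho>)" using X \<delta> by (intro mult_left_mono) auto
  have e: "2 * real l \<le> \<delta> * (r * \<rho>)" using err by (simp add: l_def r_def \<rho>_def)
  have "real (card (occurrences w y)) \<le> real H + (r - real N * real l)"
  proof -
    have "real (card (occurrences w y) + N * l) \<le> real (H + length w)" using occ(2) by (simp only: of_nat_le_iff)
    then show ?thesis by (simp add: r_def)
  qed
  moreover have "real H \<le> real (card (occurrences w y))" using occ(1) by simp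
  ultimately have "\<bar>real (card (occurrences w y)) - r * \<rho>\<bar> \<le> 2 * (\<delta> * (r * \<rho>))"
    using H X \<delta>X e Nl unfolding abs_le_iff by linarith
  then show "\<bar>real (card (occurrences w y)) - real (length w) * freq m\<bar> \<le> 2 * \<delta> * (real (length w) * freq m)"
    by (simp add: r_def \<rho>_def mult.assoc)
qed

text \<open>Union bound over the reduced words of length \<open>m\<close> and over the offsets of the windows. Gaps are
chosen as long as the words, so the windows have length \<open>2m\<close>.\<close>

theorem card_not_equidistributed:
  assumes m: "m \<ge> 1" and \<delta>: "0 < \<delta>" "\<delta> \<le> 1"
    and q: "2 * real k / branching ^ Suc m \<le> \<delta> / 4"
    and r: "8 * m \<le> r" and err: "4 * real m \<le> \<delta> * (r * freq m)"
  shows "real (card {w \<in> reduced_words r. \<not> equidistributed w m (2 * \<delta>)})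
    \<le> 4 * m / freq m * exp (- (\<delta>\<^sup>2 * (r * freq m) / (64 * m))) * card (reduced_words r)"
proof -
  define l where "l = 2 * m"
  \<comment> \<open>One window is given up, so that \<open>N\<close> windows fit for each of the \<open>l\<close> offsets.\<close>
  define N where "N = r div l - 1"
  define \<rho> where "\<rho> = freq m"
  have \<rho>0: "\<rho> > 0" using branching_ge_1 k_pos by (simp add: \<rho>_def freq_branching)
  have l0: "l > 0" using m by (simp add: l_def)
  have "r div l \<ge> 4" using r l0 by (simp add: l_def less_eq_div_iff_mult_less_eq)
  then have N1: "N + 1 = r div l" by (simp add: N_def)
  have N2: "(N + 1) * l \<le> r" unfolding N1 by (metis div_times_less_eq_dividend)
  have N3: "r \<le> (N + 2) * l"
  proof -
    have "r = r div l * l + r mod l" by simp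
    also have "\<dots> \<le> r div l * l + l" using mod_less_divisor[OF l0, of r] by linarith
    also have "\<dots> = (N + 2) * l" using N1 by (metis add_mult_distrib mult.left_neutral nat_1_add_1 add.assoc)
    finally show ?thesis .
  qed
  have N4: "real r / (4 * m) \<le> N"
  proof -
    have "real r \<le> (real N + 2) * (2 * real m)" using of_nat_mono[OF N3, where ?'a = real] by (simp add: l_def distrib_right)
    moreover have "8 * real m \<le> real r" using of_nat_mono[OF r, where ?'a = real] by simp
    ultimately have "real r \<le> N * (4 * real m)" by (simp add: algebra_simps)
    then show ?thesis using m by (simp add: divide_le_eq)
  qed
  define E where "E = 2 * exp (- (\<delta>\<^sup>2 * (N * \<rho>) / 16))"
  define bad where "bad y d = {w \<in> reduced_words r.
     \<not> \<bar>real (hits y m l N (take (N * l) (drop (Suc d) w))) - N * \<rho>\<bar> \<le> \<delta> * (N * \<rho>)}" for y d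
  have cb: "real (card (bad y d)) \<le> E * card (reduced_words r)" if y: "y \<in> reduced_words m" and d: "d < l" for y d
    unfolding bad_def
  proof (rule card_reduced_words_window)
    show "Suc d + N * l \<le> r" using N2 d by simp
    fix a assume a: "a \<in> S"
    have "set y \<subseteq> S" "reduced y" "length y = m" using y by (auto simp: reduced_words_def)
    note conc = hits_concentration[OF this m a \<delta> q, of N]
    have ml: "m + m = l" by (simp add: l_def)
    show "real (card {v \<in> extensions a (N * l). \<not> \<bar>real (hits y m l N v) - N * \<rho>\<bar> \<le> \<delta> * (N * \<rho>)}) \<le> E * branching ^ (N * l)"
      using conc unfolding ml E_def \<rho>_def .
  qed
  have "{w \<in> reduced_words r. \<not> equidistributed w m (2 * \<delta>)} \<subseteq> (\<Union>(y, d)\<in>reduced_words m \<times> {..<l}. bad y d)"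
  proof
    fix w assume w: "w \<in> {w \<in> reduced_words r. \<not> equidistributed w m (2 * \<delta>)}"
    then have len: "length w = r" by (simp add: reduced_words_def)
    have "\<not> (\<forall>y\<in>reduced_words m. \<forall>d<l. \<bar>real (hits y m l N (take (N * l) (drop (Suc d) w))) - N * \<rho>\<bar> \<le> \<delta> * (N * \<rho>))"
      using equidistributed_if_hits[OF m \<delta>, of N w] w N2 N3 err len by (auto simp: l_def \<rho>_def)
    then show "w \<in> (\<Union>(y, d)\<in>reduced_words m \<times> {..<l}. bad y d)" using w by (auto simp: bad_def)
  qed
  then have "card {w \<in> reduced_words r. \<not> equidistributed w m (2 * \<delta>)} \<le> card (\<Union>(y, d)\<in>reduced_words m \<times> {..<l}. bad y d)"
    by (rule card_mono[rotated]) (auto simp: finite_reduced_words bad_def)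
  also have "\<dots> \<le> (\<Sum>(y, d)\<in>reduced_words m \<times> {..<l}. card (bad y d))"
    using card_UN_le[of "reduced_words m \<times> {..<l}" "\<lambda>(y, d). bad y d"] finite_reduced_words
    by (simp add: split_def)
  finally have "real (card {w \<in> reduced_words r. \<not> equidistributed w m (2 * \<delta>)}) \<le>
     real (\<Sum>(y, d)\<in>reduced_words m \<times> {..<l}. card (bad y d))" by (simp only: of_nat_le_iff)
  also have "\<dots> = (\<Sum>(y, d)\<in>reduced_words m \<times> {..<l}. real (card (bad y d)))" by (simp add: split_def)
  also have "\<dots> \<le> (\<Sum>(y, d)\<in>reduced_words m \<times> {..<l}. E * card (reduced_words r))"
    by (rule sum_mono) (use cb in auto)
  also have "\<dots> = real (card (reduced_words m)) * l * (E * card (reduced_words r))"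
    by (simp add: split_def card_cartesian_product)
  also have "real (card (reduced_words m)) = 1 / \<rho>"
    using card_reduced_words[of "m - 1"] m by (simp add: \<rho>_def freq_branching)
  also have "1 / \<rho> * l * (E * card (reduced_words r)) =
     4 * m / \<rho> * exp (- (\<delta>\<^sup>2 * (N * \<rho>) / 16)) * card (reduced_words r)"
    by (simp add: E_def l_def)
  also have "\<dots> \<le> 4 * m / \<rho> * exp (- (\<delta>\<^sup>2 * (r * \<rho>) / (64 * m))) * card (reduced_words r)"
  proof (intro mult_right_mono mult_left_mono)
    have "\<delta>\<^sup>2 * \<rho> / 16 * (real r / (4 * m)) \<le> \<delta>\<^sup>2 * \<rho> / 16 * N"
      using \<rho>0 by (intro mult_left_mono N4) auto
    then show "exp (- (\<delta>\<^sup>2 * (N * \<rho>) / 16)) \<le> exp (- (\<delta>\<^sup>2 * (r * \<rho>) / (64 * m)))"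
      by (simp add: mult_ac)
  qed (use \<rho>0 in auto)
  finally show ?thesis by (simp add: \<rho>_def)
qed

end

section \<open>Reduction of random words\<close>

lemma pairs_same_image:
  fixes A :: "'a set" and f :: "'a \<Rightarrow> 'b"
  assumes "finite A"
  shows "(real (card A))\<^sup>2 \<le> card {(x, y). x \<in> A \<and> y \<in> A \<and> f x = f y} * card (f ` A)"
proof -
  define N where "N b = real (card {x \<in> A. f x = b})" for b
  have "real (card A) = (\<Sum>b\<in>f ` A. N b * 1)"
  proof -
    have "card A = (\<Sum>b\<in>f ` A. card {x \<in> A. f x = b})"
      using sum.image_gen[OF assms, of "\<lambda>_. 1::nat" f] by simp
    then show ?thesis by (simp add: N_def)
  qed
  then have "(real (card A))\<^sup>2 \<le> (\<Sum>b\<in>f ` A. (N b)\<^sup>2) * (\<Sum>b\<in>f ` A. 1\<^sup>2)"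
    using Cauchy_Schwarz_ineq_sum[of N "\<lambda>_. 1" "f ` A"] by simp
  also have "(\<Sum>b\<in>f ` A. (N b)\<^sup>2) = card {(x, y). x \<in> A \<and> y \<in> A \<and> f x = f y}"
  proof -
    have eq: "{(x, y). x \<in> A \<and> y \<in> A \<and> f x = f y} = (\<Union>b\<in>f ` A. {x \<in> A. f x = b} \<times> {x \<in> A. f x = b})"
      by auto
    have "card {(x, y). x \<in> A \<and> y \<in> A \<and> f x = f y} = (\<Sum>b\<in>f ` A. card ({x \<in> A. f x = b} \<times> {x \<in> A. f x = b}))"
      unfolding eq by (rule card_UN_disjoint) (use assms in auto)
    then show ?thesis by (simp add: N_def card_cartesian_product power2_eq_square)
  qed
  finally show ?thesis by simp
qed

context involutive_alphabet
begin

definition words :: "nat \<Rightarrow> 'a list set" where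
  "words n = {xs. set xs \<subseteq> S \<and> length xs = n}"

lemma finite_words: "finite (words n)"
  unfolding words_def by (rule finite_lists_length_eq[OF finite_S])

lemma card_words: "card (words n) = (2 * k) ^ n"
  unfolding words_def by (simp add: card_lists_length_eq[OF finite_S] card_S)

lemma sum_words_Suc: "(\<Sum>xs\<in>words (Suc n). f xs) = (\<Sum>s\<in>S. \<Sum>xs\<in>words n. f (s # xs))"
proof -
  have "(\<Sum>xs\<in>words (Suc n). f xs) = (\<Sum>(s, xs)\<in>S \<times> words n. f (s # xs))"
    by (rule sum.reindex_bij_witness[of _ "\<lambda>(s, xs). s # xs" "\<lambda>xs. (hd xs, tl xs)"])
      (auto simp: words_def length_Suc_conv)
  then show ?thesis by (simp add: sum.cartesian_product)
qed

definition push :: "'a \<Rightarrow> 'a list \<Rightarrow> 'a list" where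
  "push s w = (if w \<noteq> [] \<and> hd w = bar s then tl w else s # w)"

definition reduce :: "'a list \<Rightarrow> 'a list" where
  "reduce xs = foldr push xs []"

lemma reduce_simps [simp]: "reduce [] = []" "reduce (s # xs) = push s (reduce xs)"
  by (simp_all add: reduce_def)

definition red_lang :: "'a list set" where
  "red_lang = {w. set w \<subseteq> S \<and> reduced w}"

lemma reduced_words_iff: "w \<in> reduced_words r \<longleftrightarrow> w \<in> red_lang \<and> length w = r"
  by (auto simp: reduced_words_def red_lang_def)

lemma push_red_lang: "s \<in> S \<Longrightarrow> w \<in> red_lang \<Longrightarrow> push s w \<in> red_lang"
  by (cases w) (auto simp: push_def red_lang_def reduced_Cons)

lemma push_push: "s \<in> S \<Longrightarrow> w \<in> red_lang \<Longrightarrow> push s (push (bar s) w) = w"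
  by (cases w) (auto simp: push_def red_lang_def reduced_Cons bar_bar)

lemma push_push': "s \<in> S \<Longrightarrow> w \<in> red_lang \<Longrightarrow> push (bar s) (push s w) = w"
  using push_push[of "bar s" w] by (simp add: bar_bar bar_in)

lemma reduce_red_lang: "set xs \<subseteq> S \<Longrightarrow> reduce xs \<in> red_lang"
  by (induction xs) (auto simp: push_red_lang, simp add: red_lang_def reduced_def)

lemma length_push: "length (push s w) \<le> Suc (length w)"
  by (auto simp: push_def)

lemma length_reduce: "length (reduce xs) \<le> length xs"
  by (induction xs) (auto intro: order_trans[OF length_push])

lemma bij_bar: "bij_betw bar S S"
  by (rule bij_betw_byWitness[where f' = bar]) (auto simp: bar_bar bar_in)

lemma push_length_cases:
  assumes "w \<in> red_lang" "w \<noteq> []"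
  shows "(\<Sum>s\<in>S. f (length (push s w))) = f (length w - 1) + (2 * real k - 1) * f (length w + 1)"
proof -
  have h: "hd w \<in> S" using assms by (auto simp: red_lang_def)
  have eq: "hd w = bar s \<longleftrightarrow> s = bar (hd w)" if "s \<in> S" for s using that h bar_bar by auto
  have "(\<Sum>s\<in>S. f (length (push s w))) = f (length (push (bar (hd w)) w)) + (\<Sum>s\<in>S - {bar (hd w)}. f (length (push s w)))"
    by (rule sum.remove[OF finite_S bar_in[OF h]])
  also have "(\<Sum>s\<in>S - {bar (hd w)}. f (length (push s w))) = (\<Sum>s\<in>S - {bar (hd w)}. f (length w + 1))"
    by (rule sum.cong) (use eq in \<open>auto simp: push_def\<close>)
  also have "\<dots> = (2 * real k - 1) * f (length w + 1)"
    using k_pos by (simp add: card_Diff_singleton_if bar_in[OF h] card_S of_nat_diff)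
  also have "f (length (push (bar (hd w)) w)) = f (length w - 1)"
    using assms(2) h by (simp add: push_def bar_bar)
  finally show ?thesis .
qed

text \<open>Removing the first letter \<open>s\<close> turns words with reduction \<open>w\<close> into words with reduction \<open>push (bar s) w\<close>.
Among the neighbours \<open>push s w\<close> of a nonempty \<open>w\<close> in the tree, one is shorter and all others are longer, so
the recursion only sees lengths.\<close>

lemma card_reduce_eq:
  "\<exists>c. \<forall>w\<in>red_lang. real (card {xs \<in> words n. reduce xs = w}) = c (length w)"
proof (induction n)
  case 0
  have "{xs \<in> words 0. reduce xs = w} = (if w = [] then {[]} else {})" for w by (auto simp: words_def)
  then show ?case by (intro exI[of _ "\<lambda>l. if l = 0 then 1 else 0"]) simp
next
  case (Suc n)
  then obtain c where c: "\<And>w. w \<in> red_lang \<Longrightarrow> real (card {xs \<in> words n. reduce xs = w}) = c (length w)"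
    by blast
  have eq: "real (card {xs \<in> words (Suc n). reduce xs = w}) = (\<Sum>s\<in>S. c (length (push s w)))"
    if w: "w \<in> red_lang" for w
  proof -
    have "real (card {xs \<in> words (Suc n). reduce xs = w}) = (\<Sum>xs\<in>words (Suc n). if reduce xs = w then 1 else 0)"
      by (simp add: card_filter_sum finite_words)
    also have "\<dots> = (\<Sum>s\<in>S. \<Sum>xs\<in>words n. if push s (reduce xs) = w then 1 else 0)"
      unfolding sum_words_Suc by simp
    also have "\<dots> = (\<Sum>s\<in>S. \<Sum>xs\<in>words n. if reduce xs = push (bar s) w then 1 else 0)"
    proof (intro sum.cong refl)
      fix s xs assume s: "s \<in> S" and xs: "xs \<in> words n"
      have "reduce xs \<in> red_lang" using xs reduce_red_lang by (auto simp: words_def)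
      then have "push s (reduce xs) = w \<longleftrightarrow> reduce xs = push (bar s) w"
        using push_push[OF s w] push_push'[OF s] by auto
      then show "(if push s (reduce xs) = w then 1 else (0::real)) = (if reduce xs = push (bar s) w then 1 else 0)" by simp
    qed
    also have "\<dots> = (\<Sum>s\<in>S. c (length (push (bar s) w)))"
      using c push_red_lang w bar_in by (simp add: card_filter_sum[symmetric] finite_words)
    also have "\<dots> = (\<Sum>s\<in>S. c (length (push s w)))"
      by (rule sum.reindex_bij_betw[OF bij_bar])
    finally show ?thesis .
  qed
  show ?case
  proof (intro exI ballI)
    fix w assume w: "w \<in> red_lang"
    show "real (card {xs \<in> words (Suc n). reduce xs = w}) =
      (\<lambda>l. if l = 0 then 2 * real k * c 1 else c (l - 1) + (2 * real k - 1) * c (l + 1)) (length w)"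
    proof (cases "w = []")
      case True
      then show ?thesis using eq[OF w] by (simp add: push_def card_S)
    next
      case False
      then show ?thesis using eq[OF w] push_length_cases[OF w False, of c] by simp
    qed
  qed
qed

text \<open>Conditioned on its length, the reduction of a uniformly random word is uniformly distributed.\<close>

lemma card_reduce_proportion:
  assumes A: "A \<subseteq> reduced_words r" "real (card A) \<le> e * real (card (reduced_words r))"
  shows "real (card {xs \<in> words n. reduce xs \<in> A}) \<le> e * real (card {xs \<in> words n. length (reduce xs) = r})"
proof -
  obtain c where c: "\<And>w. w \<in> red_lang \<Longrightarrow> real (card {xs \<in> words n. reduce xs = w}) = c (length w)"
    using card_reduce_eq by blast
  have B: "real (card {xs \<in> words n. reduce xs \<in> B}) = c r * real (card B)" if B: "B \<subseteq> reduced_words r" for B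
  proof -
    have finB: "finite B" using B finite_reduced_words finite_subset by blast
    have eq: "{xs \<in> words n. reduce xs \<in> B} = (\<Union>w\<in>B. {xs \<in> words n. reduce xs = w})" by auto
    have "card {xs \<in> words n. reduce xs \<in> B} = (\<Sum>w\<in>B. card {xs \<in> words n. reduce xs = w})"
      unfolding eq by (rule card_UN_disjoint) (use finB finite_words in auto)
    then have "real (card {xs \<in> words n. reduce xs \<in> B}) = (\<Sum>w\<in>B. c r)"
      using c B by (simp add: reduced_words_iff subset_iff)
    then show ?thesis by simp
  qed
  have all: "{xs \<in> words n. length (reduce xs) = r} = {xs \<in> words n. reduce xs \<in> reduced_words r}"
    using reduce_red_lang by (auto simp: reduced_words_iff words_def)
  show ?thesis
  proof (cases "reduced_words r = {}")
    case True
    then show ?thesis using A unfolding all by simp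
  next
    case False
    then have "c r \<ge> 0" using B[of "{SOME w. w \<in> reduced_words r}"] some_in_eq[of "reduced_words r"]
      by (metis (no_types, lifting) card.empty card.insert empty_subsetI finite.emptyI insert_not_empty
        insert_subset mult.right_neutral of_nat_0_le_iff of_nat_1 One_nat_def empty_iff)
    then have "c r * real (card A) \<le> c r * (e * real (card (reduced_words r)))"
      using A(2) by (rule mult_left_mono[rotated])
    then show ?thesis unfolding all B[OF A(1)] B[OF order_refl] by (simp add: mult_ac)
  qed
qed

text \<open>Away from the empty word, one step multiplies the expected exponential by at most \<open>M\<close>. At the
empty word the length always grows; this is taken into account by the additional \<open>exp \<sigma>\<close> in each
step, and it costs only the factor \<open>1 + n exp \<sigma>\<close>.\<close>

lemma sum_exp_length_reduce:
  fixes \<sigma> :: real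
  assumes \<sigma>: "0 \<le> \<sigma>" "\<sigma> \<le> 1"
  defines "M \<equiv> exp ((real k - 1) / real k * \<sigma> + \<sigma>\<^sup>2)"
  shows "(\<Sum>xs\<in>words n. exp (\<sigma> * length (reduce xs))) \<le> (2 * real k) ^ n * (M ^ n * (1 + n * exp \<sigma>))"
proof (induction n)
  case 0
  have "words 0 = {[]}" by (auto simp: words_def)
  then show ?case by simp
next
  case (Suc n)
  have M1: "M \<ge> 1" using \<sigma> k_pos by (simp add: M_def)
  have k0: "2 * real k > 0" using k_pos by simp
  have step: "(\<Sum>s\<in>S. exp (\<sigma> * length (push s w))) \<le> 2 * real k * (M * exp (\<sigma> * length w) + exp \<sigma>)"
    if w: "w \<in> red_lang" for w
  proof (cases "w = []")
    case True
    have "0 \<le> M" using M1 by simp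
    then show ?thesis using True k0 by (simp add: push_def card_S)
  next
    case False
    define E where "E = exp (\<sigma> * length w)"
    have "(\<Sum>s\<in>S. exp (\<sigma> * length (push s w))) =
      exp (\<sigma> * (length w - 1)) + (2 * real k - 1) * exp (\<sigma> * (length w + 1))"
      using push_length_cases[OF w False, of "\<lambda>l. exp (\<sigma> * real l)"] by simp
    also have "exp (\<sigma> * (length w - 1)) = E * exp (- \<sigma>)"
      using False by (simp add: E_def exp_add[symmetric] of_nat_diff Suc_leI algebra_simps)
    also have "exp (\<sigma> * (length w + 1)) = E * exp \<sigma>"
      by (simp add: E_def exp_add[symmetric] algebra_simps)
    also have "E * exp (- \<sigma>) + (2 * real k - 1) * (E * exp \<sigma>) \<le>
      E * (1 - \<sigma> + \<sigma>\<^sup>2) + (2 * real k - 1) * (E * (1 + \<sigma> + \<sigma>\<^sup>2))"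
      using exp_le_quadratic[of \<sigma>] exp_le_quadratic[of "- \<sigma>"] \<sigma> k_pos
      by (intro add_mono mult_left_mono) (auto simp: E_def)
    also have "\<dots> = 2 * real k * (E * (1 + ((real k - 1) / real k * \<sigma> + \<sigma>\<^sup>2)))"
      using k_pos by (simp add: field_simps)
    also have "\<dots> \<le> 2 * real k * (E * M)"
      unfolding M_def by (intro mult_left_mono exp_ge_add_one_self) (use k_pos in \<open>auto simp: E_def\<close>)
    also have "\<dots> \<le> 2 * real k * (M * E + exp \<sigma>)"
      using k0 by (intro mult_left_mono) (auto simp: mult.commute)
    finally show ?thesis by (simp add: E_def)
  qed
  have "(\<Sum>xs\<in>words (Suc n). exp (\<sigma> * length (reduce xs))) =
     (\<Sum>xs\<in>words n. \<Sum>s\<in>S. exp (\<sigma> * length (push s (reduce xs))))"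
    unfolding sum_words_Suc by (subst sum.swap) simp
  also have "\<dots> \<le> (\<Sum>xs\<in>words n. 2 * real k * (M * exp (\<sigma> * length (reduce xs)) + exp \<sigma>))"
    by (intro sum_mono step reduce_red_lang) (auto simp: words_def)
  also have "\<dots> = 2 * real k * (M * (\<Sum>xs\<in>words n. exp (\<sigma> * length (reduce xs))) + (2 * real k) ^ n * exp \<sigma>)"
    by (simp add: sum_distrib_left sum.distrib card_words distrib_left mult_ac)
  also have "\<dots> \<le> 2 * real k * (M * ((2 * real k) ^ n * (M ^ n * (1 + n * exp \<sigma>))) + (2 * real k) ^ n * (M ^ Suc n * exp \<sigma>))"
  proof (intro mult_left_mono add_mono Suc.IH)
    show "exp \<sigma> \<le> M ^ Suc n * exp \<sigma>"
      using one_le_power[OF M1, of "Suc n"] by (simp del: power_Suc add: mult_le_cancel_right1)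
  qed (use M1 k0 in auto)
  also have "\<dots> = (2 * real k) ^ Suc n * (M ^ Suc n * (1 + Suc n * exp \<sigma>))"
    by (simp add: algebra_simps)
  finally show ?case .
qed

lemma card_long_reduction:
  fixes \<sigma> :: real
  assumes \<sigma>: "0 \<le> \<sigma>" "\<sigma> \<le> 1"
  shows "real (card {xs \<in> words n. T \<le> real (length (reduce xs))}) \<le>
    (2 * real k) ^ n * ((1 + n * exp \<sigma>) * exp (n * ((real k - 1) / real k * \<sigma> + \<sigma>\<^sup>2) - \<sigma> * T))"
proof -
  define M where "M = exp ((real k - 1) / real k * \<sigma> + \<sigma>\<^sup>2)"
  have "real (card {xs \<in> words n. T \<le> real (length (reduce xs))}) * exp (\<sigma> * T) =
     (\<Sum>xs\<in>{xs \<in> words n. T \<le> real (length (reduce xs))}. exp (\<sigma> * T))" by simp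
  also have "\<dots> \<le> (\<Sum>xs\<in>{xs \<in> words n. T \<le> real (length (reduce xs))}. exp (\<sigma> * length (reduce xs)))"
    using \<sigma> by (intro sum_mono) (auto intro: mult_left_mono)
  also have "\<dots> \<le> (\<Sum>xs\<in>words n. exp (\<sigma> * length (reduce xs)))"
    by (rule sum_mono2) (auto simp: finite_words)
  also have "\<dots> \<le> (2 * real k) ^ n * (M ^ n * (1 + n * exp \<sigma>))"
    unfolding M_def by (rule sum_exp_length_reduce[OF \<sigma>])
  also have "M ^ n = exp (n * ((real k - 1) / real k * \<sigma> + \<sigma>\<^sup>2))"
    by (simp add: M_def exp_of_nat_mult)
  finally show ?thesis by (simp add: exp_diff field_simps)
qed

lemma replicate_pmf_eq_words: "replicate_pmf n (pmf_of_set S) = pmf_of_set (words n)"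
proof -
  have Sne: "S \<noteq> {}" using card_S k_pos by auto
  have ne: "words n \<noteq> {}" for n using card_words[of n] k_pos by (metis card.empty power_eq_0_iff mult_eq_0_iff not_one_le_zero zero_neq_numeral)
  show ?thesis
  proof (induction n)
    case 0
    have "words 0 = {[]}" by (auto simp: words_def)
    then show ?case by (simp add: pmf_of_set_singleton)
  next
    case (Suc n)
    have "replicate_pmf (Suc n) (pmf_of_set S) =
      map_pmf (\<lambda>(x, xs). x # xs) (pair_pmf (pmf_of_set S) (replicate_pmf n (pmf_of_set S)))"
      by (simp add: pair_pmf_def map_bind_pmf map_pmf_def bind_assoc_pmf bind_return_pmf)
    also have "\<dots> = map_pmf (\<lambda>(x, xs). x # xs) (pmf_of_set (S \<times> words n))"
    proof -
      have "pair_pmf (pmf_of_set S) (pmf_of_set (words n)) = pmf_of_set (S \<times> words n)"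
      proof (rule pmf_eqI)
        fix z :: "'a \<times> 'a list"
        obtain x xs where z: "z = (x, xs)" by (cases z)
        have "S \<times> words n \<noteq> {}" "finite (S \<times> words n)" using Sne ne finite_S finite_words by auto
        from pmf_of_set[OF this] pmf_of_set[OF Sne finite_S] pmf_of_set[OF ne finite_words]
        show "pmf (pair_pmf (pmf_of_set S) (pmf_of_set (words n))) z = pmf (pmf_of_set (S \<times> words n)) z"
          unfolding z by (simp add: pmf_pair indicator_def card_cartesian_product)
      qed
      then show ?thesis unfolding Suc.IH by simp
    qed
    also have "\<dots> = pmf_of_set ((\<lambda>(x, xs). x # xs) ` (S \<times> words n))"
      by (rule map_pmf_of_set_inj) (use Sne ne finite_S finite_words in \<open>auto simp: inj_on_def\<close>)
    also have "(\<lambda>(x, xs). x # xs) ` (S \<times> words n) = words (Suc n)"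
      by (auto simp: words_def length_Suc_conv image_iff)
    finally show ?case .
  qed
qed

end

context group
begin

lemma list_prod_reduce:
  assumes alph: "involutive_alphabet S (m_inv G) k" and S: "S \<subseteq> carrier G" and xs: "set xs \<subseteq> S"
  shows "list_prod G (involutive_alphabet.reduce (m_inv G) xs) = list_prod G xs"
proof -
  interpret A: involutive_alphabet S "m_inv G" k by (rule alph)
  show ?thesis using xs
  proof (induction xs)
    case (Cons s xs)
    have r: "set (A.reduce xs) \<subseteq> S" using A.reduce_red_lang[of xs] Cons.prems by (auto simp: A.red_lang_def)
    have s: "s \<in> carrier G" using Cons.prems S by auto
    have "list_prod G (A.push s w) = s \<otimes> list_prod G w" if w: "set w \<subseteq> S" for w
    proof (cases "w \<noteq> [] \<and> hd w = inv s")
      case True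
      then obtain w' where "w = inv s # w'" by (cases w) auto
      moreover from this have "set w' \<subseteq> carrier G" using w S by auto
      ultimately show ?thesis using s by (simp add: A.push_def inv_cancel_left list_prod_closed)
    qed (auto simp: A.push_def)
    then show ?case using Cons r by simp
  qed simp
qed

lemma random_walk_prob:
  assumes alph: "involutive_alphabet S (m_inv G) k"
  shows "measure (random_walk G S n) A =
    real (card {xs \<in> involutive_alphabet.words S n. list_prod G xs \<in> A}) / (2 * real k) ^ n"
proof -
  interpret A: involutive_alphabet S "m_inv G" k by (rule alph)
  have ne: "A.words n \<noteq> {}" using A.card_words[of n] A.k_pos
    by (metis card.empty power_eq_0_iff mult_eq_0_iff not_one_le_zero zero_neq_numeral)
  have "measure (random_walk G S n) A = measure (pmf_of_set (A.words n)) (list_prod G -` A)"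
    unfolding random_walk_def A.replicate_pmf_eq_words by simp
  also have "\<dots> = card (A.words n \<inter> list_prod G -` A) / card (A.words n)"
    by (rule measure_pmf_of_set[OF ne A.finite_words])
  also have "A.words n \<inter> list_prod G -` A = {xs \<in> A.words n. list_prod G xs \<in> A}" by auto
  finally show ?thesis by (simp add: A.card_words)
qed

text \<open>By Cauchy-Schwarz, many pairs of words of length \<open>m\<close> have the same letter counts. A word followed by
the inverse of a word with the same letter counts is balanced, hence lies in \<open>[G,G]\<close>.\<close>

lemma card_words_in_derived:
  assumes alph: "involutive_alphabet S (m_inv G) k" and S: "S \<subseteq> carrier G"
  shows "(2 * real k) ^ (2 * m) \<le> real (card {xs \<in> involutive_alphabet.words S (2 * m).
     list_prod G xs \<in> derived G (carrier G)}) * (real m + 1) ^ (2 * k)"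
proof -
  interpret A: involutive_alphabet S "m_inv G" k by (rule alph)
  define f where "f xs = restrict (count (mset xs)) S" for xs
  let ?P = "{(xs, ys). xs \<in> A.words m \<and> ys \<in> A.words m \<and> f xs = f ys}"
  let ?W = "{xs \<in> A.words (2 * m). list_prod G xs \<in> derived G (carrier G)}"
  have cP: "card ?P \<le> card ?W"
  proof (rule card_inj_on_le[where f = "\<lambda>(xs, ys). xs @ A.word_inv ys"])
    show "finite ?W" using A.finite_words by auto
    show "inj_on (\<lambda>(xs, ys). xs @ A.word_inv ys) ?P"
    proof (rule inj_onI, clarify)
      fix xs ys xs' ys' assume *: "xs \<in> A.words m" "ys \<in> A.words m" "xs' \<in> A.words m" "ys' \<in> A.words m"
        "xs @ A.word_inv ys = xs' @ A.word_inv ys'"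
      then have l: "length xs = length xs'" and ys: "set ys \<subseteq> S" "set ys' \<subseteq> S" by (simp_all add: A.words_def)
      have eq: "xs = xs' \<and> A.word_inv ys = A.word_inv ys'"
        using append_eq_append_conv[of xs xs' "A.word_inv ys" "A.word_inv ys'"] *(5) l by blast
      then have "A.word_inv (A.word_inv ys) = A.word_inv (A.word_inv ys')" by metis
      then have "ys = ys'" unfolding A.word_inv_inv[OF ys(1)] A.word_inv_inv[OF ys(2)] .
      with eq show "xs = xs' \<and> ys = ys'" by blast
    qed
    show "(\<lambda>(xs, ys). xs @ A.word_inv ys) ` ?P \<subseteq> ?W"
    proof
      fix x assume "x \<in> (\<lambda>(xs, ys). xs @ A.word_inv ys) ` ?P"
      then obtain xs ys where x: "x = xs @ A.word_inv ys" "set xs \<subseteq> S" "length xs = m"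
         "set ys \<subseteq> S" "length ys = m" "f xs = f ys" by (auto simp: A.words_def)
      have "count (mset xs) a = count (mset ys) a" for a
      proof (cases "a \<in> S")
        case True
        then show ?thesis using fun_cong[OF x(6), of a] by (simp add: f_def)
      next
        case False
        then have "a \<notin># mset xs" "a \<notin># mset ys" using x by auto
        then show ?thesis by (simp only: not_in_iff)
      qed
      then have mm: "mset xs = mset ys" by (rule multiset_eqI)
      have "mset x = mset ys + image_mset (m_inv G) (mset ys)"
        using x(1) mm by (simp add: A.word_inv_def)
      then have "balanced (mset x)" using balanced_inverses[of "mset ys"] x S by simp
      moreover have "set x \<subseteq> S" using x A.set_word_inv by auto
      moreover from this have "set x \<subseteq> carrier G" using S by auto
      ultimately have "list_prod G x \<in> derived G (carrier G)" "x \<in> A.words (2 * m)"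
        using commutator_product_in_derived[OF balanced_commutator_product[of x]] x by (auto simp: A.words_def)
      then show "x \<in> ?W" by simp
    qed
  qed
  have cf: "card (f ` A.words m) \<le> (m + 1) ^ (2 * k)"
  proof -
    have "f ` A.words m \<subseteq> PiE S (\<lambda>_. {..m})"
    proof
      fix g assume "g \<in> f ` A.words m"
      then obtain xs where "g = f xs" "length xs = m" by (auto simp: A.words_def)
      then show "g \<in> PiE S (\<lambda>_. {..m})" by (auto simp: f_def count_mset count_le_length)
    qed
    then have "card (f ` A.words m) \<le> card (PiE S (\<lambda>_. {..m}))"
      by (rule card_mono[rotated]) (auto intro: finite_PiE A.finite_S)
    then show ?thesis by (simp add: card_PiE A.finite_S A.card_S)
  qed
  have "((2 * real k) ^ m)\<^sup>2 \<le> real (card ?P) * real (card (f ` A.words m))"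
    using pairs_same_image[OF A.finite_words, of m f] by (simp add: A.card_words)
  also have "\<dots> \<le> real (card ?W) * real ((m + 1) ^ (2 * k))"
    using cP cf by (intro mult_mono) (simp_all only: of_nat_le_iff of_nat_0_le_iff)
  also have "((2 * real k) ^ m)\<^sup>2 = (2 * real k) ^ (2 * m)" by (simp only: power_even_eq)
  also have "real ((m + 1) ^ (2 * k)) = (real m + 1) ^ (2 * k)" by (simp add: add.commute)
  finally show ?thesis .
qed

end

section \<open>Asymptotics of the random walk\<close>

lemma asymp_main_term:
  fixes a B C D e :: real
  assumes "0 < e" "e < 1/4" "0 < B" "0 < a" "0 \<le> C" and D: "a * B / (1 - 2 * e) < D"
  shows "eventually (\<lambda>n::nat.
     ((1 + 2 * real n powr (-e/4)) * (1 + 8 * real n powr (-e/4)) * (a * real n + real n powr (3/4)) /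
        (3 * ((1/2 - e) * ln (real n) / B - 1)) + 4 + (C + 1) * (ln (real n) + 2)
        + 2 * real n powr (-e/4) * (C + 1) * real n + 1) / 4 \<le> D / 6 * (real n / ln (real n))) sequentially"
    (is "eventually (\<lambda>n. ?U n \<le> _) _")
proof -
  have "((\<lambda>n::nat. ?U n * ln (real n) / real n) \<longlongrightarrow> a * (inverse (1 / 2 - e) * B) / 12) sequentially"
    using assms(1-5) by real_asymp
  moreover have "a * (inverse (1 / 2 - e) * B) / 12 < D / 6"
    using D assms(1,2) by (simp add: field_simps)
  ultimately have "eventually (\<lambda>n::nat. ?U n * ln (real n) / real n < D / 6) sequentially"
    by (rule order_tendstoD(2))
  then show ?thesis using eventually_gt_at_top[of "3::nat"]
  proof eventually_elim
    case (elim n)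
    have pos: "0 < ln (real n)" "0 < real n" using elim by auto
    have alg: "u \<le> c * (N / l)" if "u * l / N < c" "l > 0" "N > 0" for u c N l :: real
      using that by (simp add: field_simps)
    show ?case by (rule alg[OF elim(1) pos])
  qed
qed

lemma asymp_small_term:
  fixes C D e :: real
  assumes "0 < e" "e < 1/4" "0 < D" "0 \<le> C"
  shows "eventually (\<lambda>n::nat. ((C + 1) * real n powr (1 - e) + 1) / 4 \<le> D / 6 * (real n / ln (real n))) sequentially"
  using assms by real_asymp

lemma asymp_conditions:
  fixes K e B :: real
  assumes "0 < e" "e < 1/4" "0 < K" "0 < B"
  shows "eventually (\<lambda>n::nat. 8 * (ln (real n) + 2) \<le> real n powr (1 - e)) sequentially"
    "eventually (\<lambda>n::nat. 4 * (ln (real n) + 2) \<le> real n powr (-e/4) * (real n powr e / K)) sequentially"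
    "eventually (\<lambda>n::nat. K * real n powr (-(1/2-e)) \<le> real n powr (-e/4)/4) sequentially"
    "eventually (\<lambda>n::nat. 2 \<le> (1/2-e) * ln (real n) / B) sequentially"
    "eventually (\<lambda>n::nat. 2 * real n powr (-e/4) \<le> 1) sequentially"
    "eventually (\<lambda>n::nat. real n powr (3/4) \<le> real n powr (1 - e)) sequentially"
  using assms by real_asymp+

lemma asymp_failure:
  fixes K E e :: real
  assumes "0 < e" "e < 1/4" "0 < K" "0 < E"
  shows "(\<lambda>n::nat. (real n / 2 + 1) ^ m * ((1 + 3 * real n) * exp (- (real n powr (1/2) / 4)) +
     E * (ln (real n) + 2) * real n * exp (- (real n powr (e/2) / (K * (ln (real n) + 2))))))
     \<in> O(\<lambda>n. exp (- (real n powr (e/4))))"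
  using assms by real_asymp

context involutive_alphabet
begin

lemma card_long_reduction_failing:
  assumes P: "\<And>r. R \<le> real r \<Longrightarrow>
      real (card {w \<in> reduced_words r. P w}) \<le> e * real (card (reduced_words r))"
  shows "real (card {xs \<in> words n. R \<le> real (length (reduce xs)) \<and> P (reduce xs)}) \<le> \<bar>e\<bar> * (2 * real k) ^ n"
proof -
  let ?A = "\<lambda>r. {xs \<in> words n. reduce xs \<in> {w \<in> reduced_words r. P w}}"
  let ?R = "{r. r \<le> n \<and> R \<le> real r}"
  have "{xs \<in> words n. R \<le> real (length (reduce xs)) \<and> P (reduce xs)} \<subseteq> (\<Union>r\<in>?R. ?A r)"
  proof
    fix xs assume xs: "xs \<in> {xs \<in> words n. R \<le> real (length (reduce xs)) \<and> P (reduce xs)}"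
    then have "reduce xs \<in> red_lang" "length (reduce xs) \<le> n"
      using reduce_red_lang length_reduce[of xs] by (auto simp: words_def)
    then show "xs \<in> (\<Union>r\<in>?R. ?A r)" using xs by (auto simp: reduced_words_iff)
  qed
  then have "card {xs \<in> words n. R \<le> real (length (reduce xs)) \<and> P (reduce xs)} \<le> card (\<Union>r\<in>?R. ?A r)"
    by (rule card_mono[rotated]) (auto simp: finite_words)
  also have "\<dots> \<le> (\<Sum>r\<in>?R. card (?A r))" by (rule card_UN_le) auto
  finally have "real (card {xs \<in> words n. R \<le> real (length (reduce xs)) \<and> P (reduce xs)}) \<le> real (\<Sum>r\<in>?R. card (?A r))"
    by (simp only: of_nat_le_iff)
  also have "\<dots> = (\<Sum>r\<in>?R. real (card (?A r)))" by simp
  also have "\<dots> \<le> (\<Sum>r\<in>?R. \<bar>e\<bar> * real (card {xs \<in> words n. length (reduce xs) = r}))"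
  proof (rule sum_mono)
    fix r assume r: "r \<in> ?R"
    have "real (card {w \<in> reduced_words r. P w}) \<le> \<bar>e\<bar> * real (card (reduced_words r))"
      using P[of r] r by (intro order_trans[OF P]) (auto intro: mult_right_mono)
    then show "real (card (?A r)) \<le> \<bar>e\<bar> * real (card {xs \<in> words n. length (reduce xs) = r})"
      by (intro card_reduce_proportion) auto
  qed
  also have "\<dots> \<le> (\<Sum>r\<in>{..n}. \<bar>e\<bar> * real (card {xs \<in> words n. length (reduce xs) = r}))"
    by (rule sum_mono2) auto
  also have "\<dots> = \<bar>e\<bar> * (\<Sum>r\<in>{..n}. real (card {xs \<in> words n. length (reduce xs) = r}))"
    by (simp add: sum_distrib_left)
  also have "(\<Sum>r\<in>{..n}. real (card {xs \<in> words n. length (reduce xs) = r})) = (2 * real k) ^ n"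
  proof -
    have "words n = (\<Union>r\<in>{..n}. {xs \<in> words n. length (reduce xs) = r})"
      using length_reduce by (auto simp: words_def)
    then have "card (words n) = card (\<Union>r\<in>{..n}. {xs \<in> words n. length (reduce xs) = r})" by simp
    also have "\<dots> = (\<Sum>r\<in>{..n}. card {xs \<in> words n. length (reduce xs) = r})"
      by (rule card_UN_disjoint) (auto simp: finite_words)
    finally have "real (card (words n)) = real (\<Sum>r\<in>{..n}. card {xs \<in> words n. length (reduce xs) = r})" by simp
    then show ?thesis by (simp add: card_words)
  qed
  finally show ?thesis .
qed

text \<open>Half of the logarithmic length \<open>ln n / ln b\<close>, shortened by the factor \<open>1 - 2e\<close>. Then words of
length \<open>2L\<close> still occur about \<open>n powr e\<close> times in a word whose length is at least \<open>n powr (1 - e)\<close>.\<close>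

definition block_length :: "real \<Rightarrow> nat \<Rightarrow> nat" where
  "block_length e n = nat \<lfloor>(1/2 - e) * ln (real n) / ln branching\<rfloor>"

lemma block_length_bounds:
  fixes e :: real and n :: nat
  assumes e: "0 < e" "e < 1/4" and n: "n \<ge> 1" and k2: "k \<ge> 2"
  defines "L \<equiv> block_length e n"
  shows "(1/2 - e) * ln (real n) / ln branching - 1 \<le> real L"
    "2 * real L \<le> ln (real n)"
    "branching ^ L \<le> real n powr (1/2 - e)" "real n powr (1/2 - e) \<le> branching ^ Suc L"
    "1 \<le> ln branching"
proof -
  have "exp 1 \<le> branching" using exp_le k2 by (simp add: branching_def)
  then have B: "1 \<le> ln branching" using branching_ge_1 by (simp add: ln_ge_iff)
  then show "1 \<le> ln branching" .
  have b0: "branching > 0" using branching_ge_1 by simp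
  let ?x = "(1/2 - e) * ln (real n) / ln branching"
  have x0: "0 \<le> ?x" using e n B by simp
  have L: "real L \<le> ?x" "?x < real L + 1"
    using x0 unfolding L_def block_length_def by linarith+
  then show "?x - 1 \<le> real L" by simp
  have LB: "real L * ln branching \<le> (1/2 - e) * ln (real n)" "(1/2 - e) * ln (real n) \<le> (real L + 1) * ln branching"
    using L B by (simp_all add: pos_le_divide_eq pos_divide_less_eq)
  have "real L \<le> real L * ln branching" using B by (simp add: mult_le_cancel_left1)
  also have "\<dots> \<le> (1/2) * ln (real n)"
    using LB(1) e n mult_right_mono[of "1/2 - e" "1/2" "ln (real n)"] by simp
  finally show "2 * real L \<le> ln (real n)" by simp
  have bL: "branching ^ j = exp (real j * ln branching)" for j
    using b0 by (simp add: exp_of_nat_mult)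
  have nL: "real n powr (1/2 - e) = exp ((1/2 - e) * ln (real n))" using n by (simp add: powr_def)
  show "branching ^ L \<le> real n powr (1/2 - e)" unfolding bL nL using LB(1) by simp
  show "real n powr (1/2 - e) \<le> branching ^ Suc L" unfolding bL nL using LB(2) by (simp add: algebra_simps)
qed

lemma eventually_card_not_equidistributed:
  fixes e :: real
  assumes e: "0 < e" "e < 1/4" and k2: "k \<ge> 2"
  shows "eventually (\<lambda>n. \<forall>m\<in>{block_length e n + 2, 2 * block_length e n + 2}.
    real (card {xs \<in> words n. real n powr (1 - e) \<le> real (length (reduce xs)) \<and>
        \<not> equidistributed (reduce xs) m (2 * real n powr (-e/4))}) \<le>
      8 * real k * branching * (ln (real n) + 2) * real n *
        exp (- (real n powr (e/2) / (128 * real k * branching * (ln (real n) + 2)))) * (2 * real k) ^ n) sequentially"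
proof -
  have b1: "branching \<ge> 1" by (rule branching_ge_1)
  have k0: "real k > 0" using k2 by simp
  define K where "K = 2 * real k * branching"
  have K: "K > 0" "2 * real k > 0" using b1 k0 by (auto simp: K_def)
  have lnb: "0 < ln branching" using b1 k2 by (simp add: branching_def)
  show ?thesis
    using asymp_conditions[OF e K(1) lnb] asymp_conditions(3)[OF e K(2) lnb] eventually_ge_at_top[of "1::nat"]
  proof eventually_elim
    case (elim n)
    define L where "L = block_length e n"
    define d where "d = real n powr (-e/4)"
    define l where "l = ln (real n) + 2"
    have n1: "n \<ge> 1" and n0: "real n > 0" using elim by auto
    note LB = block_length_bounds[OF e n1 k2, folded L_def]
    have "0 \<le> ln (real n)" using n1 by simp
    then have l0: "l > 0" by (simp add: l_def)
    have d: "0 < d" "d \<le> 1" using elim(5) n0 by (auto simp: d_def)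
    show ?case
    proof
      fix m assume "m \<in> {block_length e n + 2, 2 * block_length e n + 2}"
      then have m: "L + 2 \<le> m" "m \<le> 2 * L + 2" by (auto simp: L_def)
      have ml: "real m \<le> l" using LB(2) of_nat_mono[OF m(2), where ?'a = real] by (simp add: l_def)
      have inv_freq: "1 / freq m \<le> K * real n powr (1 - 2 * e)"
      proof -
        have "branching ^ (m - 1) \<le> branching ^ (L + L + 1)"
          using m b1 by (intro power_increasing) auto
        also have "\<dots> = branching ^ L * branching ^ L * branching" by (simp add: power_add)
        also have "\<dots> \<le> real n powr (1/2 - e) * real n powr (1/2 - e) * branching"
          using LB(3) b1 by (intro mult_mono) auto
        also have "real n powr (1/2 - e) * real n powr (1/2 - e) = real n powr (1 - 2 * e)"
          by (simp add: powr_add[symmetric])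
        finally have "2 * real k * branching ^ (m - 1) \<le> 2 * real k * (real n powr (1 - 2 * e) * branching)"
          using k0 by (intro mult_left_mono) auto
        then show ?thesis by (simp add: freq_branching K_def mult_ac)
      qed
      have f0: "freq m > 0" using b1 k0 by (simp add: freq_branching)
      have rf: "real n powr e / K \<le> real r * freq m" if r: "real n powr (1 - e) \<le> real r" for r
      proof -
        have "real n powr e / K = real n powr (1 - e) / (K * real n powr (1 - 2 * e))"
        proof -
          have "real n powr (1 - e) / real n powr (1 - 2 * e) = real n powr ((1 - e) - (1 - 2 * e))"
            by (rule powr_diff[symmetric])
          then show ?thesis using K by (simp add: field_simps)
        qed
        also have "\<dots> \<le> real n powr (1 - e) / (1 / freq m)"
          using inv_freq f0 K n0 by (intro divide_left_mono) auto
        also have "\<dots> = real n powr (1 - e) * freq m" by simp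
        also have "\<dots> \<le> real r * freq m" using r f0 by (intro mult_right_mono) auto
        finally show ?thesis .
      qed
      let ?c = "8 * real k * branching * l * real n * exp (- (real n powr (e/2) / (64 * K * l)))"
      have "real (card {xs \<in> words n. real n powr (1 - e) \<le> real (length (reduce xs)) \<and>
        \<not> equidistributed (reduce xs) m (2 * d)}) \<le> \<bar>?c\<bar> * (2 * real k) ^ n"
      proof (rule card_long_reduction_failing)
        fix r assume r: "real n powr (1 - e) \<le> real r"
        have c1: "2 * real k / branching ^ Suc m \<le> d / 4"
        proof -
          have "real n powr (1/2 - e) \<le> branching ^ Suc m"
            using LB(4) power_increasing[of "Suc L" "Suc m" branching] m b1 by linarith
          then have "2 * real k / branching ^ Suc m \<le> 2 * real k / real n powr (1/2 - e)"
            using n0 k0 b1 by (intro divide_left_mono) auto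
          also have "\<dots> = 2 * real k * real n powr (- (1/2 - e))" using powr_minus_divide[of "real n" "1/2 - e"] by simp
          also have "\<dots> \<le> d / 4" using elim(7) by (simp add: d_def)
          finally show ?thesis .
        qed
        have c2: "8 * m \<le> r"
        proof -
          have "8 * real m \<le> real r" using ml elim(1) r by (simp add: l_def)
          then show ?thesis by linarith
        qed
        have c3: "4 * real m \<le> d * (real r * freq m)"
        proof -
          have "4 * real m \<le> 4 * l" using ml by simp
          also have "\<dots> \<le> d * (real n powr e / K)" using elim(2) by (simp add: l_def d_def)
          also have "\<dots> \<le> d * (real r * freq m)" using rf[OF r] d by (intro mult_left_mono) auto
          finally show ?thesis .
        qed
        have m1: "1 \<le> m" using m by simp
        have "real (card {w \<in> reduced_words r. \<not> equidistributed w m (2 * d)}) \<le>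
          4 * real m / freq m * exp (- (d\<^sup>2 * (real r * freq m) / (64 * real m))) * real (card (reduced_words r))"
          using card_not_equidistributed[OF m1 d c1 c2 c3] by simp
        also have "\<dots> \<le> ?c * card (reduced_words r)"
        proof (intro mult_right_mono mult_mono)
          have "4 * real m / freq m = 4 * real m * (1 / freq m)" by simp
          also have "\<dots> \<le> 4 * l * (K * real n powr (1 - 2 * e))"
            using ml inv_freq f0 l0 by (intro mult_mono) auto
          also have "\<dots> \<le> 4 * l * (K * real n)"
            using l0 K e n1 powr_mono[of "1 - 2 * e" 1 "real n"] by (intro mult_left_mono) auto
          finally show "4 * real m / freq m \<le> 8 * real k * branching * l * real n" by (simp add: K_def mult_ac)
          have "real n powr (e/2) / (64 * K * l) = (d\<^sup>2 * (real n powr e / K)) / (64 * l)"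
          proof -
            have "d\<^sup>2 * real n powr e = real n powr (e/2)"
              unfolding d_def by (simp add: power2_eq_square powr_add[symmetric])
            then show ?thesis using K l0 by (simp add: field_simps)
          qed
          also have "\<dots> \<le> (d\<^sup>2 * (real r * freq m)) / (64 * m)"
            using rf[OF r] ml m1 f0 l0 by (intro frac_le mult_left_mono) auto
          finally show "exp (- (d\<^sup>2 * (real r * freq m) / (64 * real m))) \<le> exp (- (real n powr (e/2) / (64 * K * l)))"
            by simp
        qed (use l0 b1 f0 in auto)
        finally show "real (card {w \<in> reduced_words r. \<not> equidistributed w m (2 * d)}) \<le> ?c * real (card (reduced_words r))" .
      qed
      moreover have "\<bar>?c\<bar> = ?c" using l0 b1 by (intro abs_of_nonneg mult_nonneg_nonneg) auto
      moreover have "64 * K * l = 128 * real k * branching * l" by (simp add: K_def)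
      ultimately show "real (card {xs \<in> words n. real n powr (1 - e) \<le> real (length (reduce xs)) \<and>
        \<not> equidistributed (reduce xs) m (2 * real n powr (-e/4))}) \<le>
      8 * real k * branching * (ln (real n) + 2) * real n *
        exp (- (real n powr (e/2) / (128 * real k * branching * (ln (real n) + 2)))) * (2 * real k) ^ n"
        by (simp only: l_def d_def)
    qed
  qed
qed

text \<open>The exponent \<open>n \<sigma>\<^sup>2 - \<sigma> n powr (3/4)\<close> is minimal at the chosen \<open>\<sigma>\<close>.\<close>

lemma card_long_reduction_power:
  assumes n: "n \<ge> 1"
  shows "real (card {xs \<in> words n. (real k - 1) / real k * real n + real n powr (3/4) \<le> real (length (reduce xs))}) \<le>
    (1 + 3 * real n) * exp (- (real n powr (1/2) / 4)) * (2 * real k) ^ n"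
proof -
  define \<sigma> where "\<sigma> = real n powr (-1/4) / 2"
  have n0: "real n > 0" using n by simp
  have p1: "real n powr (-1/4) \<le> 1" using powr_mono[of "-1/4" 0 "real n"] n by simp
  have \<sigma>: "0 \<le> \<sigma>" "\<sigma> \<le> 1" using p1 by (auto simp: \<sigma>_def)
  have "exp \<sigma> \<le> exp 1" using \<sigma> by simp
  from order_trans[OF this exp_le] have e3: "exp \<sigma> \<le> 3" .
  let ?a = "(real k - 1) / real k"
  have "n * \<sigma>\<^sup>2 = real n powr (1/2) / 4"
  proof -
    have "real n * (real n powr (-1/4) * real n powr (-1/4)) = real n powr 1 * real n powr (-1/2)"
      using n0 by (simp add: powr_add[symmetric])
    also have "\<dots> = real n powr (1/2)" by (simp only: powr_add[symmetric]) simp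
    finally show ?thesis by (simp add: \<sigma>_def power2_eq_square)
  qed
  moreover have "\<sigma> * real n powr (3/4) = real n powr (1/2) / 2"
    by (simp add: \<sigma>_def powr_add[symmetric])
  ultimately have ex: "n * (?a * \<sigma> + \<sigma>\<^sup>2) - \<sigma> * (?a * real n + real n powr (3/4)) = - (real n powr (1/2) / 4)"
    by (simp add: algebra_simps)
  have "real (card {xs \<in> words n. ?a * real n + real n powr (3/4) \<le> real (length (reduce xs))}) \<le>
    (2 * real k) ^ n * ((1 + n * exp \<sigma>) * exp (- (real n powr (1/2) / 4)))"
    using card_long_reduction[OF \<sigma>, of n "?a * real n + real n powr (3/4)"] unfolding ex .
  also have "\<dots> \<le> (2 * real k) ^ n * ((1 + 3 * real n) * exp (- (real n powr (1/2) / 4)))"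
    using e3 n0 by (intro mult_left_mono mult_right_mono) (auto simp: mult.commute)
  finally show ?thesis by (simp add: mult_ac)
qed

definition failure_bound :: "real \<Rightarrow> nat \<Rightarrow> real" where
  "failure_bound e n = (1 + 3 * real n) * exp (- (real n powr (1/2) / 4)) +
     16 * real k * branching * (ln (real n) + 2) * real n *
       exp (- (real n powr (e/2) / (128 * real k * branching * (ln (real n) + 2))))"

text \<open>Reduced words shorter than \<open>n powr (1 - e)\<close> need no equidistribution, as the trivial estimate by
a multiple of the length is good enough for them. For \<open>k = 1\<close> all words of typical length are of this kind.\<close>

definition typical :: "real \<Rightarrow> nat \<Rightarrow> 'a list \<Rightarrow> bool" where
  "typical e n w \<longleftrightarrow> real (length w) \<le> (real k - 1) / real k * real n + real n powr (3/4) \<and>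
     (k \<ge> 2 \<longrightarrow> real n powr (1 - e) \<le> real (length w) \<longrightarrow>
       equidistributed w (block_length e n + 2) (2 * real n powr (-e/4)) \<and>
       equidistributed w (2 * block_length e n + 2) (2 * real n powr (-e/4)))"

lemma eventually_card_not_typical:
  fixes e :: real
  assumes e: "0 < e" "e < 1/4"
  shows "eventually (\<lambda>n. real (card {xs \<in> words n. \<not> typical e n (reduce xs)}) \<le>
     failure_bound e n * (2 * real k) ^ n) sequentially"
proof -
  have ev: "eventually (\<lambda>n. k \<ge> 2 \<longrightarrow> (\<forall>m\<in>{block_length e n + 2, 2 * block_length e n + 2}.
    real (card {xs \<in> words n. real n powr (1 - e) \<le> real (length (reduce xs)) \<and>
        \<not> equidistributed (reduce xs) m (2 * real n powr (-e/4))}) \<le>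
      8 * real k * branching * (ln (real n) + 2) * real n *
        exp (- (real n powr (e/2) / (128 * real k * branching * (ln (real n) + 2)))) * (2 * real k) ^ n)) sequentially"
    using eventually_card_not_equidistributed[OF e] by (cases "k \<ge> 2") auto
  show ?thesis using ev eventually_ge_at_top[of "1::nat"]
  proof eventually_elim
    case (elim n)
    have n1: "n \<ge> 1" using elim by simp
    let ?A = "{xs \<in> words n. (real k - 1) / real k * real n + real n powr (3/4) \<le> real (length (reduce xs))}"
    let ?B = "\<lambda>m. if k \<ge> 2 then {xs \<in> words n. real n powr (1 - e) \<le> real (length (reduce xs)) \<and>
        \<not> equidistributed (reduce xs) m (2 * real n powr (-e/4))} else {}"
    let ?c = "8 * real k * branching * (ln (real n) + 2) * real n *
        exp (- (real n powr (e/2) / (128 * real k * branching * (ln (real n) + 2)))) * (2 * real k) ^ n"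
    have "0 \<le> ln (real n)" using n1 by simp
    then have c0: "0 \<le> ?c" using branching_ge_1 by (intro mult_nonneg_nonneg) auto
    have B: "real (card (?B m)) \<le> ?c" if "m \<in> {block_length e n + 2, 2 * block_length e n + 2}" for m
      using elim(1) that c0 by (cases "k \<ge> 2") auto
    have "{xs \<in> words n. \<not> typical e n (reduce xs)} \<subseteq>
      ?A \<union> (?B (block_length e n + 2) \<union> ?B (2 * block_length e n + 2))"
      by (auto simp: typical_def)
    then have "card {xs \<in> words n. \<not> typical e n (reduce xs)} \<le>
       card (?A \<union> (?B (block_length e n + 2) \<union> ?B (2 * block_length e n + 2)))"
      by (rule card_mono[rotated]) (auto simp: finite_words)
    also have "\<dots> \<le> card ?A + (card (?B (block_length e n + 2)) + card (?B (2 * block_length e n + 2)))"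
      by (intro order_trans[OF card_Un_le] add_left_mono card_Un_le)
    finally have "real (card {xs \<in> words n. \<not> typical e n (reduce xs)}) \<le>
       real (card ?A) + (real (card (?B (block_length e n + 2))) + real (card (?B (2 * block_length e n + 2))))"
      by linarith
    also have "\<dots> \<le> (1 + 3 * real n) * exp (- (real n powr (1/2) / 4)) * (2 * real k) ^ n + (?c + ?c)"
      by (intro add_mono card_long_reduction_power[OF n1] B) auto
    also have "\<dots> = failure_bound e n * (2 * real k) ^ n"
      by (simp add: failure_bound_def algebra_simps)
    finally show ?case .
  qed
qed

end

context group
begin

text \<open>The parameter \<open>e\<close> is chosen so small that shortening the blocks by the factor \<open>1 - 2e\<close> uses up
less than \<open>\<epsilon>\<close>.\<close>

lemma eventually_scl_typical:
  fixes \<epsilon> :: real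
  assumes gen: "symmetric_generating_set G S" and fin: "finite S" and card: "card S = 2 * k" and k: "k \<ge> 1"
    and \<epsilon>: "\<epsilon> > 0"
  shows "\<exists>e. 0 < e \<and> e < 1/4 \<and> eventually (\<lambda>n. \<forall>w. set w \<subseteq> S \<longrightarrow>
      involutive_alphabet.reduced (m_inv G) w \<longrightarrow> length w \<le> n \<longrightarrow>
      list_prod G w \<in> derived G (carrier G) \<longrightarrow> involutive_alphabet.typical S (m_inv G) k e n w \<longrightarrow>
      scl G (list_prod G w) \<le> ((real k - 1) * ln (2 * real k - 1) + \<epsilon>) / (6 * real k) * (real n / ln (real n))) sequentially"
proof -
  have alph: "involutive_alphabet S (m_inv G) k" by (rule symmetric_alphabet[OF gen fin card k])
  interpret A: involutive_alphabet S "m_inv G" k by (rule alph)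
  have S: "S \<subseteq> carrier G" using gen by (simp add: symmetric_generating_set_def)
  obtain C where C: "C \<ge> 0" and dual: "\<And>v B. v \<in> derived G (carrier G) \<Longrightarrow>
     (\<And>\<phi>. tame_cochain S C \<phi> \<Longrightarrow> \<phi> v \<le> B) \<Longrightarrow> scl G v \<le> (B + 1) / 4"
    using scl_duality[OF gen fin] by blast
  define a where "a = (real k - 1) / real k"
  define B where "B = ln A.branching"
  define D where "D = a * B + \<epsilon> / real k"
  have k0: "real k > 0" using k by simp
  have a0: "0 \<le> a" using k by (simp add: a_def)
  have B0: "0 \<le> B" using A.branching_ge_1 by (simp add: B_def)
  have D: "D > a * B" "D > 0" "0 \<le> a * B" using \<epsilon> k0 a0 B0 by (auto simp: D_def add_nonneg_pos)
  have target: "((real k - 1) * ln (2 * real k - 1) + \<epsilon>) / (6 * real k) = D / 6"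
    using k0 by (simp add: D_def a_def B_def A.branching_def field_simps)
  define e where "e = min (1/8) ((D - a * B) / (4 * D))"
  have e: "0 < e" "e < 1/4" using D by (auto simp: e_def)
  have De: "a * B / (1 - 2 * e) < D"
  proof -
    have "e * (4 * D) \<le> D - a * B" using D by (simp add: e_def pos_le_divide_eq[symmetric])
    moreover have "0 < e * D" using e D by simp
    ultimately have "a * B < D * (1 - 2 * e)" by (simp add: algebra_simps)
    then show ?thesis using e by (simp add: divide_less_eq)
  qed
  have small_scl: "scl G (list_prod G w) \<le> ((C + 1) * R + 1) / 4"
    if "set w \<subseteq> S" "list_prod G w \<in> derived G (carrier G)" "real (length w) \<le> R" for w R
  proof (rule dual[OF that(2)])
    fix \<phi> assume "tame_cochain S C \<phi>"
    then have "\<phi> (list_prod G w) \<le> (C + 1) * length w"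
      using tame_cochain_word[OF _ S that(1) C] by fastforce
    also have "\<dots> \<le> (C + 1) * R" using that(3) C by (intro mult_left_mono) auto
    finally show "\<phi> (list_prod G w) \<le> (C + 1) * R" .
  qed
  note small = asymp_small_term[OF e D(2) C]
  have "eventually (\<lambda>n. \<forall>w. set w \<subseteq> S \<longrightarrow> A.reduced w \<longrightarrow> length w \<le> n \<longrightarrow>
      list_prod G w \<in> derived G (carrier G) \<longrightarrow> A.typical e n w \<longrightarrow>
      scl G (list_prod G w) \<le> D / 6 * (real n / ln (real n))) sequentially"
  proof (cases "k \<ge> 2")
    case False
    then have k1: "k = 1" using k by simp
    have "eventually (\<lambda>n::nat. real n powr (3/4) \<le> real n powr (1 - e)) sequentially"
      by (rule asymp_conditions(6)[OF e, of 1 1]) auto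
    then show ?thesis using small
    proof eventually_elim
      case (elim n)
      show ?case
      proof (intro allI impI)
        fix w assume w: "set w \<subseteq> S" "list_prod G w \<in> derived G (carrier G)" "A.typical e n w"
        have "real (length w) \<le> real n powr (1 - e)" using w(3)[unfolded A.typical_def] elim(1) k1 by simp
        from small_scl[OF w(1,2) this] elim(2)
        show "scl G (list_prod G w) \<le> D / 6 * (real n / ln (real n))" by linarith
      qed
    qed
  next
    case k2: True
    have B1: "B > 0" using k2 by (simp add: B_def A.branching_def)
    have a1: "a > 0" using k2 by (simp add: a_def)
    show ?thesis
      using small asymp_main_term[OF e B1 a1 C De] asymp_conditions[OF e k0 B1] eventually_ge_at_top[of "1::nat"]
    proof eventually_elim
      case (elim n)
      define L where "L = A.block_length e n"
      define d where "d = real n powr (-e/4)"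
      have n1: "n \<ge> 1" and n0: "real n > 0" using elim by auto
      note LB = A.block_length_bounds[OF e n1 k2, folded L_def B_def]
      have x2: "2 \<le> (1/2 - e) * ln (real n) / B" using elim(6) .
      have L1: "real L \<ge> 1" using LB(1) x2 by linarith
      have d: "0 < d" "2 * d \<le> 1" using elim(7) n0 by (auto simp: d_def)
      have ln0: "0 \<le> ln (real n)" using n1 by simp
      show ?case
      proof (intro allI impI)
        fix w assume w: "set w \<subseteq> S" "A.reduced w" "length w \<le> n" "list_prod G w \<in> derived G (carrier G)" "A.typical e n w"
        let ?r = "real (length w)"
        show "scl G (list_prod G w) \<le> D / 6 * (real n / ln (real n))"
        proof (cases "real n powr (1 - e) \<le> ?r")
          case False
          then have "?r \<le> real n powr (1 - e)" by simp
          from small_scl[OF w(1,4) this] elim(1) show ?thesis by linarith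
        next
          case True
          have eq: "A.equidistributed w (L + 2) (2 * d)" "A.equidistributed w (2 * L + 2) (2 * d)"
            using w(5) True k2 by (auto simp: A.typical_def L_def d_def)
          have r_le: "?r \<le> a * real n + real n powr (3/4)" using w(5) by (simp add: A.typical_def a_def)
          have Ln: "L \<ge> 1" using L1 by simp
          have Lw: "L + 1 < length w"
          proof -
            have "8 * (ln (real n) + 2) \<le> ?r" using elim(3) True by linarith
            then have "real (L + 1) < ?r" using LB(2) ln0 by simp
            then show ?thesis by (simp only: of_nat_less_iff)
          qed
          let ?U = "(1 + 2 * d) * (1 + 8 * d) * (a * real n + real n powr (3/4)) /
              (3 * ((1/2 - e) * ln (real n) / B - 1)) + 4 + (C + 1) * (ln (real n) + 2)
              + 2 * d * (C + 1) * real n"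
          have "scl G (list_prod G w) \<le> (?U + 1) / 4"
          proof (rule dual[OF w(4)])
            fix \<phi> assume \<phi>: "tame_cochain S C \<phi>"
            have "\<phi> (list_prod G w) \<le> (1 + 2 * d) * (1 + 4 * (2 * d)) * ?r / (3 * L) + 2 * (1 + 2 * d)
              + (C + 1) * (L + 1) + 2 * d * (C + 1) * ?r"
              by (rule tame_cochain_equidistributed[OF alph S k2 \<phi> C w(1,2) Ln Lw _ d(2) eq]) (use d in simp)
            also have "\<dots> \<le> ?U"
            proof (intro add_mono)
              have "(1 + 2 * d) * (1 + 4 * (2 * d)) * ?r \<le> (1 + 2 * d) * (1 + 8 * d) * (a * real n + real n powr (3/4))"
                using r_le d by (intro mult_mono) auto
              then show "(1 + 2 * d) * (1 + 4 * (2 * d)) * ?r / (3 * L) \<le>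
                (1 + 2 * d) * (1 + 8 * d) * (a * real n + real n powr (3/4)) / (3 * ((1/2 - e) * ln (real n) / B - 1))"
                using LB(1) x2 d a0 by (intro frac_le mult_nonneg_nonneg add_nonneg_nonneg) auto
              show "2 * (1 + 2 * d) \<le> 4" using d by simp
              show "(C + 1) * (L + 1) \<le> (C + 1) * (ln (real n) + 2)"
                using LB(2) ln0 C by (intro mult_left_mono) auto
              show "2 * d * (C + 1) * ?r \<le> 2 * d * (C + 1) * real n"
                using w(3) d C by (intro mult_left_mono) auto
            qed
            finally show "\<phi> (list_prod G w) \<le> ?U" .
          qed
          also have "\<dots> \<le> D / 6 * (real n / ln (real n))" using elim(2) unfolding d_def .
          finally show ?thesis .
        qed
      qed
    qed
  qed
  with e show ?thesis unfolding target by blast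
qed

text \<open>The probability of failure under the condition is at most the unconditioned one times the
reciprocal of the probability of the condition, which is at most \<open>(n/2 + 1) ^ (2k)\<close>.\<close>

lemma scl_tail:
  fixes \<epsilon> :: real
  assumes gen: "symmetric_generating_set G S" and fin: "finite S" and card: "card S = 2 * k" and k: "k \<ge> 1"
    and \<epsilon>: "\<epsilon> > 0"
  defines "bound \<equiv> \<lambda>n::nat. ((real k - 1) * ln (2 * real k - 1) + \<epsilon>) / (6 * real k) * (real n / ln (real n))"
  shows "\<exists>c>0. (\<lambda>n::nat. 1 - \<P>(g in random_walk G S n. scl G g \<le> bound n \<bar> g \<in> commutator_subgroup G))
      \<in> O[inf sequentially (principal {n. even n})](\<lambda>n. exp (- (real n powr c)))"
proof -
  have alph: "involutive_alphabet S (m_inv G) k" by (rule symmetric_alphabet[OF gen fin card k])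
  interpret A: involutive_alphabet S "m_inv G" k by (rule alph)
  have S: "S \<subseteq> carrier G" using gen by (simp add: symmetric_generating_set_def)
  obtain e where e: "0 < e" "e < 1/4" and good: "eventually (\<lambda>n. \<forall>w. set w \<subseteq> S \<longrightarrow>
      A.reduced w \<longrightarrow> length w \<le> n \<longrightarrow>
      list_prod G w \<in> derived G (carrier G) \<longrightarrow> A.typical e n w \<longrightarrow>
      scl G (list_prod G w) \<le> bound n) sequentially"
    using eventually_scl_typical[OF gen fin card k \<epsilon>] unfolding bound_def by blast
  define f where "f n = 1 - \<P>(g in random_walk G S n. scl G g \<le> bound n \<bar> g \<in> commutator_subgroup G)" for n
  define g where "g n = (real n / 2 + 1) ^ (2 * k) * A.failure_bound e n" for n
  have "eventually (\<lambda>n. even n \<longrightarrow> norm (f n) \<le> norm (g n)) sequentially"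
    using good A.eventually_card_not_typical[OF e]
  proof eventually_elim
    case (elim n)
    show ?case
    proof
      assume "even n"
      then obtain m where m: "n = 2 * m" by (elim evenE)
      let ?N = "(2 * real k) ^ n" and ?H = "commutator_subgroup G"
      define h where "h = real (card {xs \<in> A.words n. list_prod G xs \<in> ?H})"
      define q where "q = real (card {xs \<in> A.words n. list_prod G xs \<in> {g. scl G g \<le> bound n \<and> g \<in> ?H}})"
      have N0: "?N > 0" using k by simp
      have ret: "?N \<le> h * (real n / 2 + 1) ^ (2 * k)"
        using card_words_in_derived[OF alph S, of m] by (simp add: h_def m)
      then have h0: "h > 0" using N0 by (cases "h = 0") (auto simp: h_def)
      have fn: "f n = (h - q) / h"
      proof -
        have "f n = 1 - (q / ?N) / (h / ?N)"
          by (simp add: f_def cond_prob_def random_walk_prob[OF alph] h_def q_def)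
        also have "\<dots> = (h - q) / h"
        proof -
          have "1 - (q / N) / (h / N) = (h - q) / h" if "N > 0" for N using that h0 by (simp add: field_simps)
          from this[OF N0] show ?thesis .
        qed
        finally show ?thesis .
      qed
      have hq: "h - q = real (card {xs \<in> A.words n. list_prod G xs \<in> ?H \<and> \<not> scl G (list_prod G xs) \<le> bound n})"
      proof -
        have "{xs \<in> A.words n. list_prod G xs \<in> ?H} =
          {xs \<in> A.words n. list_prod G xs \<in> {g. scl G g \<le> bound n \<and> g \<in> ?H}} \<union>
          {xs \<in> A.words n. list_prod G xs \<in> ?H \<and> \<not> scl G (list_prod G xs) \<le> bound n}" by auto
        moreover have "card \<dots> = card {xs \<in> A.words n. list_prod G xs \<in> {g. scl G g \<le> bound n \<and> g \<in> ?H}} +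
          card {xs \<in> A.words n. list_prod G xs \<in> ?H \<and> \<not> scl G (list_prod G xs) \<le> bound n}"
          by (rule card_Un_disjoint) (auto simp: A.finite_words)
        ultimately show ?thesis by (simp add: h_def q_def)
      qed
      have "{xs \<in> A.words n. list_prod G xs \<in> ?H \<and> \<not> scl G (list_prod G xs) \<le> bound n} \<subseteq>
        {xs \<in> A.words n. \<not> A.typical e n (A.reduce xs)}"
      proof
        fix xs assume xs: "xs \<in> {xs \<in> A.words n. list_prod G xs \<in> ?H \<and> \<not> scl G (list_prod G xs) \<le> bound n}"
        then have w: "set xs \<subseteq> S" "length xs = n" by (auto simp: A.words_def)
        have "list_prod G (A.reduce xs) = list_prod G xs" by (rule list_prod_reduce[OF alph S w(1)])
        moreover have "set (A.reduce xs) \<subseteq> S" "A.reduced (A.reduce xs)"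
          using A.reduce_red_lang[OF w(1)] by (auto simp: A.red_lang_def)
        moreover have "length (A.reduce xs) \<le> n" using A.length_reduce[of xs] w by simp
        ultimately show "xs \<in> {xs \<in> A.words n. \<not> A.typical e n (A.reduce xs)}"
          using elim(1) xs by (metis (mono_tags, lifting) mem_Collect_eq)
      qed
      then have "card {xs \<in> A.words n. list_prod G xs \<in> ?H \<and> \<not> scl G (list_prod G xs) \<le> bound n} \<le>
        card {xs \<in> A.words n. \<not> A.typical e n (A.reduce xs)}"
        by (rule card_mono[rotated]) (auto simp: A.finite_words)
      then have u: "h - q \<le> A.failure_bound e n * ?N" using elim(2) unfolding hq by linarith
      have hq0: "0 \<le> h - q" unfolding hq by simp
      then have "0 \<le> A.failure_bound e n * ?N" using u by linarith
      then have fb0: "0 \<le> A.failure_bound e n" using N0 by (simp add: zero_le_mult_iff)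
      have "h - q \<le> A.failure_bound e n * (h * (real n / 2 + 1) ^ (2 * k))"
        using u mult_left_mono[OF ret fb0] by linarith
      then have "(h - q) / h \<le> g n" using h0 by (simp add: g_def divide_le_eq mult_ac)
      moreover have "0 \<le> (h - q) / h" using hq0 h0 by simp
      ultimately show "norm (f n) \<le> norm (g n)" unfolding fn by simp
    qed
  qed
  then have "eventually (\<lambda>n. norm (f n) \<le> norm (g n)) (inf sequentially (principal {n. even n}))"
    unfolding eventually_inf_principal by simp
  then have fg: "f \<in> O[inf sequentially (principal {n. even n})](g)"
    by (intro landau_o.big_mono)
  have K: "0 < 128 * real k * A.branching" "0 < 16 * real k * A.branching"
    using A.branching_ge_1 k by auto
  have "g \<in> O(\<lambda>n. exp (- (real n powr (e/4))))"
    using asymp_failure[OF e K, of "2 * k"] unfolding g_def A.failure_bound_def .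
  then have "g \<in> O[inf sequentially (principal {n. even n})](\<lambda>n. exp (- (real n powr (e/4))))"
    by (rule landau_o.big.filter_mono[rotated]) simp
  from landau_o.big_trans[OF fg this]
  show ?thesis unfolding f_def using e by (intro exI[of _ "e/4"]) auto
qed

end

theorem mainTheorem2:
  fixes G :: "('a, 'b) monoid_scheme" and S :: "'a set" and k :: nat and \<epsilon> :: real
  assumes "group G"
    and "symmetric_generating_set G S"
    and "finite S" and "card S = 2 * k" and "k \<ge> 1"
    and "\<epsilon> > 0"
  shows "\<exists>C\<^sub>1 C\<^sub>2 :: real. C\<^sub>1 > 1 \<and> C\<^sub>2 > 0 \<and>
    (\<lambda>n::nat. 1 - \<P>(g in random_walk G S n.
         scl G g \<le> ((real k - 1) * ln (2 * real k - 1) + \<epsilon>) / (6 * real k) * (real n / ln (real n))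
         \<bar> g \<in> commutator_subgroup G))
      \<in> O[inf sequentially (principal {n. even n})](\<lambda>n. C\<^sub>1 powr (- (real n powr C\<^sub>2)))"
proof -
  obtain c where c: "c > 0" "(\<lambda>n::nat. 1 - \<P>(g in random_walk G S n.
         scl G g \<le> ((real k - 1) * ln (2 * real k - 1) + \<epsilon>) / (6 * real k) * (real n / ln (real n))
         \<bar> g \<in> commutator_subgroup G))
      \<in> O[inf sequentially (principal {n. even n})](\<lambda>n. exp (- (real n powr c)))"
    using group.scl_tail[OF assms] by blast
  have "exp 1 powr x = exp x" for x :: real by (simp add: powr_def)
  with c show ?thesis by (intro exI[of _ "exp 1"] exI[of _ c]) simp
qed

end
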